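(* Let $(\mathcal X,\Gamma)$ be a topological local diffusion space, let $\ell$ be a strong lifting, and let $\mu$ be a probability measure on $(\Upsilon,\Sigma_{\mathrm v})$ satisfying the assumption (GNZ) stated in the context for the pointwise defined square field operator $(\hat\Gamma_\ell,\mathcal D)$, $\hat\Gamma_\ell(f,g):=\ell(\Gamma(f,g))$. Then the form $$\mathcal E^{\Upsilon,\mu}_\ell(u,v)=\int_\Upsilon \Gamma^\Upsilon_\ell(u,v)\,d\mu,\qquad u,v\in \mathrm{Cyl}_\mu(\mathcal D),$$ is well-defined (on $\mu$-classes), densely defined and closable on $L^2(\mu)$, and (together with its closure) it is independent of $\ell$.
   Context: A topological local structure $\mathcal X=(X,\tau,\Sigma,\mathsf m,\mathscr E)$ consists of a non-empty completely regular Hausdorff Luzin space $(X,\tau)$ (a continuous bijective image of a Polish space), a $\sigma$-algebra $\Sigma$ with $\mathscr B_\tau\subset\Sigma\subset\mathscr B_\tau^{\mathsf m}$ (Borel $\sigma$-algebra and its $\mathsf m$-completion) that contains all singletons and is, up to $\mathsf m$-null sets, countably generated, a $\sigma$-finite atomless Radon measure $\mathsf m$ on $\Sigma$ with full $\tau$-support, and a localizing ring $\mathscr E$: a family $\mathscr E\subset\{A\in\Sigma:\mathsf mA<\infty\}$ closed under finite unions and intersections, with $A\cap E\in\mathscr E$ for $A\in\Sigma$, $E\in\mathscr E$, such that $\mathscr E=\bigcup_h\{A\cap E_h:A\in\Sigma\}$ for some sequence $E_h\uparrow X$ in $\Sigma$ with $\mathsf mE_h<\infty$ (a localizing sequence),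 and such that every $x\in X$ has a $\tau$-neighbourhood in $\mathscr E$. $\mathcal C_0(\mathscr E)$ (resp. $\Sigma_b(\mathscr E)$) is the space of bounded $\tau$-continuous (resp. bounded $\Sigma$-measurable) real functions vanishing outside some $E\in\mathscr E$. $\mathcal C_b^\infty(\mathbb R^k)$ is the space of bounded smooth functions with bounded derivatives of all orders. A topological local diffusion space $(\mathcal X,\Gamma)$ is a topological local structure with a square field operator $(\Gamma,\mathcal D)$: $\mathcal D\subset\mathcal C_0(\mathscr E)$ is an algebra generating $\tau$ (functions identified with their $\mathsf m$-classes) with $\varphi\circ\mathbf f-\varphi(0)\in\mathcal D$ for $\mathbf f\in\mathcal D^k$, $\varphi\in\mathcal C_b^\infty(\mathbb R^k)$; $\Gamma:\mathcal D\times\mathcal D\to L^\infty(\mathsf m)$ is symmetric, bilinear, non-negative definite, takes values in $\mathsf m$-classes of functions in $\Sigma_b(\mathscr E)$, and satisfies $\Gamma(\varphi\circ\mathbf f-\varphi(0),\psi\circ\mathbf g-\psi(0))=\sum_{i,j}(\partial_i\varphi)(\mathbf f)(\partial_j\psi)(\mathbf g)\Gamma(f_i,g_j)$ $\mathsf m$-a.e.; the form $\mathcal E^{X,\mathsf m}(f,g)=\int\Gamma(f,g)\,d\mathsf m$ on $\mathcal D$ is closable and densely defined in $L^2(\mathsf m)$, and its closure is a quasi-regular Dirichlet form. A strong lifting is a map $\ell:L^\infty(\mathsf m)\to\mathcal L^\infty(\mathsf m)$ (bounded $\Sigma$-measurable functions) which is linear, multiplicative, order preserving, with $\ell(1)=1$,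 $[\ell(f)]_{\mathsf m}=f$, and $\ell(\varphi)=\varphi$ for $\varphi\in\mathcal C_b(X)$. $\Upsilon$ is the set of all $\gamma=\sum_{i\le N}\delta_{x_i}$, $N\in\mathbb N_0\cup\{\infty\}$, $x_i\in X$ (repetitions allowed), with $\gamma E<\infty$ for all $E\in\mathscr E$; $\Sigma_{\mathrm v}$ is the $\sigma$-algebra generated by $\gamma\mapsto\gamma E$, $E\in\mathscr E$. For a function $f$ put $f^\star\gamma=\int f\,d\gamma$. $\mathrm{Cyl}(\mathcal D)$ is the space of functions $u=F(f_1^\star,\dots,f_k^\star)$, $k\in\mathbb N_0$, $F\in\mathcal C_b^\infty(\mathbb R^k)$, $f_i\in\mathcal D$; $\mathrm{Cyl}_\mu(\mathcal D)$ is the space of their $\mu$-classes. For $u=F(f_1^\star,\dots,f_k^\star)$, $v=G(g_1^\star,\dots,g_m^\star)$, $$\Gamma^\Upsilon_\ell(u,v)(\gamma)=\sum_{i,j}\partial_iF(f_1^\star\gamma,\dots,f_k^\star\gamma)\,\partial_jG(g_1^\star\gamma,\dots,g_m^\star\gamma)\int\ell(\Gamma(f_i,g_j))\,d\gamma .$$ Assumption (GNZ) on $\mu$: (a) the intensity $\mathsf m_\mu A:=\int\gamma A\,d\mu(\gamma)$ is finite for every $A\in\mathscr E$; (b) there is a $\Sigma_{\mathrm v}\otimes\Sigma$-measurable $\rho:\Upsilon\times X\to\mathbb R_+$ with $$\int_\Upsilon\int_X u(\gamma,x)\,d\gamma(x)\,d\mu(\gamma)=\int_\Upsilon\int_X u(\gamma+\delta_x,x)\,\rho(\gamma,x)\,d\mathsf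 m(x)\,d\mu(\gamma)$$ for all semi-bounded measurable $u:\Upsilon\times X\to\mathbb R$; (c) setting $d\mathsf m_\gamma=\rho(\gamma,\cdot)\,d\mathsf m$, for $\mu$-a.e. $\gamma$ one has $\hat\Gamma_\ell(f,g)=0$ $\mathsf m_\gamma$-a.e. for all $g\in\mathcal D$ whenever $f\in\mathcal D$ vanishes $\mathsf m_\gamma$-a.e.; (d) there is an $\mathsf m_\mu$-integrable $w:X\to(0,1]$ such that for $\mu$-a.e. $\gamma$ the form $(f,g)\mapsto\int_X\Gamma(f,g)\,w\,d\mathsf m_\gamma$ on $\mathcal D$ is closable on $L^2(w\cdot\mathsf m_\gamma)$. *)

theory Defs
  imports "HOL-Probability.Probability"
begin

section \<open>Smooth functions of finitely many variables\<close>

text \<open>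
  A function on \<open>\<real>\<^sup>k\<close>, for a \<open>k\<close> that is quantified inside definitions, is encoded as a function
  on \<open>nat \<Rightarrow> real\<close> that depends only on the coordinates \<open>i < k\<close>.  For such functions, continuity
  with respect to the product topology is continuity on \<open>\<real>\<^sup>k\<close>.
\<close>

definition partial_deriv :: "nat \<Rightarrow> ((nat \<Rightarrow> real) \<Rightarrow> real) \<Rightarrow> (nat \<Rightarrow> real) \<Rightarrow> real" where
  "partial_deriv i F x = deriv (\<lambda>t. F (x(i := t))) (x i)"

text \<open>\<open>C\<^sub>b\<^sup>\<infinity>(\<real>\<^sup>k)\<close>: all iterated partial derivatives (the empty list is \<open>F\<close> itself) exist, are
  continuous and are bounded.\<close>

definition Cb_smooth :: "nat \<Rightarrow> ((nat \<Rightarrow> real) \<Rightarrow> real) set" where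
  "Cb_smooth k = {F.
     (\<forall>x y. (\<forall>i<k. x i = y i) \<longrightarrow> F x = F y) \<and>
     (\<forall>js. set js \<subseteq> {..<k} \<longrightarrow>
        continuous_on UNIV (foldr partial_deriv js F) \<and>
        bounded (range (foldr partial_deriv js F)) \<and>
        (\<forall>i<k. \<forall>x. (\<lambda>t. foldr partial_deriv js F (x(i := t))) differentiable (at (x i))))}"

section \<open>Forms on \<open>L\<^sup>2\<close>\<close>

text \<open>
  Elements of \<open>L\<^sup>2(M)\<close> are handled through representatives: a form on \<open>L\<^sup>2(M)\<close> is a set \<open>D\<close> of
  square-integrable functions together with \<open>Q :: _ \<Rightarrow> _ \<Rightarrow> real\<close>, relevant on \<open>D \<times> D\<close> only.
\<close>

definition L2 :: "'b measure \<Rightarrow> ('b \<Rightarrow> real) set" where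
  "L2 M = {f \<in> borel_measurable M. integrable M (\<lambda>x. (f x)\<^sup>2)}"

definition L2_tendsto :: "'b measure \<Rightarrow> (nat \<Rightarrow> 'b \<Rightarrow> real) \<Rightarrow> ('b \<Rightarrow> real) \<Rightarrow> bool" where
  "L2_tendsto M u v \<longleftrightarrow> (\<lambda>n. \<integral>\<^sup>+x. ennreal ((u n x - v x)\<^sup>2) \<partial>M) \<longlonglongrightarrow> 0"

definition L2_dense :: "'b measure \<Rightarrow> ('b \<Rightarrow> real) set \<Rightarrow> bool" where
  "L2_dense M D \<longleftrightarrow> D \<subseteq> L2 M \<and> (\<forall>v\<in>L2 M. \<exists>u. (\<forall>n. u n \<in> D) \<and> L2_tendsto M u v)"

text \<open>Symmetric, bilinear, non-negative definite forms.\<close>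

definition form_on_L2 ::
    "'b measure \<Rightarrow> ('b \<Rightarrow> real) set \<Rightarrow> (('b \<Rightarrow> real) \<Rightarrow> ('b \<Rightarrow> real) \<Rightarrow> real) \<Rightarrow> bool" where
  "form_on_L2 M D Q \<longleftrightarrow>
     D \<subseteq> L2 M \<and> (\<lambda>_. 0) \<in> D \<and>
     (\<forall>u\<in>D. \<forall>v\<in>D. \<forall>a b. (\<lambda>x. a * u x + b * v x) \<in> D) \<and>
     (\<forall>u\<in>D. \<forall>v\<in>D. Q u v = Q v u) \<and>
     (\<forall>u\<in>D. \<forall>v\<in>D. \<forall>z\<in>D. \<forall>a b. Q (\<lambda>x. a * u x + b * v x) z = a * Q u z + b * Q v z) \<and>
     (\<forall>u\<in>D. Q u u \<ge> 0)"

definition form_Cauchy ::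
    "(('b \<Rightarrow> real) \<Rightarrow> ('b \<Rightarrow> real) \<Rightarrow> real) \<Rightarrow> (nat \<Rightarrow> 'b \<Rightarrow> real) \<Rightarrow> bool" where
  "form_Cauchy Q u \<longleftrightarrow>
     (\<forall>e>0. \<exists>N. \<forall>m\<ge>N. \<forall>n\<ge>N. Q (\<lambda>x. u m x - u n x) (\<lambda>x. u m x - u n x) < e)"

definition closable_form ::
    "'b measure \<Rightarrow> ('b \<Rightarrow> real) set \<Rightarrow> (('b \<Rightarrow> real) \<Rightarrow> ('b \<Rightarrow> real) \<Rightarrow> real) \<Rightarrow> bool" where
  "closable_form M D Q \<longleftrightarrow>
     (\<forall>u. (\<forall>n. u n \<in> D) \<and> form_Cauchy Q u \<and> L2_tendsto M u (\<lambda>_. 0)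
        \<longrightarrow> (\<lambda>n. Q (u n) (u n)) \<longlonglongrightarrow> 0)"

definition form_approx ::
    "'b measure \<Rightarrow> ('b \<Rightarrow> real) set \<Rightarrow> (('b \<Rightarrow> real) \<Rightarrow> ('b \<Rightarrow> real) \<Rightarrow> real)
      \<Rightarrow> ('b \<Rightarrow> real) \<Rightarrow> (nat \<Rightarrow> 'b \<Rightarrow> real) \<Rightarrow> bool" where
  "form_approx M D Q v u \<longleftrightarrow> (\<forall>n. u n \<in> D) \<and> form_Cauchy Q u \<and> L2_tendsto M u v"

definition closure_dom ::
    "'b measure \<Rightarrow> ('b \<Rightarrow> real) set \<Rightarrow> (('b \<Rightarrow> real) \<Rightarrow> ('b \<Rightarrow> real) \<Rightarrow> real)
      \<Rightarrow> ('b \<Rightarrow> real) set" where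
  "closure_dom M D Q = {v \<in> L2 M. \<exists>u. form_approx M D Q v u}"

text \<open>Meaningful for closable forms, where the limit does not depend on the approximations.\<close>

definition closure_form ::
    "'b measure \<Rightarrow> ('b \<Rightarrow> real) set \<Rightarrow> (('b \<Rightarrow> real) \<Rightarrow> ('b \<Rightarrow> real) \<Rightarrow> real)
      \<Rightarrow> ('b \<Rightarrow> real) \<Rightarrow> ('b \<Rightarrow> real) \<Rightarrow> real" where
  "closure_form M D Q v w =
     (THE c. \<exists>p q. form_approx M D Q v p \<and> form_approx M D Q w q \<and> (\<lambda>n. Q (p n) (q n)) \<longlonglongrightarrow> c)"

text \<open>Convergence for the norm \<open>Q\<^sub>1(u)\<^sup>1\<^sup>/\<^sup>2\<close>, where \<open>Q\<^sub>1(u) = Q(u, u) + \<parallel>u\<parallel>\<^sup>2\<close>.\<close>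

definition form1_tendsto ::
    "'b measure \<Rightarrow> (('b \<Rightarrow> real) \<Rightarrow> ('b \<Rightarrow> real) \<Rightarrow> real)
      \<Rightarrow> (nat \<Rightarrow> 'b \<Rightarrow> real) \<Rightarrow> ('b \<Rightarrow> real) \<Rightarrow> bool" where
  "form1_tendsto M Q u v \<longleftrightarrow>
     L2_tendsto M u v \<and> (\<lambda>n. Q (\<lambda>x. u n x - v x) (\<lambda>x. u n x - v x)) \<longlonglongrightarrow> 0"

definition form1_dense ::
    "'b measure \<Rightarrow> ('b \<Rightarrow> real) set \<Rightarrow> (('b \<Rightarrow> real) \<Rightarrow> ('b \<Rightarrow> real) \<Rightarrow> real)
      \<Rightarrow> ('b \<Rightarrow> real) set \<Rightarrow> bool" where
  "form1_dense M D Q C \<longleftrightarrow>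
     C \<subseteq> D \<and> (\<forall>v\<in>D. \<exists>u. (\<forall>n. u n \<in> C) \<and> form1_tendsto M Q u v)"

text \<open>By completeness of \<open>L\<^sup>2(M)\<close> a \<open>Q\<^sub>1\<close>-Cauchy sequence has an \<open>L\<^sup>2\<close>-limit; closedness asks it to
  be a \<open>Q\<^sub>1\<close>-limit in the domain.\<close>

definition closed_form ::
    "'b measure \<Rightarrow> ('b \<Rightarrow> real) set \<Rightarrow> (('b \<Rightarrow> real) \<Rightarrow> ('b \<Rightarrow> real) \<Rightarrow> real) \<Rightarrow> bool" where
  "closed_form M D Q \<longleftrightarrow>
     (\<forall>u. \<forall>v\<in>L2 M. (\<forall>n. u n \<in> D) \<and> form_Cauchy Q u \<and> L2_tendsto M u v
        \<longrightarrow> v \<in> D \<and> form1_tendsto M Q u v)"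

definition Dirichlet_form ::
    "'b measure \<Rightarrow> ('b \<Rightarrow> real) set \<Rightarrow> (('b \<Rightarrow> real) \<Rightarrow> ('b \<Rightarrow> real) \<Rightarrow> real) \<Rightarrow> bool" where
  "Dirichlet_form M D Q \<longleftrightarrow>
     form_on_L2 M D Q \<and> L2_dense M D \<and> closed_form M D Q \<and>
     (\<forall>u\<in>D. (\<lambda>x. min (max (u x) 0) 1) \<in> D \<and>
        Q (\<lambda>x. min (max (u x) 0) 1) (\<lambda>x. min (max (u x) 0) 1) \<le> Q u u)"

section \<open>Quasi-regular Dirichlet forms (in the sense of Ma and Roeckner)\<close>

definition form_nest ::
    "'a::topological_space measure \<Rightarrow> ('a \<Rightarrow> real) set \<Rightarrow> (('a \<Rightarrow> real) \<Rightarrow> ('a \<Rightarrow> real) \<Rightarrow> real)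
      \<Rightarrow> (nat \<Rightarrow> 'a set) \<Rightarrow> bool" where
  "form_nest M D Q K \<longleftrightarrow>
     incseq K \<and> (\<forall>n. closed (K n)) \<and>
     form1_dense M D Q (\<Union>n. {u \<in> D. AE x in M. x \<notin> K n \<longrightarrow> u x = 0})"

definition form_polar ::
    "'a::topological_space measure \<Rightarrow> ('a \<Rightarrow> real) set \<Rightarrow> (('a \<Rightarrow> real) \<Rightarrow> ('a \<Rightarrow> real) \<Rightarrow> real)
      \<Rightarrow> 'a set \<Rightarrow> bool" where
  "form_polar M D Q N \<longleftrightarrow> (\<exists>K. form_nest M D Q K \<and> N \<subseteq> - (\<Union>n. K n))"

definition quasi_continuous ::
    "'a::topological_space measure \<Rightarrow> ('a \<Rightarrow> real) set \<Rightarrow> (('a \<Rightarrow> real) \<Rightarrow> ('a \<Rightarrow> real) \<Rightarrow> real)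
      \<Rightarrow> ('a \<Rightarrow> real) \<Rightarrow> bool" where
  "quasi_continuous M D Q f \<longleftrightarrow> (\<exists>K. form_nest M D Q K \<and> (\<forall>n. continuous_on (K n) f))"

definition quasi_regular ::
    "'a::topological_space measure \<Rightarrow> ('a \<Rightarrow> real) set \<Rightarrow> (('a \<Rightarrow> real) \<Rightarrow> ('a \<Rightarrow> real) \<Rightarrow> real)
      \<Rightarrow> bool" where
  "quasi_regular M D Q \<longleftrightarrow>
     (\<exists>K. form_nest M D Q K \<and> (\<forall>n. compact (K n))) \<and>
     (\<exists>C. form1_dense M D Q C \<and>
        (\<forall>u\<in>C. \<exists>v. quasi_continuous M D Q v \<and> (AE x in M. v x = u x))) \<and>
     (\<exists>N (u :: nat \<Rightarrow> 'a \<Rightarrow> real) v. form_polar M D Q N \<and>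
        (\<forall>n. u n \<in> D \<and> quasi_continuous M D Q (v n) \<and> (AE x in M. v n x = u n x)) \<and>
        (\<forall>x y. x \<notin> N \<and> y \<notin> N \<and> x \<noteq> y \<longrightarrow> (\<exists>n. v n x \<noteq> v n y)))"

section \<open>Topological local structures\<close>

text \<open>The carrier of the Polish topology \<open>P\<close> may be taken in the same type, since the continuous
  map onto the space is bijective.\<close>

definition Luzin_space :: "'b topology \<Rightarrow> bool" where
  "Luzin_space T \<longleftrightarrow>
     (\<exists>(P :: 'b topology) f. completely_metrizable_space P \<and> second_countable P \<and>
        continuous_map P T f \<and> bij_betw f (topspace P) (topspace T))"

definition atomless :: "'b measure \<Rightarrow> bool" where
  "atomless M \<longleftrightarrow>
     (\<forall>A\<in>sets M. emeasure M A > 0 \<longrightarrow>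
        (\<exists>B\<in>sets M. B \<subseteq> A \<and> 0 < emeasure M B \<and> emeasure M B < emeasure M A))"

definition Radon_measure :: "'a::t2_space measure \<Rightarrow> bool" where
  "Radon_measure M \<longleftrightarrow>
     (\<forall>x. \<exists>U. open U \<and> x \<in> U \<and> emeasure M U < \<infinity>) \<and>
     (\<forall>A\<in>sets M. emeasure M A = (SUP K\<in>{K. compact K \<and> K \<subseteq> A}. emeasure M K))"

definition localizing_ring :: "'a::topological_space measure \<Rightarrow> 'a set set \<Rightarrow> bool" where
  "localizing_ring M \<E> \<longleftrightarrow>
     \<E> \<subseteq> {A \<in> sets M. emeasure M A < \<infinity>} \<and>
     (\<forall>A\<in>\<E>. \<forall>B\<in>\<E>. A \<union> B \<in> \<E> \<and> A \<inter> B \<in> \<E>) \<and>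
     (\<forall>A\<in>sets M. \<forall>E\<in>\<E>. A \<inter> E \<in> \<E>) \<and>
     (\<exists>Eh :: nat \<Rightarrow> 'a set. (\<forall>h. Eh h \<in> sets M \<and> emeasure M (Eh h) < \<infinity>) \<and> incseq Eh \<and>
        (\<Union>h. Eh h) = UNIV \<and> \<E> = (\<Union>h. {A \<inter> Eh h |A. A \<in> sets M})) \<and>
     (\<forall>x. \<exists>E\<in>\<E>. \<exists>U. open U \<and> x \<in> U \<and> U \<subseteq> E)"

text \<open>The space \<open>X\<close> is the type \<open>'a\<close> with its class topology, \<open>\<Sigma>\<close> is \<open>sets M\<close> and the reference
  measure \<open>m\<close> is \<open>M\<close>.\<close>

locale topological_local_structure = sigma_finite_measure M
  for M :: "'a::t2_space measure" and \<E> :: "'a set set" +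
  assumes completely_regular: "completely_regular_space (euclidean :: 'a topology)"
    and Luzin: "Luzin_space (euclidean :: 'a topology)"
    and space_UNIV: "space M = UNIV"
    and borel_subset: "sets borel \<subseteq> sets M"
    and subset_completion:
      "sets M \<subseteq> sets (completion (measure_of UNIV (sets borel) (emeasure M)))"
    and singletons: "\<And>x. {x} \<in> sets M"
    and ess_countably_generated:
      "\<exists>\<A>. countable \<A> \<and> \<A> \<subseteq> sets M \<and>
         (\<forall>A\<in>sets M. \<exists>B\<in>sigma_sets UNIV \<A>. (A - B) \<union> (B - A) \<in> null_sets M)"
    and atomless: "atomless M"
    and Radon: "Radon_measure M"
    and full_support: "\<And>U. open U \<Longrightarrow> U \<noteq> {} \<Longrightarrow> emeasure M U > 0"
    and localizing_ring: "localizing_ring M \<E>"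

definition C0_funs :: "'a::topological_space set set \<Rightarrow> ('a \<Rightarrow> real) set" where
  "C0_funs \<E> =
     {f. continuous_on UNIV f \<and> bounded (range f) \<and> (\<exists>E\<in>\<E>. \<forall>x. x \<notin> E \<longrightarrow> f x = 0)}"

text \<open>Bounded (not merely essentially bounded) measurable functions.\<close>

definition bdd_measurable :: "'a measure \<Rightarrow> ('a \<Rightarrow> real) set" where
  "bdd_measurable M = {f \<in> borel_measurable M. bounded (f ` space M)}"

definition bdd_measurable_loc :: "'a measure \<Rightarrow> 'a set set \<Rightarrow> ('a \<Rightarrow> real) set" where
  "bdd_measurable_loc M \<E> = {f \<in> bdd_measurable M. \<exists>E\<in>\<E>. \<forall>x. x \<notin> E \<longrightarrow> f x = 0}"

section \<open>Square field operators and topological local diffusion spaces\<close>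

text \<open>\<open>\<phi> \<circ> f - \<phi>(0)\<close> for \<open>f = (f\<^sub>0, \<dots>, f\<^sub>k\<^sub>-\<^sub>1)\<close>; the values of \<open>f i\<close> for \<open>i \<ge> k\<close> are irrelevant.\<close>

definition comp0 :: "((nat \<Rightarrow> real) \<Rightarrow> real) \<Rightarrow> (nat \<Rightarrow> 'a \<Rightarrow> real) \<Rightarrow> 'a \<Rightarrow> real" where
  "comp0 \<phi> f x = \<phi> (\<lambda>i. f i x) - \<phi> (\<lambda>_. 0)"

text \<open>Since \<open>M\<close> has full support, a class has at most one continuous representative, and \<open>D\<close> is a
  set of continuous functions.  \<open>\<Gamma> f g\<close> is a bounded representative of a class in \<open>L\<^sup>\<infinity>(M)\<close>, and
  all its properties are required \<open>M\<close>-almost everywhere only.\<close>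

locale topological_local_diffusion_space = topological_local_structure M \<E>
  for M :: "'a::t2_space measure" and \<E> :: "'a set set" +
  fixes D :: "('a \<Rightarrow> real) set"
    and \<Gamma> :: "('a \<Rightarrow> real) \<Rightarrow> ('a \<Rightarrow> real) \<Rightarrow> 'a \<Rightarrow> real"
  assumes D_subset: "D \<subseteq> C0_funs \<E>"
    and D_zero: "(\<lambda>_. 0) \<in> D"
    and D_lin: "\<And>f g a b. f \<in> D \<Longrightarrow> g \<in> D \<Longrightarrow> (\<lambda>x. a * f x + b * g x) \<in> D"
    and D_mult: "\<And>f g. f \<in> D \<Longrightarrow> g \<in> D \<Longrightarrow> (\<lambda>x. f x * g x) \<in> D"
    and D_generates:
      "topology_generated_by {f -` V |f V. f \<in> D \<and> open V} = (euclidean :: 'a topology)"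
    and D_comp: "\<And>k \<phi> f. \<phi> \<in> Cb_smooth k \<Longrightarrow> (\<And>i. i < k \<Longrightarrow> f i \<in> D) \<Longrightarrow> comp0 \<phi> f \<in> D"
    and Gamma_Linf: "\<And>f g. f \<in> D \<Longrightarrow> g \<in> D \<Longrightarrow> \<Gamma> f g \<in> bdd_measurable M"
    and Gamma_loc:
      "\<And>f g. f \<in> D \<Longrightarrow> g \<in> D \<Longrightarrow> \<exists>h\<in>bdd_measurable_loc M \<E>. AE x in M. \<Gamma> f g x = h x"
    and Gamma_sym: "\<And>f g. f \<in> D \<Longrightarrow> g \<in> D \<Longrightarrow> AE x in M. \<Gamma> f g x = \<Gamma> g f x"
    and Gamma_lin:
      "\<And>f g h a b. f \<in> D \<Longrightarrow> g \<in> D \<Longrightarrow> h \<in> D \<Longrightarrow>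
         AE x in M. \<Gamma> (\<lambda>y. a * f y + b * g y) h x = a * \<Gamma> f h x + b * \<Gamma> g h x"
    and Gamma_nonneg: "\<And>f. f \<in> D \<Longrightarrow> AE x in M. \<Gamma> f f x \<ge> 0"
    and Gamma_diffusion:
      "\<And>k l \<phi> \<psi> f g. \<phi> \<in> Cb_smooth k \<Longrightarrow> \<psi> \<in> Cb_smooth l \<Longrightarrow>
         (\<And>i. i < k \<Longrightarrow> f i \<in> D) \<Longrightarrow> (\<And>j. j < l \<Longrightarrow> g j \<in> D) \<Longrightarrow>
         AE x in M. \<Gamma> (comp0 \<phi> f) (comp0 \<psi> g) x =
           (\<Sum>i<k. \<Sum>j<l. partial_deriv i \<phi> (\<lambda>n. f n x) * partial_deriv j \<psi> (\<lambda>n. g n x)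
              * \<Gamma> (f i) (g j) x)"
    and energy_dense: "L2_dense M D"
    and energy_closable: "closable_form M D (\<lambda>f g. \<integral>x. \<Gamma> f g x \<partial>M)"
    and energy_Dirichlet:
      "Dirichlet_form M (closure_dom M D (\<lambda>f g. \<integral>x. \<Gamma> f g x \<partial>M))
         (closure_form M D (\<lambda>f g. \<integral>x. \<Gamma> f g x \<partial>M))"
    and energy_quasi_regular:
      "quasi_regular M (closure_dom M D (\<lambda>f g. \<integral>x. \<Gamma> f g x \<partial>M))
         (closure_form M D (\<lambda>f g. \<integral>x. \<Gamma> f g x \<partial>M))"

text \<open>A map on \<open>L\<^sup>\<infinity>(M)\<close> is a map on bounded measurable functions that respects equality almost
  everywhere (a special case of \<open>mono\<close>).\<close>

definition strong_lifting ::
    "'a::topological_space measure \<Rightarrow> (('a \<Rightarrow> real) \<Rightarrow> 'a \<Rightarrow> real) \<Rightarrow> bool" where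
  "strong_lifting M \<l> \<longleftrightarrow>
     (\<forall>f\<in>bdd_measurable M. \<l> f \<in> bdd_measurable M \<and> (AE x in M. \<l> f x = f x)) \<and>
     (\<forall>f\<in>bdd_measurable M. \<forall>g\<in>bdd_measurable M. (AE x in M. f x = g x) \<longrightarrow> \<l> f = \<l> g) \<and>
     (\<forall>f\<in>bdd_measurable M. \<forall>g\<in>bdd_measurable M. \<forall>a b.
        \<l> (\<lambda>x. a * f x + b * g x) = (\<lambda>x. a * \<l> f x + b * \<l> g x)) \<and>
     (\<forall>f\<in>bdd_measurable M. \<forall>g\<in>bdd_measurable M.
        \<l> (\<lambda>x. f x * g x) = (\<lambda>x. \<l> f x * \<l> g x)) \<and>
     (\<forall>f\<in>bdd_measurable M. \<forall>g\<in>bdd_measurable M.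
        (AE x in M. f x \<le> g x) \<longrightarrow> (\<forall>x. \<l> f x \<le> \<l> g x)) \<and>
     \<l> (\<lambda>_. 1) = (\<lambda>_. 1) \<and>
     (\<forall>\<phi>. continuous_on UNIV \<phi> \<and> bounded (range \<phi>) \<longrightarrow> \<l> \<phi> = \<phi>)"

section \<open>Configurations\<close>

definition configs :: "'a measure \<Rightarrow> 'a set set \<Rightarrow> 'a measure set" where
  "configs M \<E> =
     {\<gamma>. sets \<gamma> = sets M \<and>
         (\<exists>(N :: enat) x. (\<forall>i. x i \<in> space M) \<and>
            (\<forall>A\<in>sets M. emeasure \<gamma> A = (\<Sum>i. if enat i < N then emeasure (return M (x i)) A else 0))) \<and>
         (\<forall>E\<in>\<E>. emeasure \<gamma> E < \<infinity>)}"

definition config_space :: "'a measure \<Rightarrow> 'a set set \<Rightarrow> 'a measure measure" where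
  "config_space M \<E> =
     sigma (configs M \<E>)
       {(\<lambda>\<gamma>. emeasure \<gamma> E) -` B \<inter> configs M \<E> |E B. E \<in> \<E> \<and> B \<in> sets borel}"

text \<open>\<open>\<gamma> + \<delta>\<^sub>x\<close>\<close>

definition add_point :: "'a measure \<Rightarrow> 'a \<Rightarrow> 'a measure" where
  "add_point \<gamma> x = measure_of (space \<gamma>) (sets \<gamma>) (\<lambda>A. emeasure \<gamma> A + emeasure (return \<gamma> x) A)"

text \<open>For a probability measure \<open>\<mu>\<close> on \<open>config_space M \<E>\<close> the set function below is a measure, the
  maps \<open>\<gamma> \<mapsto> \<gamma> A\<close> being measurable for every \<open>A \<in> sets M\<close> by exhaustion along a localizing
  sequence; see \<open>emeasure_intensity\<close>.\<close>

definition intensity :: "'a measure \<Rightarrow> 'a measure measure \<Rightarrow> 'a measure" where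
  "intensity M \<mu> = measure_of (space M) (sets M) (\<lambda>A. \<integral>\<^sup>+\<gamma>. emeasure \<gamma> A \<partial>\<mu>)"

lemma measurable_emeasure_config:
  assumes loc: "localizing_ring M \<E>" and M: "space M = UNIV"
    and mu: "sets \<mu> = sets (config_space M \<E>)" and A: "A \<in> sets M"
  shows "(\<lambda>\<gamma>. emeasure \<gamma> A) \<in> borel_measurable \<mu>"
proof -
  let ?G = "{(\<lambda>\<gamma>. emeasure \<gamma> E) -` B \<inter> configs M \<E> |E B. E \<in> \<E> \<and> B \<in> sets borel}"
  have G: "?G \<subseteq> Pow (configs M \<E>)" by auto
  have sp: "space \<mu> = configs M \<E>"
    using sets_eq_imp_space_eq[OF mu] by (simp add: config_space_def space_measure_of[OF G])
  have st: "sets \<mu> = sigma_sets (configs M \<E>) ?G"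
    using mu by (simp add: config_space_def sets_measure_of[OF G])
  have E: "(\<lambda>\<gamma>. emeasure \<gamma> E) \<in> borel_measurable \<mu>" if "E \<in> \<E>" for E
  proof (rule measurableI)
    fix B :: "ennreal set" assume "B \<in> sets borel"
    then have "(\<lambda>\<gamma>. emeasure \<gamma> E) -` B \<inter> configs M \<E> \<in> ?G" using that by blast
    then show "(\<lambda>\<gamma>. emeasure \<gamma> E) -` B \<inter> space \<mu> \<in> sets \<mu>"
      unfolding st sp by (rule sigma_sets.Basic)
  qed simp
  from loc have "\<exists>Eh :: nat \<Rightarrow> 'a set. (\<forall>h. Eh h \<in> sets M \<and> emeasure M (Eh h) < \<infinity>) \<and>
      incseq Eh \<and> (\<Union>h. Eh h) = UNIV \<and> \<E> = (\<Union>h. {A \<inter> Eh h |A. A \<in> sets M})"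
    unfolding localizing_ring_def by (elim conjE)
  then obtain Eh :: "nat \<Rightarrow> 'a set"
    where seq: "\<forall>h. Eh h \<in> sets M \<and> emeasure M (Eh h) < \<infinity>" "incseq Eh" "(\<Union>h. Eh h) = UNIV"
      and E_eq: "\<E> = (\<Union>h. {A \<inter> Eh h |A. A \<in> sets M})"
    by (elim exE conjE)
  have in_E: "A \<inter> Eh h \<in> \<E>" for h
    unfolding E_eq using A by blast
  have "(\<lambda>\<gamma>. SUP h. emeasure \<gamma> (A \<inter> Eh h)) \<in> borel_measurable \<mu>"
    by (rule borel_measurable_SUP[OF countableI_type E[OF in_E]])
  moreover have "(SUP h. emeasure \<gamma> (A \<inter> Eh h)) = emeasure \<gamma> A" if "\<gamma> \<in> space \<mu>" for \<gamma>
  proof -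
    have s: "sets \<gamma> = sets M" using that by (simp add: sp configs_def)
    have "(SUP h. emeasure \<gamma> (A \<inter> Eh h)) = emeasure \<gamma> (\<Union>h. A \<inter> Eh h)"
      using A seq(1,2) by (intro SUP_emeasure_incseq) (auto simp: s incseq_def)
    also have "(\<Union>h. A \<inter> Eh h) = A" using seq(3) by blast
    finally show ?thesis .
  qed
  ultimately show ?thesis using measurable_cong[of \<mu> "\<lambda>\<gamma>. SUP h. emeasure \<gamma> (A \<inter> Eh h)" "\<lambda>\<gamma>. emeasure \<gamma> A"] by blast
qed

lemma emeasure_intensity:
  assumes loc: "localizing_ring M \<E>" and M: "space M = UNIV"
    and mu: "sets \<mu> = sets (config_space M \<E>)" and A: "A \<in> sets M"
  shows "emeasure (intensity M \<mu>) A = (\<integral>\<^sup>+\<gamma>. emeasure \<gamma> A \<partial>\<mu>)"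
proof (rule emeasure_measure_of[OF intensity_def])
  show "sets M \<subseteq> Pow (space M)" using sets.space_closed .
  show "A \<in> sets (intensity M \<mu>)"
    using A by (simp add: intensity_def)
  show "positive (sets (intensity M \<mu>)) (\<lambda>A. \<integral>\<^sup>+\<gamma>. emeasure \<gamma> A \<partial>\<mu>)"
    by (simp add: positive_def)
  have sp: "space \<mu> = configs M \<E>"
    using sets_eq_imp_space_eq[OF mu] unfolding config_space_def
    by (subst (asm) space_measure_of) blast+
  show "countably_additive (sets (intensity M \<mu>)) (\<lambda>A. \<integral>\<^sup>+\<gamma>. emeasure \<gamma> A \<partial>\<mu>)"
  proof (rule countably_additiveI)
    fix B :: "nat \<Rightarrow> 'a set"
    assume "range B \<subseteq> sets (intensity M \<mu>)" and disj: "disjoint_family B"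
    then have B: "\<And>i. B i \<in> sets M" by (auto simp: intensity_def)
    have "(\<Sum>i. \<integral>\<^sup>+\<gamma>. emeasure \<gamma> (B i) \<partial>\<mu>) = (\<integral>\<^sup>+\<gamma>. (\<Sum>i. emeasure \<gamma> (B i)) \<partial>\<mu>)"
      by (rule nn_integral_suminf[symmetric]) (rule measurable_emeasure_config[OF loc M mu B])
    also have "\<dots> = (\<integral>\<^sup>+\<gamma>. emeasure \<gamma> (\<Union>i. B i) \<partial>\<mu>)"
      using B disj by (intro nn_integral_cong suminf_emeasure) (auto simp: sp configs_def)
    finally show "(\<Sum>i. \<integral>\<^sup>+\<gamma>. emeasure \<gamma> (B i) \<partial>\<mu>) = (\<integral>\<^sup>+\<gamma>. emeasure \<gamma> (\<Union>i. B i) \<partial>\<mu>)" .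
  qed
qed

section \<open>Cylinder functions\<close>

text \<open>A triple \<open>(k, F, f)\<close> presents the function \<open>F(f\<^sub>0\<^sup>\<star>, \<dots>, f\<^sub>k\<^sub>-\<^sub>1\<^sup>\<star>)\<close>.  The same function, or
  the same \<open>\<mu>\<close>-class, has many presentations, and the square field operator on configurations is
  a priori a function of the presentations.\<close>

type_synonym 'a cyl = "nat \<times> ((nat \<Rightarrow> real) \<Rightarrow> real) \<times> (nat \<Rightarrow> 'a \<Rightarrow> real)"

definition cyl_data :: "('a \<Rightarrow> real) set \<Rightarrow> 'a cyl set" where
  "cyl_data D = {(k, F, f). F \<in> Cb_smooth k \<and> (\<forall>i<k. f i \<in> D)}"

fun cyl_fun :: "'a cyl \<Rightarrow> 'a measure \<Rightarrow> real" where
  "cyl_fun (k, F, f) \<gamma> = F (\<lambda>i. \<integral>x. f i x \<partial>\<gamma>)"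

text \<open>For given \<open>f\<close>, \<open>g\<close> in \<open>D\<close>, \<open>\<l> (\<Gamma> f g)\<close> need only vanish almost everywhere outside some
  \<open>E \<in> \<E>\<close>; where its integral against \<open>\<gamma>\<close> does not exist it is \<open>0\<close> by convention.\<close>

fun cyl_Gamma ::
    "(('a \<Rightarrow> real) \<Rightarrow> ('a \<Rightarrow> real) \<Rightarrow> 'a \<Rightarrow> real) \<Rightarrow> (('a \<Rightarrow> real) \<Rightarrow> 'a \<Rightarrow> real)
      \<Rightarrow> 'a cyl \<Rightarrow> 'a cyl \<Rightarrow> 'a measure \<Rightarrow> real" where
  "cyl_Gamma \<Gamma> \<l> (k, F, f) (l, G, g) \<gamma> =
     (\<Sum>i<k. \<Sum>j<l.
        partial_deriv i F (\<lambda>n. \<integral>x. f n x \<partial>\<gamma>) * partial_deriv j G (\<lambda>n. \<integral>x. g n x \<partial>\<gamma>)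
        * (\<integral>x. \<l> (\<Gamma> (f i) (g j)) x \<partial>\<gamma>))"

text \<open>All representatives of the classes in \<open>Cyl\<^sub>\<mu>(D)\<close>.\<close>

definition Cyl :: "'a measure measure \<Rightarrow> ('a \<Rightarrow> real) set \<Rightarrow> ('a measure \<Rightarrow> real) set" where
  "Cyl \<mu> D = {u \<in> borel_measurable \<mu>. \<exists>r\<in>cyl_data D. AE \<gamma> in \<mu>. u \<gamma> = cyl_fun r \<gamma>}"

text \<open>The form on \<open>\<mu>\<close>-classes, with arbitrary value if the presentations do not determine it.\<close>

definition cyl_form ::
    "'a measure measure \<Rightarrow> ('a \<Rightarrow> real) set \<Rightarrow> (('a \<Rightarrow> real) \<Rightarrow> ('a \<Rightarrow> real) \<Rightarrow> 'a \<Rightarrow> real)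
      \<Rightarrow> (('a \<Rightarrow> real) \<Rightarrow> 'a \<Rightarrow> real) \<Rightarrow> ('a measure \<Rightarrow> real) \<Rightarrow> ('a measure \<Rightarrow> real) \<Rightarrow> real" where
  "cyl_form \<mu> D \<Gamma> \<l> u v =
     (THE c. \<exists>r\<in>cyl_data D. \<exists>s\<in>cyl_data D.
        (AE \<gamma> in \<mu>. u \<gamma> = cyl_fun r \<gamma>) \<and> (AE \<gamma> in \<mu>. v \<gamma> = cyl_fun s \<gamma>) \<and>
        c = (\<integral>\<gamma>. cyl_Gamma \<Gamma> \<l> r s \<gamma> \<partial>\<mu>))"

section \<open>The assumption (GNZ)\<close>

definition semi_bounded_on :: "'b set \<Rightarrow> ('b \<Rightarrow> real) \<Rightarrow> bool" where
  "semi_bounded_on S u \<longleftrightarrow> (\<exists>c. \<forall>p\<in>S. c \<le> u p) \<or> (\<exists>c. \<forall>p\<in>S. u p \<le> c)"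

text \<open>The two sides of the identity, for the positive part of \<open>u\<close> (note that \<open>ennreal\<close> sends
  negative reals to \<open>0\<close>).\<close>

definition GNZ_left :: "'a measure measure \<Rightarrow> ('a measure \<times> 'a \<Rightarrow> real) \<Rightarrow> ennreal" where
  "GNZ_left \<mu> u = (\<integral>\<^sup>+\<gamma>. (\<integral>\<^sup>+x. ennreal (u (\<gamma>, x)) \<partial>\<gamma>) \<partial>\<mu>)"

definition GNZ_right ::
    "'a measure \<Rightarrow> 'a measure measure \<Rightarrow> ('a measure \<times> 'a \<Rightarrow> real) \<Rightarrow> ('a measure \<times> 'a \<Rightarrow> real)
      \<Rightarrow> ennreal" where
  "GNZ_right M \<mu> \<rho> u =
     (\<integral>\<^sup>+\<gamma>. (\<integral>\<^sup>+x. ennreal (u (add_point \<gamma> x, x) * \<rho> (\<gamma>, x)) \<partial>M) \<partial>\<mu>)"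

text \<open>The identity between extended real integrals holds for every semi-bounded \<open>u\<close> for which both
  sides are defined, i.e. are not of the form \<open>\<infinity> - \<infinity>\<close> (a semi-bounded \<open>u\<close> may be positive and
  negative on sets of infinite mass).\<close>

definition GNZ_identity ::
    "'a measure \<Rightarrow> 'a measure measure \<Rightarrow> ('a measure \<times> 'a \<Rightarrow> real) \<Rightarrow> bool" where
  "GNZ_identity M \<mu> \<rho> \<longleftrightarrow>
     (\<forall>u \<in> borel_measurable (\<mu> \<Otimes>\<^sub>M M). semi_bounded_on (space (\<mu> \<Otimes>\<^sub>M M)) u \<longrightarrow>
        (GNZ_left \<mu> u < \<infinity> \<or> GNZ_left \<mu> (\<lambda>p. - u p) < \<infinity>) \<longrightarrow>
        (GNZ_right M \<mu> \<rho> u < \<infinity> \<or> GNZ_right M \<mu> \<rho> (\<lambda>p. - u p) < \<infinity>) \<longrightarrow>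
        enn2ereal (GNZ_left \<mu> u) - enn2ereal (GNZ_left \<mu> (\<lambda>p. - u p)) =
        enn2ereal (GNZ_right M \<mu> \<rho> u) - enn2ereal (GNZ_right M \<mu> \<rho> (\<lambda>p. - u p)))"

text \<open>The measure \<open>\<rho>(\<gamma>, \<cdot>) \<cdot> M\<close>.\<close>

definition cond_measure ::
    "'a measure \<Rightarrow> ('a measure \<times> 'a \<Rightarrow> real) \<Rightarrow> 'a measure \<Rightarrow> 'a measure" where
  "cond_measure M \<rho> \<gamma> = density M (\<lambda>x. ennreal (\<rho> (\<gamma>, x)))"

definition GNZ ::
    "'a measure \<Rightarrow> 'a set set \<Rightarrow> ('a \<Rightarrow> real) set
      \<Rightarrow> (('a \<Rightarrow> real) \<Rightarrow> ('a \<Rightarrow> real) \<Rightarrow> 'a \<Rightarrow> real) \<Rightarrow> (('a \<Rightarrow> real) \<Rightarrow> 'a \<Rightarrow> real)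
      \<Rightarrow> 'a measure measure \<Rightarrow> bool" where
  "GNZ M \<E> D \<Gamma> \<l> \<mu> \<longleftrightarrow>
     (\<forall>E\<in>\<E>. (\<integral>\<^sup>+\<gamma>. emeasure \<gamma> E \<partial>\<mu>) < \<infinity>) \<and>
     (\<exists>\<rho> \<in> borel_measurable (\<mu> \<Otimes>\<^sub>M M).
        (\<forall>p\<in>space (\<mu> \<Otimes>\<^sub>M M). 0 \<le> \<rho> p) \<and>
        GNZ_identity M \<mu> \<rho> \<and>
        (AE \<gamma> in \<mu>. \<forall>f\<in>D. (AE x in cond_measure M \<rho> \<gamma>. f x = 0) \<longrightarrow>
           (\<forall>g\<in>D. AE x in cond_measure M \<rho> \<gamma>. \<l> (\<Gamma> f g) x = 0)) \<and>
        (\<exists>w \<in> borel_measurable M.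
           (\<forall>x\<in>space M. 0 < w x \<and> w x \<le> 1) \<and> integrable (intensity M \<mu>) w \<and>
           (AE \<gamma> in \<mu>. closable_form (density (cond_measure M \<rho> \<gamma>) (\<lambda>x. ennreal (w x))) D
              (\<lambda>f g. \<integral>x. \<Gamma> f g x * w x \<partial>cond_measure M \<rho> \<gamma>))))"

end

theory Submission
  imports Defs
begin

text \<open>
  For a function \<open>u\<close> on configurations let \<open>u\<^sub>\<gamma>(x) = u(\<gamma> + \<delta>\<^sub>x) - u(\<gamma>)\<close> be its increment at \<open>\<gamma>\<close>.  If
  \<open>u = F(f\<^sub>1\<^sup>\<star>, \<dots>, f\<^sub>k\<^sup>\<star>)\<close> is a cylinder function, then \<open>u\<^sub>\<gamma>\<close> is the smooth function
  \<open>F(f\<^sup>\<star>\<gamma> + \<cdot>) - F(f\<^sup>\<star>\<gamma>)\<close> of \<open>f\<close>, hence an element of \<open>D\<close>, and the chain rule computes \<open>\<Gamma>(u\<^sub>\<gamma>, v\<^sub>\<gamma>)\<close>.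
  The Georgii-Nguyen-Zessin identity, applied to the integrand of the square field operator on
  configurations, therefore gives

  \<open>\<integral> \<Gamma>\<^sup>\<Upsilon>(u, v) d\<mu> = \<integral> (\<integral> \<Gamma>(u\<^sub>\<gamma>, v\<^sub>\<gamma>) dm\<^sub>\<gamma>) d\<mu>(\<gamma>)\<close>, \<open>dm\<^sub>\<gamma> = \<rho>(\<gamma>, \<cdot>) dM\<close>

  (\<open>cyl_Gamma_energy\<close>).  The right-hand side depends neither on the presentation of \<open>u\<close> and \<open>v\<close> nor
  on the lifting, because \<open>m\<^sub>\<gamma>\<close> is absolutely continuous; bilinearity, symmetry and positivity are
  inherited from \<open>\<Gamma>\<close>.  If \<open>u = u'\<close> almost everywhere, then, again by the identity, \<open>u\<^sub>\<gamma> = u'\<^sub>\<gamma>\<close>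
  \<open>m\<^sub>\<gamma>\<close>-almost everywhere for almost every \<open>\<gamma>\<close>, so that the degeneracy condition makes the form
  well-defined on classes (\<open>energy_cong\<close>).

  For closability (\<open>energy_closable\<close>) take cylinder functions \<open>u\<^sub>n\<close> that tend to \<open>0\<close> in \<open>L\<^sup>2\<close> and are
  Cauchy for the form.  Along a fast subsequence the increments are, for almost every \<open>\<gamma>\<close>, Cauchy
  for \<open>\<integral> \<Gamma>(\<cdot>, \<cdot>) dm\<^sub>\<gamma>\<close> and tend to \<open>0\<close> in \<open>L\<^sup>2(w m\<^sub>\<gamma>)\<close>; the latter uses the identity with the factor
  \<open>1 / (1 + \<gamma>(w))\<close>.  Closability of the weighted form on the fibre, removal of the weight
  (\<open>fibre_liminf\<close>) and Fatou's lemma yield the claim.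

  For density (\<open>cyl_algebra_dense\<close>) the cylinder functions form an algebra of bounded functions.
  By a functional monotone class theorem it is enough that they generate the \<open>\<sigma>\<close>-algebra up to null
  sets.  Since the space is hereditarily Lindelof, \<open>D\<close> generates the Borel sets, and the same monotone
  class theorem, now on the base space, makes \<open>\<gamma> \<mapsto> \<gamma>(B)\<close> measurable with respect to the
  \<open>\<sigma>\<close>-algebra generated by the cylinder functions, up to null sets.
\<close>

section \<open>Bounded smooth functions of finitely many variables\<close>

text \<open>To belong to \<open>C\<^sub>b\<^sup>\<infinity>\<close> it suffices to belong to a set of bounded continuous functions that is closed
  under partial derivatives.\<close>

lemma Cb_smoothI:
  assumes F: "F \<in> S"
    and dep: "\<And>x y. (\<And>i. i < k \<Longrightarrow> x i = y i) \<Longrightarrow> F x = F y"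
    and cont: "\<And>G. G \<in> S \<Longrightarrow> continuous_on UNIV G"
    and bdd: "\<And>G. G \<in> S \<Longrightarrow> bounded (range G)"
    and deriv: "\<And>G i. G \<in> S \<Longrightarrow> i < k \<Longrightarrow>
      \<exists>G'\<in>S. \<forall>x. ((\<lambda>t. G (x(i := t))) has_real_derivative G' x) (at (x i))"
  shows "F \<in> Cb_smooth k"
proof -
  have pd: "partial_deriv i G \<in> S" if "G \<in> S" "i < k" for G i
  proof -
    from deriv[OF that] obtain G' where G': "G' \<in> S"
      "\<And>x. ((\<lambda>t. G (x(i := t))) has_real_derivative G' x) (at (x i))"
      by blast
    have "partial_deriv i G = G'"
      unfolding partial_deriv_def using DERIV_imp_deriv[OF G'(2)] by blast
    with G'(1) show ?thesis by simp
  qed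
  have "foldr partial_deriv js F \<in> S" if "set js \<subseteq> {..<k}" for js
    using that by (induction js) (auto simp: F intro: pd)
  moreover have "(\<lambda>t. G (x(i := t))) differentiable (at (x i))" if "G \<in> S" "i < k" for G i x
    using deriv[OF that] real_differentiable_def by blast
  ultimately show ?thesis
    unfolding Cb_smooth_def
    by (intro CollectI conjI allI impI dep cont bdd) blast+
qed

lemma Cb_smooth_cong: "F \<in> Cb_smooth k \<Longrightarrow> (\<And>i. i < k \<Longrightarrow> x i = y i) \<Longrightarrow> F x = F y"
  unfolding Cb_smooth_def by blast

lemma Cb_smooth_continuous: "F \<in> Cb_smooth k \<Longrightarrow> continuous_on UNIV F"
  unfolding Cb_smooth_def by (drule CollectD, elim conjE allE[where x = "[]"]) simp

lemma Cb_smooth_bounded: "F \<in> Cb_smooth k \<Longrightarrow> bounded (range F)"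
  unfolding Cb_smooth_def by (drule CollectD, elim conjE allE[where x = "[]"]) simp

lemma partial_deriv_eq_0:
  assumes "F \<in> Cb_smooth k" "k \<le> i"
  shows "partial_deriv i F = (\<lambda>_. 0)"
proof
  fix x :: "nat \<Rightarrow> real"
  have "(\<lambda>t. F (x(i := t))) = (\<lambda>_. F x)"
    using assms(2) by (intro ext Cb_smooth_cong[OF assms(1)]) auto
  then show "partial_deriv i F x = 0" by (simp add: partial_deriv_def)
qed

lemma Cb_smooth_has_derivative:
  assumes "F \<in> Cb_smooth k"
  shows "((\<lambda>t. F (x(i := t))) has_real_derivative partial_deriv i F x) (at (x i))"
proof (cases "i < k")
  case True
  then have "(\<lambda>t. F (x(i := t))) differentiable (at (x i))"
    using assms unfolding Cb_smooth_def
    by (auto dest: spec[where x = "[]"])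
  then show ?thesis
    unfolding partial_deriv_def using DERIV_deriv_iff_real_differentiable by blast
next
  case False
  then have "(\<lambda>t. F (x(i := t))) = (\<lambda>_. F x)"
    by (intro ext Cb_smooth_cong[OF assms]) auto
  then show ?thesis using partial_deriv_eq_0[OF assms] False by simp
qed

lemma Cb_smooth_const: "(\<lambda>_. c) \<in> Cb_smooth k"
proof (rule Cb_smoothI[where S = "range (\<lambda>c _. c)"])
  fix G :: "(nat \<Rightarrow> real) \<Rightarrow> real" and i assume "G \<in> range (\<lambda>c _. c)"
  then show "\<exists>G'\<in>range (\<lambda>c _. c).
      \<forall>x. ((\<lambda>t. G (x(i := t))) has_real_derivative G' x) (at (x i))"
    by (intro bexI[of _ "\<lambda>_. 0"]) auto
qed auto

lemma Cb_smooth_partial_deriv: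
  assumes "F \<in> Cb_smooth k"
  shows "partial_deriv i F \<in> Cb_smooth k"
proof (cases "i < k")
  case True
  have dep: "partial_deriv i F x = partial_deriv i F y" if "\<And>j. j < k \<Longrightarrow> x j = y j" for x y
  proof -
    have "(\<lambda>t. F (x(i := t))) = (\<lambda>t. F (y(i := t)))"
      using that by (intro ext Cb_smooth_cong[OF assms]) auto
    then show ?thesis using that[OF True] by (simp add: partial_deriv_def)
  qed
  have "foldr partial_deriv js (partial_deriv i F) = foldr partial_deriv (js @ [i]) F" for js
    by simp
  moreover have "set (js @ [i]) \<subseteq> {..<k}" if "set js \<subseteq> {..<k}" for js
    using that True by simp
  ultimately have *: "set js \<subseteq> {..<k} \<Longrightarrow> \<exists>js'. set js' \<subseteq> {..<k} \<and>
      foldr partial_deriv js (partial_deriv i F) = foldr partial_deriv js' F" for js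
    by blast
  show ?thesis
    unfolding Cb_smooth_def
  proof (intro CollectI conjI allI impI)
    fix js assume "set js \<subseteq> {..<k}"
    from *[OF this] obtain js' where js': "set js' \<subseteq> {..<k}"
      and eq: "foldr partial_deriv js (partial_deriv i F) = foldr partial_deriv js' F"
      by blast
    from assms js' show "continuous_on UNIV (foldr partial_deriv js (partial_deriv i F))"
      "bounded (range (foldr partial_deriv js (partial_deriv i F)))"
      unfolding Cb_smooth_def eq by blast+
    fix j x assume "j < k"
    with assms js' show "(\<lambda>t. foldr partial_deriv js (partial_deriv i F) (x(j := t)))
        differentiable (at (x j))"
      unfolding Cb_smooth_def eq by blast
  qed (use dep in blast)
next
  case False
  then show ?thesis using partial_deriv_eq_0[OF assms] Cb_smooth_const[of 0] by simp
qed

lemma Cb_smooth_mono: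
  assumes F: "F \<in> Cb_smooth k" and "k \<le> l"
  shows "F \<in> Cb_smooth l"
proof (rule Cb_smoothI[where S = "Cb_smooth k"])
  fix x y :: "nat \<Rightarrow> real" assume "\<And>i. i < l \<Longrightarrow> x i = y i"
  with \<open>k \<le> l\<close> show "F x = F y" by (intro Cb_smooth_cong[OF F]) auto
next
  fix G i assume "G \<in> Cb_smooth k"
  then show "\<exists>G'\<in>Cb_smooth k. \<forall>x. ((\<lambda>t. G (x(i := t))) has_real_derivative G' x) (at (x i))"
    by (intro bexI[of _ "partial_deriv i G"] allI Cb_smooth_has_derivative Cb_smooth_partial_deriv)
qed (fact F Cb_smooth_continuous Cb_smooth_bounded)+

lemma bounded_range_plus:
  fixes F G :: "'b \<Rightarrow> real"
  assumes "bounded (range F)" "bounded (range G)"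
  shows "bounded (range (\<lambda>x. F x + G x))"
  using bounded_plus[OF assms] by (rule bounded_subset) auto

lemma bounded_range_mult:
  fixes F G :: "'b \<Rightarrow> real"
  assumes "bounded (range F)" "bounded (range G)"
  shows "bounded (range (\<lambda>x. F x * G x))"
proof -
  obtain a b where "\<And>x. \<bar>F x\<bar> \<le> a" "\<And>x. \<bar>G x\<bar> \<le> b"
    using assms unfolding bounded_iff by auto
  then have "\<bar>F x * G x\<bar> \<le> a * b" for x
    unfolding abs_mult by (intro mult_mono) (auto intro: order_trans[OF abs_ge_zero])
  then show ?thesis unfolding bounded_iff by auto
qed

lemma Cb_smooth_add:
  assumes "F \<in> Cb_smooth k" "G \<in> Cb_smooth k"
  shows "(\<lambda>x. F x + G x) \<in> Cb_smooth k"
proof (rule Cb_smoothI[where S = "{\<lambda>x. F x + G x |F G. F \<in> Cb_smooth k \<and> G \<in> Cb_smooth k}"])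
  fix x y :: "nat \<Rightarrow> real" assume "\<And>i. i < k \<Longrightarrow> x i = y i"
  then show "F x + G x = F y + G y" using Cb_smooth_cong assms by metis
next
  fix H i assume "H \<in> {\<lambda>x. F x + G x |F G. F \<in> Cb_smooth k \<and> G \<in> Cb_smooth k}"
  then obtain F G where "F \<in> Cb_smooth k" "G \<in> Cb_smooth k" "H = (\<lambda>x. F x + G x)" by blast
  then show "\<exists>G'\<in>{\<lambda>x. F x + G x |F G. F \<in> Cb_smooth k \<and> G \<in> Cb_smooth k}.
      \<forall>x. ((\<lambda>t. H (x(i := t))) has_real_derivative G' x) (at (x i))"
    by (intro bexI[of _ "\<lambda>x. partial_deriv i F x + partial_deriv i G x"])
      (auto intro!: DERIV_add Cb_smooth_has_derivative dest: Cb_smooth_partial_deriv)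
next
  fix H assume "H \<in> {\<lambda>x. F x + G x |F G. F \<in> Cb_smooth k \<and> G \<in> Cb_smooth k}"
  then show "continuous_on UNIV H"
    by (blast intro: continuous_on_add Cb_smooth_continuous)
next
  fix H assume "H \<in> {\<lambda>x. F x + G x |F G. F \<in> Cb_smooth k \<and> G \<in> Cb_smooth k}"
  then show "bounded (range H)"
    by (blast intro: bounded_range_plus Cb_smooth_bounded)
next
  show "(\<lambda>x. F x + G x) \<in> {\<lambda>x. F x + G x |F G. F \<in> Cb_smooth k \<and> G \<in> Cb_smooth k}"
    using assms by (intro CollectI exI[of _ F] exI[of _ G] conjI refl)
qed

text \<open>The linear span of products, closed under partial derivatives by the Leibniz rule.\<close>

inductive_set Cb_products :: "nat \<Rightarrow> ((nat \<Rightarrow> real) \<Rightarrow> real) set" for k where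
  product: "F \<in> Cb_smooth k \<Longrightarrow> G \<in> Cb_smooth k \<Longrightarrow> (\<lambda>x. F x * G x) \<in> Cb_products k"
| plus: "H \<in> Cb_products k \<Longrightarrow> H' \<in> Cb_products k \<Longrightarrow> (\<lambda>x. H x + H' x) \<in> Cb_products k"

lemma Cb_smooth_mult:
  assumes "F \<in> Cb_smooth k" "G \<in> Cb_smooth k"
  shows "(\<lambda>x. F x * G x) \<in> Cb_smooth k"
proof (rule Cb_smoothI[where S = "Cb_products k"])
  fix x y :: "nat \<Rightarrow> real" assume "\<And>i. i < k \<Longrightarrow> x i = y i"
  then show "F x * G x = F y * G y" using Cb_smooth_cong assms by metis
next
  fix H i assume "H \<in> Cb_products k"
  then show "\<exists>H'\<in>Cb_products k. \<forall>x. ((\<lambda>t. H (x(i := t))) has_real_derivative H' x) (at (x i))"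
  proof induction
    case (product F G)
    have "((\<lambda>t. F (x(i := t)) * G (x(i := t))) has_real_derivative
        partial_deriv i F x * G x + partial_deriv i G x * F x) (at (x i))" for x
      using DERIV_mult[OF product[THEN Cb_smooth_has_derivative], of x i x] by simp
    moreover have "(\<lambda>x. partial_deriv i F x * G x + partial_deriv i G x * F x) \<in> Cb_products k"
      using product by (intro Cb_products.intros Cb_smooth_partial_deriv)
    ultimately show ?case
      by (intro bexI[of _ "\<lambda>x. partial_deriv i F x * G x + partial_deriv i G x * F x"] allI)
  next
    case (plus H1 H2)
    then obtain H1' H2' where "H1' \<in> Cb_products k" "H2' \<in> Cb_products k"
      "\<And>x. ((\<lambda>t. H1 (x(i := t))) has_real_derivative H1' x) (at (x i))"
      "\<And>x. ((\<lambda>t. H2 (x(i := t))) has_real_derivative H2' x) (at (x i))" by blast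
    then show ?case
      by (intro bexI[of _ "\<lambda>x. H1' x + H2' x"] allI DERIV_add Cb_products.plus)
  qed
next
  fix H assume "H \<in> Cb_products k"
  then show "continuous_on UNIV H"
    by (induction rule: Cb_products.induct)
      (blast intro: continuous_on_add continuous_on_mult Cb_smooth_continuous)+
next
  fix H assume "H \<in> Cb_products k"
  then show "bounded (range H)"
    by (induction rule: Cb_products.induct)
      (blast intro: bounded_range_plus bounded_range_mult Cb_smooth_bounded)+
qed (rule Cb_products.product[OF assms])

lemma continuous_on_coordinates:
  fixes F :: "(nat \<Rightarrow> real) \<Rightarrow> real"
  assumes "continuous_on UNIV F" "\<And>i. continuous_on UNIV (\<lambda>x. h x i)"
  shows "continuous_on UNIV (\<lambda>x :: nat \<Rightarrow> real. F (h x))"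
  using continuous_on_compose2[OF assms(1) continuous_on_coordinatewise_then_product[of UNIV h]]
    assms(2) by auto

lemma continuous_on_coordinate: "continuous_on UNIV (\<lambda>x :: nat \<Rightarrow> real. x i)"
  by (rule continuous_on_product_coordinates)

lemma partial_deriv_translate:
  "partial_deriv i (\<lambda>y. F (\<lambda>n. c n + y n)) x = partial_deriv i F (\<lambda>n. c n + x n)"
proof -
  have eq: "(\<lambda>n. c n + (x(i := t)) n) = (\<lambda>n. c n + x n)(i := c i + t)" for t by auto
  have "deriv (\<lambda>t. G (c i + t)) a = deriv G (c i + a)" for G :: "real \<Rightarrow> real" and a
    unfolding deriv_def using DERIV_at_within_shift[of G _ "c i" a UNIV] by simp
  from this[of "\<lambda>s. F ((\<lambda>n. c n + x n)(i := s))" "x i"] show ?thesis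
    unfolding partial_deriv_def eq .
qed

lemma Cb_smooth_translate:
  assumes "F \<in> Cb_smooth k"
  shows "(\<lambda>y. F (\<lambda>n. c n + y n)) \<in> Cb_smooth k"
proof (rule Cb_smoothI[where S = "(\<lambda>F y. F (\<lambda>n. c n + y n)) ` Cb_smooth k"])
  fix x y :: "nat \<Rightarrow> real" assume "\<And>i. i < k \<Longrightarrow> x i = y i"
  then show "F (\<lambda>n. c n + x n) = F (\<lambda>n. c n + y n)" by (intro Cb_smooth_cong[OF assms]) auto
next
  fix G i assume "G \<in> (\<lambda>F y. F (\<lambda>n. c n + y n)) ` Cb_smooth k"
  then obtain H where H: "H \<in> Cb_smooth k" "G = (\<lambda>y. H (\<lambda>n. c n + y n))" by blast
  have "((\<lambda>t. G (x(i := t))) has_real_derivative partial_deriv i H (\<lambda>n. c n + x n)) (at (x i))" for x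
  proof -
    have eq: "(\<lambda>n. c n + (x(i := t)) n) = (\<lambda>n. c n + x n)(i := c i + t)" for t by auto
    show ?thesis
      unfolding H(2) eq
      using Cb_smooth_has_derivative[OF H(1), of "\<lambda>n. c n + x n" i]
        DERIV_at_within_shift[of "\<lambda>s. H ((\<lambda>n. c n + x n)(i := s))" _ "c i" "x i" UNIV] by simp
  qed
  with H show "\<exists>G'\<in>(\<lambda>F y. F (\<lambda>n. c n + y n)) ` Cb_smooth k.
      \<forall>x. ((\<lambda>t. G (x(i := t))) has_real_derivative G' x) (at (x i))"
    by (intro bexI[of _ "\<lambda>y. partial_deriv i H (\<lambda>n. c n + y n)"]) (auto intro: Cb_smooth_partial_deriv)
next
  fix G assume "G \<in> (\<lambda>F y. F (\<lambda>n. c n + y n)) ` Cb_smooth k"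
  then obtain H where H: "H \<in> Cb_smooth k" "G = (\<lambda>y. H (\<lambda>n. c n + y n))" by blast
  show "continuous_on UNIV G"
    unfolding H(2)
    by (rule continuous_on_coordinates[OF Cb_smooth_continuous[OF H(1)]])
      (intro continuous_on_add continuous_on_const continuous_on_coordinate)
next
  fix G assume "G \<in> (\<lambda>F y. F (\<lambda>n. c n + y n)) ` Cb_smooth k"
  then show "bounded (range G)"
    by (auto intro: bounded_subset[OF Cb_smooth_bounded])
qed (rule imageI[OF assms])

lemma Cb_smooth_shift:
  assumes "F \<in> Cb_smooth l"
  shows "(\<lambda>y. F (\<lambda>n. y (k + n))) \<in> Cb_smooth (k + l)"
proof (rule Cb_smoothI[where S = "(\<lambda>F y. F (\<lambda>n. y (k + n))) ` Cb_smooth l"])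
  fix x y :: "nat \<Rightarrow> real" assume "\<And>i. i < k + l \<Longrightarrow> x i = y i"
  then show "F (\<lambda>n. x (k + n)) = F (\<lambda>n. y (k + n))" by (intro Cb_smooth_cong[OF assms]) auto
next
  fix G i assume "G \<in> (\<lambda>F y. F (\<lambda>n. y (k + n))) ` Cb_smooth l"
  then obtain H where H: "H \<in> Cb_smooth l" "G = (\<lambda>y. H (\<lambda>n. y (k + n)))" by blast
  show "\<exists>G'\<in>(\<lambda>F y. F (\<lambda>n. y (k + n))) ` Cb_smooth l.
      \<forall>x. ((\<lambda>t. G (x(i := t))) has_real_derivative G' x) (at (x i))"
  proof (cases "i < k")
    case True
    then have "(\<lambda>n. (x(i := t)) (k + n)) = (\<lambda>n. x (k + n))" for x :: "nat \<Rightarrow> real" and t by auto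
    then show ?thesis
      unfolding H(2) by (intro bexI[of _ "\<lambda>_. 0"] image_eqI[of _ _ "\<lambda>_. 0"]) (auto intro: Cb_smooth_const)
  next
    case False
    then have eq: "(\<lambda>n. (x(i := t)) (k + n)) = (\<lambda>n. x (k + n))(i - k := t)"
      for x :: "nat \<Rightarrow> real" and t by (auto simp: fun_eq_iff)
    have "((\<lambda>t. G (x(i := t))) has_real_derivative partial_deriv (i - k) H (\<lambda>n. x (k + n))) (at (x i))" for x
      unfolding H(2) eq using Cb_smooth_has_derivative[OF H(1), of "\<lambda>n. x (k + n)" "i - k"] False by simp
    then show ?thesis
      by (intro bexI[of _ "\<lambda>y. partial_deriv (i - k) H (\<lambda>n. y (k + n))"])
        (auto intro: Cb_smooth_partial_deriv H(1))
  qed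
next
  fix G assume "G \<in> (\<lambda>F y. F (\<lambda>n. y (k + n))) ` Cb_smooth l"
  then obtain H where H: "H \<in> Cb_smooth l" "G = (\<lambda>y. H (\<lambda>n. y (k + n)))" by blast
  show "continuous_on UNIV G"
    unfolding H(2)
    by (rule continuous_on_coordinates[OF Cb_smooth_continuous[OF H(1)]])
      (rule continuous_on_coordinate)
next
  fix G assume "G \<in> (\<lambda>F y. F (\<lambda>n. y (k + n))) ` Cb_smooth l"
  then show "bounded (range G)"
    by (auto intro: bounded_subset[OF Cb_smooth_bounded])
qed (rule imageI[OF assms])

lemma Cb_smooth_sin: "(\<lambda>x. sin (c * x 0)) \<in> Cb_smooth 1"
proof (rule Cb_smoothI[where S = "{\<lambda>x :: nat \<Rightarrow> real. a * sin (c * x 0 + b) |a b. True}"])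
  show "(\<lambda>x. sin (c * x 0)) \<in> {\<lambda>x :: nat \<Rightarrow> real. a * sin (c * x 0 + b) |a b. True}"
    by (rule CollectI, rule exI[of _ 1], rule exI[of _ 0]) simp
next
  fix G i assume "G \<in> {\<lambda>x :: nat \<Rightarrow> real. a * sin (c * x 0 + b) |a b. True}" "i < (1::nat)"
  then obtain a b where G: "G = (\<lambda>x. a * sin (c * x 0 + b))" and "i = 0" by auto
  have "((\<lambda>t. G (x(0 := t))) has_real_derivative (a * c) * sin (c * x 0 + (b + pi / 2))) (at (x 0))" for x
  proof -
    have "sin (c * x 0 + (b + pi / 2)) = cos (c * x 0 + b)"
      using sin_add[of "c * x 0 + b" "pi / 2"] by (simp add: add.assoc)
    then show ?thesis unfolding G by (auto intro!: derivative_eq_intros)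
  qed
  then show "\<exists>G'\<in>{\<lambda>x :: nat \<Rightarrow> real. a * sin (c * x 0 + b) |a b. True}.
      \<forall>x. ((\<lambda>t. G (x(i := t))) has_real_derivative G' x) (at (x i))"
    unfolding \<open>i = 0\<close>
    by (intro bexI[of _ "\<lambda>x. (a * c) * sin (c * x 0 + (b + pi / 2))"]) (auto intro!: exI)
next
  fix G assume "G \<in> {\<lambda>x :: nat \<Rightarrow> real. a * sin (c * x 0 + b) |a b. True}"
  then show "continuous_on UNIV G"
    by (auto intro!: continuous_intros continuous_on_coordinate)
next
  fix G assume "G \<in> {\<lambda>x :: nat \<Rightarrow> real. a * sin (c * x 0 + b) |a b. True}"
  then obtain a b where G: "G = (\<lambda>x. a * sin (c * x 0 + b))" by auto
  have "\<bar>G x\<bar> \<le> \<bar>a\<bar> * 1" for x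
    unfolding G abs_mult by (intro mult_left_mono abs_sin_le_one) simp
  then show "bounded (range G)" unfolding bounded_iff by auto
qed auto


section \<open>A functional monotone class theorem\<close>

lemma real_polynomial_function_comp_in_algebra:
  fixes \<A> :: "('b \<Rightarrow> real) set"
  assumes const: "\<And>c. (\<lambda>_. c) \<in> \<A>"
    and add: "\<And>u v. u \<in> \<A> \<Longrightarrow> v \<in> \<A> \<Longrightarrow> (\<lambda>x. u x + v x) \<in> \<A>"
    and mult: "\<And>u v. u \<in> \<A> \<Longrightarrow> v \<in> \<A> \<Longrightarrow> (\<lambda>x. u x * v x) \<in> \<A>"
    and u: "u \<in> \<A>" and p: "real_polynomial_function (p :: real \<Rightarrow> real)"
  shows "(\<lambda>x. p (u x)) \<in> \<A>"
  using p
proof induction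
  case (linear f)
  have eq: "f t = t * f 1" for t
    using linear_scale[OF bounded_linear.linear[OF linear], of t 1] by simp
  show ?case by (subst eq) (rule mult[OF u const])
next
  case (const c)
  show ?case by (rule assms(1))
next
  case (add f g)
  show ?case by (rule assms(2)[OF add.IH])
next
  case (mult f g)
  show ?case by (rule assms(3)[OF mult.IH])
qed

text \<open>The level sets \<open>{u > a}\<close> of functions in the algebra \<open>\<A>\<close> belong to the class of sets whose
  indicator is a boundedly convergent limit from \<open>\<A>\<close>: compose \<open>u\<close> with polynomials that approximate
  the continuous functions \<open>t \<mapsto> min 1 (n (t - a)\<^sup>+)\<close> on the range of \<open>u\<close>.  That class is stable
  under intersections, so Dynkin's theorem applies.\<close>

theorem functional_monotone_class:
  fixes \<A> H :: "('b \<Rightarrow> real) set" and \<Omega> :: "'b set"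
  assumes const: "\<And>c. (\<lambda>_. c) \<in> \<A>"
    and add: "\<And>u v. u \<in> \<A> \<Longrightarrow> v \<in> \<A> \<Longrightarrow> (\<lambda>x. u x + v x) \<in> \<A>"
    and mult: "\<And>u v. u \<in> \<A> \<Longrightarrow> v \<in> \<A> \<Longrightarrow> (\<lambda>x. u x * v x) \<in> \<A>"
    and bdd: "\<And>u. u \<in> \<A> \<Longrightarrow> \<exists>C. \<forall>x\<in>\<Omega>. \<bar>u x\<bar> \<le> C"
    and sub: "\<A> \<subseteq> H"
    and lin: "\<And>u v a b. u \<in> H \<Longrightarrow> v \<in> H \<Longrightarrow> (\<lambda>x. a * u x + b * v x) \<in> H"
    and lim: "\<And>U u C. (\<And>n. U n \<in> H) \<Longrightarrow> (\<And>n x. x \<in> \<Omega> \<Longrightarrow> \<bar>U n x\<bar> \<le> C) \<Longrightarrow>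
        (\<And>x. x \<in> \<Omega> \<Longrightarrow> (\<lambda>n. U n x) \<longlonglongrightarrow> u x) \<Longrightarrow> u \<in> H"
    and A: "A \<in> sigma_sets \<Omega> {u -` {a<..} \<inter> \<Omega> |u a. u \<in> \<A>}"
  shows "indicator A \<in> H"
proof -
  define P where "P = {A. A \<subseteq> \<Omega> \<and> (\<exists>v C. (\<forall>n. v n \<in> \<A>) \<and> (\<forall>n. \<forall>x\<in>\<Omega>. \<bar>v n x\<bar> \<le> C) \<and>
      (\<forall>x\<in>\<Omega>. (\<lambda>n. v n x) \<longlonglongrightarrow> indicator A x))}"
  have in_P: "u -` {a<..} \<inter> \<Omega> \<in> P" if u: "u \<in> \<A>" for u a
  proof -
    obtain C where C: "\<And>x. x \<in> \<Omega> \<Longrightarrow> \<bar>u x\<bar> \<le> C" using bdd[OF u] by blast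
    define f where "f n t = min 1 (max 0 (real n * (t - a)))" for n and t :: real
    have "continuous_on {-C..C} (f n)" for n
      unfolding f_def by (intro continuous_intros)
    then have "\<exists>p. real_polynomial_function p \<and> (\<forall>t\<in>{-C..C}. \<bar>f n t - p t\<bar> < 1 / Suc n)" for n
      using Stone_Weierstrass_real_polynomial_function[of "{-C..C}" "f n" "1 / Suc n"]
      by (metis compact_Icc of_nat_0_less_iff zero_less_Suc zero_less_divide_1_iff)
    then obtain p where p: "\<And>n. real_polynomial_function (p n)"
      and close: "\<And>n t. t \<in> {-C..C} \<Longrightarrow> \<bar>f n t - p n t\<bar> < 1 / Suc n"
      by metis
    have close': "\<bar>f n (u x) - p n (u x)\<bar> < 1 / Suc n" if "x \<in> \<Omega>" for n x
      using C[OF that] by (intro close) auto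
    have "\<bar>p n (u x)\<bar> \<le> 2" if "x \<in> \<Omega>" for n x
    proof -
      have "\<bar>f n (u x)\<bar> \<le> 1" unfolding f_def by simp
      moreover have "1 / Suc n \<le> (1::real)" by simp
      ultimately show ?thesis using close'[OF that, of n] by linarith
    qed
    moreover have "(\<lambda>n. p n (u x)) \<longlonglongrightarrow> indicator (u -` {a<..} \<inter> \<Omega>) x" if "x \<in> \<Omega>" for x
    proof -
      have "(\<lambda>n. f n (u x)) \<longlonglongrightarrow> indicator (u -` {a<..} \<inter> \<Omega>) x"
      proof (cases "u x > a")
        case True
        obtain N where N: "1 < real N * (u x - a)"
          using reals_Archimedean3[of "u x - a"] True by auto
        have "f n (u x) = 1" if "n \<ge> N" for n
        proof -
          have "real N * (u x - a) \<le> real n * (u x - a)"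
            using that True by (intro mult_right_mono) auto
          with N show ?thesis unfolding f_def by simp
        qed
        then have "eventually (\<lambda>n. f n (u x) = 1) sequentially"
          using eventually_sequentially by blast
        then show ?thesis using True that by (simp add: tendsto_eventually)
      next
        case False
        then have "f n (u x) = 0" for n
          unfolding f_def using mult_nonneg_nonpos[of "real n" "u x - a"] by simp
        then show ?thesis using False by simp
      qed
      moreover have "(\<lambda>n. f n (u x) - p n (u x)) \<longlonglongrightarrow> 0"
      proof (rule Lim_null_comparison)
        show "\<forall>\<^sub>F n in sequentially. norm (f n (u x) - p n (u x)) \<le> inverse (real (Suc n))"
          using close'[OF that] by (intro always_eventually) (simp add: inverse_eq_divide less_imp_le)
      qed (rule LIMSEQ_inverse_real_of_nat)
      ultimately show ?thesis using tendsto_diff by fastforce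
    qed
    moreover have "(\<lambda>x. p n (u x)) \<in> \<A>" for n
      by (rule real_polynomial_function_comp_in_algebra[OF const add mult u p])
    ultimately show ?thesis
      unfolding P_def by (intro CollectI conjI exI[of _ "\<lambda>n x. p n (u x)"] exI[of _ 2]) auto
  qed
  have "Int_stable P"
  proof (rule Int_stableI)
    fix A B assume "A \<in> P" "B \<in> P"
    from \<open>A \<in> P\<close> obtain v C where v: "\<forall>n. v n \<in> \<A>" "\<forall>n. \<forall>x\<in>\<Omega>. \<bar>v n x\<bar> \<le> C"
        "\<forall>x\<in>\<Omega>. (\<lambda>n. v n x) \<longlonglongrightarrow> indicator A x" and "A \<subseteq> \<Omega>"
      unfolding P_def by blast
    from \<open>B \<in> P\<close> obtain w C' where w: "\<forall>n. w n \<in> \<A>" "\<forall>n. \<forall>x\<in>\<Omega>. \<bar>w n x\<bar> \<le> C'"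
        "\<forall>x\<in>\<Omega>. (\<lambda>n. w n x) \<longlonglongrightarrow> indicator B x"
      unfolding P_def by blast
    note v = v[rule_format] and w = w[rule_format]
    have "\<bar>v n x * w n x\<bar> \<le> C * C'" if "x \<in> \<Omega>" for n x
      unfolding abs_mult using v(2)[OF that] w(2)[OF that]
      by (intro mult_mono) (auto intro: order_trans[OF abs_ge_zero])
    moreover have "(\<lambda>n. v n x * w n x) \<longlonglongrightarrow> indicator (A \<inter> B) x" if "x \<in> \<Omega>" for x
      using tendsto_mult[OF v(3)[OF that] w(3)[OF that]] by (simp add: indicator_inter_arith)
    ultimately show "A \<inter> B \<in> P"
      unfolding P_def using \<open>A \<subseteq> \<Omega>\<close> v(1) w(1)
      by (intro CollectI conjI exI[of _ "\<lambda>n x. v n x * w n x"] exI[of _ "C * C'"]) (auto intro: mult)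
  qed
  moreover have "P \<subseteq> Pow \<Omega>" unfolding P_def by blast
  moreover have "A \<in> sigma_sets \<Omega> P"
    using A by (rule sigma_sets_mono'[THEN subsetD, rotated]) (auto intro: in_P)
  ultimately show ?thesis
  proof (induction rule: sigma_sets_induct_disjoint)
    case (basic A)
    then obtain v C where v: "\<forall>n. v n \<in> \<A>" "\<forall>n. \<forall>x\<in>\<Omega>. \<bar>v n x\<bar> \<le> C"
        "\<forall>x\<in>\<Omega>. (\<lambda>n. v n x) \<longlonglongrightarrow> indicator A x"
      unfolding P_def by blast
    show ?case
    proof (rule lim)
      show "v n \<in> H" for n using v(1) sub by blast
      show "\<bar>v n x\<bar> \<le> C" if "x \<in> \<Omega>" for n x using v(2) that by blast
      show "(\<lambda>n. v n x) \<longlonglongrightarrow> indicator A x" if "x \<in> \<Omega>" for x using v(3) that by blast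
    qed
  next
    case empty
    then show ?case using const[of 0] sub by (auto simp: indicator_def[abs_def])
  next
    case (compl A)
    have "(\<lambda>x. 1 * 1 + (-1) * indicator A x :: real) \<in> H"
      using const[of 1] sub by (intro lin compl) auto
    then show ?case
    proof (rule lim)
      show "\<bar>1 * 1 + (-1) * indicator A x\<bar> \<le> (1::real)" if "x \<in> \<Omega>" for x
        by (simp add: indicator_def)
      show "(\<lambda>_. 1 * 1 + (-1) * indicator A x) \<longlonglongrightarrow> (indicator (\<Omega> - A) x :: real)" if "x \<in> \<Omega>" for x
        using that by (simp add: indicator_def)
    qed
  next
    case (union F)
    have "indicator (\<Union>i<n. F i) \<in> H" for n
    proof (induction n)
      case 0
      then show ?case using const[of 0] sub by (auto simp: indicator_def[abs_def])
    next
      case (Suc n)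
      have "F n \<inter> F i = {}" if "i < n" for i
        using union(1) that by (auto simp: disjoint_family_on_def)
      then have "indicator (\<Union>i<Suc n. F i) = (\<lambda>x. 1 * indicator (\<Union>i<n. F i) x + 1 * indicator (F n) x :: real)"
        by (auto simp: indicator_def fun_eq_iff less_Suc_eq)
      with lin[OF Suc union(3)[of n], of 1 1] show ?case by simp
    qed
    then show ?case
    proof (rule lim)
      show "\<bar>indicator (\<Union>i<n. F i) x\<bar> \<le> (1::real)" for n x
        by (simp add: indicator_def)
    qed (rule LIMSEQ_indicator_UN)
  qed
qed

section \<open>Approximation in \<open>L\<^sup>2\<close>\<close>

lemma square_diff_le: "((a::real) - c)\<^sup>2 \<le> 2 * (a - b)\<^sup>2 + 2 * (b - c)\<^sup>2"
proof -
  have "0 \<le> ((a - b) - (b - c))\<^sup>2" by simp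
  then show ?thesis by (simp add: power2_eq_square algebra_simps)
qed

lemma square_sum_le: "((a::real) + b)\<^sup>2 \<le> 2 * a\<^sup>2 + 2 * b\<^sup>2"
  using square_diff_le[of a "-b" 0] by simp

lemma nn_integral_square_sum_le:
  fixes f g :: "'b \<Rightarrow> real"
  assumes [measurable]: "f \<in> borel_measurable M" "g \<in> borel_measurable M"
  shows "(\<integral>\<^sup>+x. ennreal ((f x + g x)\<^sup>2) \<partial>M) \<le>
    2 * (\<integral>\<^sup>+x. ennreal ((f x)\<^sup>2) \<partial>M) + 2 * (\<integral>\<^sup>+x. ennreal ((g x)\<^sup>2) \<partial>M)"
proof -
  have "ennreal ((f x + g x)\<^sup>2) \<le> 2 * ennreal ((f x)\<^sup>2) + 2 * ennreal ((g x)\<^sup>2)" for x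
    using ennreal_leI[OF square_sum_le[of "f x" "g x"]] by (simp add: ennreal_mult')
  then have "(\<integral>\<^sup>+x. ennreal ((f x + g x)\<^sup>2) \<partial>M) \<le>
      (\<integral>\<^sup>+x. 2 * ennreal ((f x)\<^sup>2) + 2 * ennreal ((g x)\<^sup>2) \<partial>M)"
    by (intro nn_integral_mono) blast
  also have "\<dots> = 2 * (\<integral>\<^sup>+x. ennreal ((f x)\<^sup>2) \<partial>M) + 2 * (\<integral>\<^sup>+x. ennreal ((g x)\<^sup>2) \<partial>M)"
    by (simp add: nn_integral_add nn_integral_cmult)
  finally show ?thesis .
qed

lemma tendsto_0_le_ennreal:
  fixes f g :: "'b \<Rightarrow> ennreal"
  assumes "\<And>n. f n \<le> g n" "(g \<longlongrightarrow> 0) F"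
  shows "(f \<longlongrightarrow> 0) F"
  by (rule tendsto_sandwich[OF _ _ tendsto_const assms(2)]) (auto simp: assms(1))

lemma L2_tendsto_add:
  assumes [measurable]: "\<And>n. u n \<in> borel_measurable M" "\<And>n. v n \<in> borel_measurable M"
    "f \<in> borel_measurable M" "g \<in> borel_measurable M"
    and "L2_tendsto M u f" "L2_tendsto M v g"
  shows "L2_tendsto M (\<lambda>n x. a * u n x + b * v n x) (\<lambda>x. a * f x + b * g x)"
  unfolding L2_tendsto_def
proof (rule tendsto_0_le_ennreal)
  fix n
  have "(\<integral>\<^sup>+x. ennreal ((a * u n x + b * v n x - (a * f x + b * g x))\<^sup>2) \<partial>M) =
      (\<integral>\<^sup>+x. ennreal ((a * (u n x - f x) + b * (v n x - g x))\<^sup>2) \<partial>M)"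
    by (intro nn_integral_cong arg_cong[where f = ennreal]) (simp add: algebra_simps)
  also have "\<dots> \<le> 2 * (\<integral>\<^sup>+x. ennreal ((a * (u n x - f x))\<^sup>2) \<partial>M)
      + 2 * (\<integral>\<^sup>+x. ennreal ((b * (v n x - g x))\<^sup>2) \<partial>M)"
    by (rule nn_integral_square_sum_le) measurable
  also have "\<dots> = 2 * (ennreal (a\<^sup>2) * (\<integral>\<^sup>+x. ennreal ((u n x - f x)\<^sup>2) \<partial>M))
      + 2 * (ennreal (b\<^sup>2) * (\<integral>\<^sup>+x. ennreal ((v n x - g x)\<^sup>2) \<partial>M))"
    by (simp add: power_mult_distrib ennreal_mult nn_integral_cmult)
  finally show "(\<integral>\<^sup>+x. ennreal ((a * u n x + b * v n x - (a * f x + b * g x))\<^sup>2) \<partial>M) \<le> \<dots>" .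
next
  have "(\<lambda>n. 2 * (ennreal (a\<^sup>2) * (\<integral>\<^sup>+x. ennreal ((u n x - f x)\<^sup>2) \<partial>M))
      + 2 * (ennreal (b\<^sup>2) * (\<integral>\<^sup>+x. ennreal ((v n x - g x)\<^sup>2) \<partial>M))) \<longlonglongrightarrow>
      2 * (ennreal (a\<^sup>2) * 0) + 2 * (ennreal (b\<^sup>2) * 0)"
    by (intro tendsto_add ennreal_tendsto_cmult assms(5,6)[unfolded L2_tendsto_def])
      (simp_all add: ennreal_less_top)
  then show "(\<lambda>n. 2 * (ennreal (a\<^sup>2) * (\<integral>\<^sup>+x. ennreal ((u n x - f x)\<^sup>2) \<partial>M))
      + 2 * (ennreal (b\<^sup>2) * (\<integral>\<^sup>+x. ennreal ((v n x - g x)\<^sup>2) \<partial>M))) \<longlonglongrightarrow> 0"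
    by simp
qed

lemma L2_tendsto_cong_AE:
  assumes "\<And>n. AE x in M. u n x = v n x" "AE x in M. f x = g x"
  shows "L2_tendsto M u f \<longleftrightarrow> L2_tendsto M v g"
proof -
  have "(\<integral>\<^sup>+x. ennreal ((u n x - f x)\<^sup>2) \<partial>M) = (\<integral>\<^sup>+x. ennreal ((v n x - g x)\<^sup>2) \<partial>M)" for n
    using assms(1)[of n] assms(2) by (intro nn_integral_cong_AE) auto
  then show ?thesis unfolding L2_tendsto_def by simp
qed

text \<open>The closure of \<open>D\<close> in \<open>L\<^sup>2(M)\<close>, as a set of representatives.\<close>

definition L2_limits :: "'b measure \<Rightarrow> ('b \<Rightarrow> real) set \<Rightarrow> ('b \<Rightarrow> real) set" where
  "L2_limits M D = {v \<in> borel_measurable M. \<exists>u. (\<forall>n. u n \<in> D) \<and> L2_tendsto M u v}"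

lemma L2_limits_cong_AE:
  assumes "f \<in> L2_limits M D" "AE x in M. f x = g x" "g \<in> borel_measurable M"
  shows "g \<in> L2_limits M D"
proof -
  obtain u where "\<And>n. u n \<in> D" "L2_tendsto M u f"
    using assms(1) unfolding L2_limits_def by auto
  moreover have "L2_tendsto M u f \<longleftrightarrow> L2_tendsto M u g"
    using assms(2) by (intro L2_tendsto_cong_AE) auto
  ultimately show ?thesis using assms(3) unfolding L2_limits_def by blast
qed

lemma L2_limits_closed:
  assumes D: "D \<subseteq> borel_measurable M" and v: "\<And>n. v n \<in> L2_limits M D"
    and [measurable]: "f \<in> borel_measurable M" and lim: "L2_tendsto M v f"
  shows "f \<in> L2_limits M D"
proof -
  have "\<forall>n. \<exists>u. u \<in> D \<and> (\<integral>\<^sup>+x. ennreal ((u x - v n x)\<^sup>2) \<partial>M) < ennreal (1 / Suc n)"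
  proof
    fix n
    obtain u where u: "\<And>m. u m \<in> D" "L2_tendsto M u (v n)"
      using v[of n] unfolding L2_limits_def by blast
    have "\<forall>\<^sub>F m in sequentially. (\<integral>\<^sup>+x. ennreal ((u m x - v n x)\<^sup>2) \<partial>M) < ennreal (1 / Suc n)"
      using u(2) unfolding L2_tendsto_def by (rule order_tendstoD) simp
    then obtain m where "(\<integral>\<^sup>+x. ennreal ((u m x - v n x)\<^sup>2) \<partial>M) < ennreal (1 / Suc n)"
      using eventually_happens'[OF sequentially_bot] by blast
    with u(1)[of m] show "\<exists>u. u \<in> D \<and> (\<integral>\<^sup>+x. ennreal ((u x - v n x)\<^sup>2) \<partial>M) < ennreal (1 / Suc n)"
      by blast
  qed
  from choice[OF this] obtain u where u: "\<And>n. u n \<in> D"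
    and close: "\<And>n. (\<integral>\<^sup>+x. ennreal ((u n x - v n x)\<^sup>2) \<partial>M) < ennreal (1 / Suc n)"
    by blast
  have [measurable]: "u n \<in> borel_measurable M" "v n \<in> borel_measurable M" for n
    using u D v unfolding L2_limits_def by auto
  have "L2_tendsto M u f"
    unfolding L2_tendsto_def
  proof (rule tendsto_0_le_ennreal)
    fix n
    have "(\<integral>\<^sup>+x. ennreal ((u n x - f x)\<^sup>2) \<partial>M) =
        (\<integral>\<^sup>+x. ennreal (((u n x - v n x) + (v n x - f x))\<^sup>2) \<partial>M)" by simp
    also have "\<dots> \<le> 2 * (\<integral>\<^sup>+x. ennreal ((u n x - v n x)\<^sup>2) \<partial>M) + 2 * (\<integral>\<^sup>+x. ennreal ((v n x - f x)\<^sup>2) \<partial>M)"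
      by (rule nn_integral_square_sum_le) measurable
    also have "\<dots> \<le> 2 * ennreal (1 / Suc n) + 2 * (\<integral>\<^sup>+x. ennreal ((v n x - f x)\<^sup>2) \<partial>M)"
      by (intro add_right_mono mult_left_mono less_imp_le[OF close]) auto
    finally show "(\<integral>\<^sup>+x. ennreal ((u n x - f x)\<^sup>2) \<partial>M) \<le> \<dots>" .
  next
    have "(\<lambda>n. 1 / real (Suc n)) \<longlonglongrightarrow> 0"
      using LIMSEQ_inverse_real_of_nat by (simp add: inverse_eq_divide)
    then have "(\<lambda>n. ennreal (1 / Suc n)) \<longlonglongrightarrow> ennreal 0" by (rule tendsto_ennrealI)
    then have "(\<lambda>n. 2 * ennreal (1 / Suc n) + 2 * (\<integral>\<^sup>+x. ennreal ((v n x - f x)\<^sup>2) \<partial>M)) \<longlonglongrightarrow> 2 * ennreal 0 + 2 * 0"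
      by (intro tendsto_add ennreal_tendsto_cmult lim[unfolded L2_tendsto_def]) simp_all
    then show "(\<lambda>n. 2 * ennreal (1 / Suc n) + 2 * (\<integral>\<^sup>+x. ennreal ((v n x - f x)\<^sup>2) \<partial>M)) \<longlonglongrightarrow> 0" by simp
  qed
  with u show ?thesis unfolding L2_limits_def by auto
qed

lemma L2_tendsto_dominated:
  assumes [measurable]: "\<And>n. u n \<in> borel_measurable M" "f \<in> borel_measurable M" "g \<in> borel_measurable M"
    and int: "(\<integral>\<^sup>+x. ennreal ((g x)\<^sup>2) \<partial>M) < \<infinity>"
    and bound: "\<And>n x. x \<in> space M \<Longrightarrow> \<bar>u n x\<bar> \<le> g x" "\<And>x. x \<in> space M \<Longrightarrow> \<bar>f x\<bar> \<le> g x"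
    and lim: "\<And>x. x \<in> space M \<Longrightarrow> (\<lambda>n. u n x) \<longlonglongrightarrow> f x"
  shows "L2_tendsto M u f"
proof -
  have le: "(u n x - f x)\<^sup>2 \<le> 4 * (g x)\<^sup>2" if "x \<in> space M" for n x
  proof -
    have "\<bar>u n x - f x\<bar> \<le> 2 * g x" using bound(1)[OF that, of n] bound(2)[OF that] by arith
    then have "\<bar>u n x - f x\<bar>\<^sup>2 \<le> (2 * g x)\<^sup>2" by (intro power_mono) auto
    then show ?thesis by (simp add: power_mult_distrib)
  qed
  have "(\<lambda>n. \<integral>\<^sup>+x. ennreal ((u n x - f x)\<^sup>2) \<partial>M) \<longlonglongrightarrow> (\<integral>\<^sup>+x. 0 \<partial>M)"
  proof (rule nn_integral_dominated_convergence[where w = "\<lambda>x. ennreal (4 * (g x)\<^sup>2)"])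
    show "AE x in M. ennreal ((u n x - f x)\<^sup>2) \<le> ennreal (4 * (g x)\<^sup>2)" for n
      using le by (intro AE_I2 ennreal_leI) auto
    have "(\<integral>\<^sup>+x. ennreal (4 * (g x)\<^sup>2) \<partial>M) = 4 * (\<integral>\<^sup>+x. ennreal ((g x)\<^sup>2) \<partial>M)"
      by (simp add: ennreal_mult'' nn_integral_cmult)
    also have "\<dots> < \<infinity>" using int by (simp add: ennreal_mult_less_top)
    finally show "(\<integral>\<^sup>+x. ennreal (4 * (g x)\<^sup>2) \<partial>M) < \<infinity>" .
    show "AE x in M. (\<lambda>n. ennreal ((u n x - f x)\<^sup>2)) \<longlonglongrightarrow> 0"
    proof (rule AE_I2)
      fix x assume "x \<in> space M"
      then have "(\<lambda>n. (u n x - f x)\<^sup>2) \<longlonglongrightarrow> (f x - f x)\<^sup>2"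
        by (intro tendsto_intros lim)
      from tendsto_ennrealI[OF this] show "(\<lambda>n. ennreal ((u n x - f x)\<^sup>2)) \<longlonglongrightarrow> 0"
        by simp
    qed
  qed measurable
  then show ?thesis unfolding L2_tendsto_def by simp
qed

text \<open>An algebra of bounded functions that generates the \<open>\<sigma>\<close>-algebra up to null sets is dense.\<close>

theorem L2_limits_algebra:
  fixes D :: "('b \<Rightarrow> real) set"
  assumes "finite_measure M" and D: "D \<subseteq> borel_measurable M"
    and const: "\<And>c. (\<lambda>_. c) \<in> D"
    and add: "\<And>u v. u \<in> D \<Longrightarrow> v \<in> D \<Longrightarrow> (\<lambda>x. u x + v x) \<in> D"
    and mult: "\<And>u v. u \<in> D \<Longrightarrow> v \<in> D \<Longrightarrow> (\<lambda>x. u x * v x) \<in> D"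
    and bdd: "\<And>u. u \<in> D \<Longrightarrow> \<exists>C. \<forall>x\<in>space M. \<bar>u x\<bar> \<le> C"
    and gen: "\<And>A. A \<in> sets M \<Longrightarrow>
      \<exists>B\<in>sigma_sets (space M) {u -` {a<..} \<inter> space M |u a. u \<in> D}. AE x in M. x \<in> A \<longleftrightarrow> x \<in> B"
    and v: "v \<in> L2 M"
  shows "v \<in> L2_limits M D"
proof -
  interpret finite_measure M by fact
  have D_sub: "D \<subseteq> L2_limits M D"
  proof
    fix u assume "u \<in> D"
    moreover have "L2_tendsto M (\<lambda>_. u) u" unfolding L2_tendsto_def by simp
    ultimately show "u \<in> L2_limits M D" using D unfolding L2_limits_def by auto
  qed
  have lin: "(\<lambda>x. a * u x + b * w x) \<in> L2_limits M D"
    if u: "u \<in> L2_limits M D" and w: "w \<in> L2_limits M D" for u w a b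
  proof -
    obtain p q where p: "\<And>n. p n \<in> D" "L2_tendsto M p u" and q: "\<And>n. q n \<in> D" "L2_tendsto M q w"
      using u w unfolding L2_limits_def by blast
    have [measurable]: "u \<in> borel_measurable M" "w \<in> borel_measurable M"
      "\<And>n. p n \<in> borel_measurable M" "\<And>n. q n \<in> borel_measurable M"
      using u w p q D unfolding L2_limits_def by auto
    have "(\<lambda>x. a * p n x + b * q n x) \<in> D" for n
      using add[OF mult[OF const[of a] p(1)] mult[OF const[of b] q(1)]] .
    moreover have "L2_tendsto M (\<lambda>n x. a * p n x + b * q n x) (\<lambda>x. a * u x + b * w x)"
      by (intro L2_tendsto_add p q) measurable
    ultimately show ?thesis
      unfolding L2_limits_def
      by (intro CollectI conjI exI[of _ "\<lambda>n x. a * p n x + b * q n x"]) auto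
  qed
  have gen_ind: "indicator B \<in> L2_limits M D"
    if "B \<in> sigma_sets (space M) {u -` {a<..} \<inter> space M |u a. u \<in> D}" for B
  proof (rule functional_monotone_class[OF const add mult bdd D_sub lin _ that])
    fix U u C
    assume U: "\<And>n. U n \<in> L2_limits M D" and C: "\<And>n x. x \<in> space M \<Longrightarrow> \<bar>U n x\<bar> \<le> C"
      and lim: "\<And>x. x \<in> space M \<Longrightarrow> (\<lambda>n. U n x) \<longlonglongrightarrow> u x"
    have [measurable]: "U n \<in> borel_measurable M" for n using U unfolding L2_limits_def by auto
    have u[measurable]: "u \<in> borel_measurable M"
      by (rule borel_measurable_LIMSEQ_real[OF lim]) auto
    have "\<bar>u x\<bar> \<le> C" if "x \<in> space M" for x
      using tendsto_rabs[OF lim[OF that]] C[OF that] by (intro LIMSEQ_le_const2) auto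
    then have "L2_tendsto M U u"
      using lim C by (intro L2_tendsto_dominated[where g = "\<lambda>_. C"])
        (auto simp: ennreal_mult_less_top emeasure_eq_measure)
    then show "u \<in> L2_limits M D" by (rule L2_limits_closed[OF D U u])
  qed
  have ind: "indicator A \<in> L2_limits M D" if A: "A \<in> sets M" for A
  proof -
    obtain B where B: "B \<in> sigma_sets (space M) {u -` {a<..} \<inter> space M |u a. u \<in> D}"
      "AE x in M. x \<in> A \<longleftrightarrow> x \<in> B" using gen[OF A] by blast
    then have "AE x in M. indicator B x = (indicator A x :: real)" by (auto simp: indicator_def)
    then show ?thesis
      by (rule L2_limits_cong_AE[OF gen_ind[OF B(1)]]) (use A in measurable)
  qed
  have nonneg: "f \<in> L2_limits M D"
    if f: "f \<in> borel_measurable M" "\<And>x. 0 \<le> f x" and int: "(\<integral>\<^sup>+x. ennreal ((f x)\<^sup>2) \<partial>M) < \<infinity>" for f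
  proof -
    have "(\<integral>\<^sup>+x. ennreal ((f x)\<^sup>2) \<partial>M) < \<infinity> \<longrightarrow> f \<in> L2_limits M D"
      using f
    proof (induction rule: borel_measurable_induct_real)
      case (set A)
      then show ?case using ind by blast
    next
      case (mult u c)
      show ?case
      proof (cases "c = 0")
        case True
        then show ?thesis using const[of 0] D_sub by auto
      next
        case False
        have "(\<integral>\<^sup>+x. ennreal ((c * u x)\<^sup>2) \<partial>M) = ennreal (c\<^sup>2) * (\<integral>\<^sup>+x. ennreal ((u x)\<^sup>2) \<partial>M)"
          using mult(2) by (simp add: power_mult_distrib ennreal_mult nn_integral_cmult)
        with False mult(4) lin[of u u c 0] show ?thesis
          by (auto simp: ennreal_mult_less_top)
      qed
    next
      case (add u w)
      show ?case
      proof
        assume fin: "(\<integral>\<^sup>+x. ennreal ((w x + u x)\<^sup>2) \<partial>M) < \<infinity>"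
        have "(\<integral>\<^sup>+x. ennreal ((u x)\<^sup>2) \<partial>M) \<le> (\<integral>\<^sup>+x. ennreal ((w x + u x)\<^sup>2) \<partial>M)"
          "(\<integral>\<^sup>+x. ennreal ((w x)\<^sup>2) \<partial>M) \<le> (\<integral>\<^sup>+x. ennreal ((w x + u x)\<^sup>2) \<partial>M)"
          using add.hyps(2,4) by (auto intro!: nn_integral_mono ennreal_leI power_mono)
        then have "u \<in> L2_limits M D" "w \<in> L2_limits M D"
          using add.IH fin by (auto dest: le_less_trans)
        from lin[OF this(2,1), of 1 1] show "(\<lambda>x. w x + u x) \<in> L2_limits M D" by simp
      qed
    next
      case (seq U)
      have le: "\<bar>U i x\<bar> \<le> f x" if "x \<in> space M" for i x
        using incseq_le[of "\<lambda>i. U i x" "f x"] seq.hyps(2,3,4) that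
        by (auto simp: incseq_def le_fun_def)
      show ?case
      proof
        assume fin: "(\<integral>\<^sup>+x. ennreal ((f x)\<^sup>2) \<partial>M) < \<infinity>"
        have "(\<integral>\<^sup>+x. ennreal ((U i x)\<^sup>2) \<partial>M) \<le> (\<integral>\<^sup>+x. ennreal ((f x)\<^sup>2) \<partial>M)" for i
          using le[of _ i] seq(2)
          by (intro nn_integral_mono ennreal_leI power_mono) auto
        then have "U i \<in> L2_limits M D" for i using seq.IH fin by (auto dest: le_less_trans)
        moreover have "L2_tendsto M U f"
          using seq.hyps(1,4) f le fin by (intro L2_tendsto_dominated[where g = f]) auto
        ultimately show "f \<in> L2_limits M D" by (rule L2_limits_closed[OF D _ f(1)])
      qed
    qed
    with int show ?thesis by blast
  qed
  have [measurable]: "v \<in> borel_measurable M" and fin: "(\<integral>\<^sup>+x. ennreal ((v x)\<^sup>2) \<partial>M) < \<infinity>"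
    using v unfolding L2_def by (auto simp: integrable_iff_bounded)
  have "(\<integral>\<^sup>+x. ennreal ((max 0 (v x))\<^sup>2) \<partial>M) \<le> (\<integral>\<^sup>+x. ennreal ((v x)\<^sup>2) \<partial>M)"
    "(\<integral>\<^sup>+x. ennreal ((max 0 (- v x))\<^sup>2) \<partial>M) \<le> (\<integral>\<^sup>+x. ennreal ((v x)\<^sup>2) \<partial>M)"
    by (intro nn_integral_mono ennreal_leI, simp add: max_def power2_eq_square)+
  then have "(\<lambda>x. max 0 (v x)) \<in> L2_limits M D" "(\<lambda>x. max 0 (- v x)) \<in> L2_limits M D"
    using fin by (auto intro!: nonneg dest: le_less_trans)
  from lin[OF this, of 1 "-1"] have "(\<lambda>x. max 0 (v x) - max 0 (- v x)) \<in> L2_limits M D" by simp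
  moreover have "(\<lambda>x. max 0 (v x) - max 0 (- v x)) = v" by (auto simp: max_def)
  ultimately show ?thesis by simp
qed


section \<open>Integration against configurations\<close>

text \<open>Integrals against a family of measures with measurable dependence on the parameter.  The
  measures need not be finite, and their \<open>\<sigma>\<close>-algebras may be larger than that of the integrand.\<close>

lemma measurable_nn_integral_kernel:
  assumes sub: "\<And>\<gamma>. \<gamma> \<in> space S \<Longrightarrow> subalgebra (\<kappa> \<gamma>) N"
    and em: "\<And>A. A \<in> sets N \<Longrightarrow> (\<lambda>\<gamma>. emeasure (\<kappa> \<gamma>) A) \<in> borel_measurable S"
    and g: "g \<in> borel_measurable N"
  shows "(\<lambda>\<gamma>. \<integral>\<^sup>+x. g x \<partial>\<kappa> \<gamma>) \<in> borel_measurable S"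
  using g
proof (induction rule: borel_measurable_induct)
  case (cong f g)
  have "(\<integral>\<^sup>+x. f x \<partial>\<kappa> \<gamma>) = (\<integral>\<^sup>+x. g x \<partial>\<kappa> \<gamma>)" if "\<gamma> \<in> space S" for \<gamma>
    using cong(3) sub[OF that] by (intro nn_integral_cong) (simp add: subalgebra_def)
  with cong(4) show ?case by (simp cong: measurable_cong)
next
  case (set A)
  have "(\<integral>\<^sup>+x. indicator A x \<partial>\<kappa> \<gamma>) = emeasure (\<kappa> \<gamma>) A" if "\<gamma> \<in> space S" for \<gamma>
    using set sub[OF that] by (intro nn_integral_indicator) (auto simp: subalgebra_def)
  with em[OF set] show ?case by (simp cong: measurable_cong)
next
  case (mult u c)
  have "(\<integral>\<^sup>+x. c * u x \<partial>\<kappa> \<gamma>) = c * (\<integral>\<^sup>+x. u x \<partial>\<kappa> \<gamma>)" if "\<gamma> \<in> space S" for \<gamma>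
    using measurable_from_subalg[OF sub[OF that] mult(2)] by (rule nn_integral_cmult)
  with mult(4) show ?case by (simp cong: measurable_cong)
next
  case (add u v)
  have "(\<integral>\<^sup>+x. v x + u x \<partial>\<kappa> \<gamma>) = (\<integral>\<^sup>+x. v x \<partial>\<kappa> \<gamma>) + (\<integral>\<^sup>+x. u x \<partial>\<kappa> \<gamma>)" if "\<gamma> \<in> space S" for \<gamma>
    using measurable_from_subalg[OF sub[OF that] add(1)] measurable_from_subalg[OF sub[OF that] add(3)]
    by (intro nn_integral_add)
  with add.IH show ?case by (simp cong: measurable_cong)
next
  case (seq U)
  have "(\<integral>\<^sup>+x. (SUP i. U i) x \<partial>\<kappa> \<gamma>) = (SUP i. \<integral>\<^sup>+x. U i x \<partial>\<kappa> \<gamma>)" if "\<gamma> \<in> space S" for \<gamma>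
    unfolding SUP_apply using measurable_from_subalg[OF sub[OF that] seq(1)] seq(3)
    by (intro nn_integral_monotone_convergence_SUP) (auto simp: incseq_def le_fun_def)
  moreover have "(\<lambda>\<gamma>. SUP i. \<integral>\<^sup>+x. U i x \<partial>\<kappa> \<gamma>) \<in> borel_measurable S"
    by (intro borel_measurable_SUP seq.IH) auto
  ultimately show ?case by (simp cong: measurable_cong)
qed

lemma sets_add_point [simp]: "sets (add_point \<gamma> x) = sets \<gamma>"
  unfolding add_point_def by (simp add: sets.space_closed sets.sigma_sets_eq)

lemma space_add_point [simp]: "space (add_point \<gamma> x) = space \<gamma>"
  using sets_eq_imp_space_eq[OF sets_add_point] .

lemma emeasure_add_point:
  assumes "A \<in> sets \<gamma>"
  shows "emeasure (add_point \<gamma> x) A = emeasure \<gamma> A + indicator A x"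
proof -
  have "emeasure (add_point \<gamma> x) A = emeasure \<gamma> A + emeasure (return \<gamma> x) A"
  proof (rule emeasure_measure_of[OF add_point_def sets.space_closed])
    show "countably_additive (sets (add_point \<gamma> x)) (\<lambda>A. emeasure \<gamma> A + emeasure (return \<gamma> x) A)"
    proof (rule countably_additiveI)
      fix B :: "nat \<Rightarrow> 'a set"
      assume "range B \<subseteq> sets (add_point \<gamma> x)" "disjoint_family B"
      then have B: "range B \<subseteq> sets \<gamma>" "range B \<subseteq> sets (return \<gamma> x)" "disjoint_family B"
        by simp_all
      show "(\<Sum>i. emeasure \<gamma> (B i) + emeasure (return \<gamma> x) (B i)) =
          emeasure \<gamma> (\<Union>i. B i) + emeasure (return \<gamma> x) (\<Union>i. B i)"
        unfolding suminf_emeasure[OF B(1,3), symmetric] suminf_emeasure[OF B(2,3), symmetric]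
        by (rule suminf_add[symmetric]) auto
    qed
  next
    show "A \<in> sets (add_point \<gamma> x)" using assms by simp
    show "positive (sets (add_point \<gamma> x)) (\<lambda>A. emeasure \<gamma> A + emeasure (return \<gamma> x) A)"
      by (simp add: positive_def)
  qed
  then show ?thesis using assms by simp
qed

lemma nn_integral_add_point:
  assumes g: "g \<in> borel_measurable \<gamma>" and x: "x \<in> space \<gamma>"
  shows "(\<integral>\<^sup>+y. g y \<partial>add_point \<gamma> x) = (\<integral>\<^sup>+y. g y \<partial>\<gamma>) + g x"
  using g
proof (induction rule: borel_measurable_induct)
  case (cong f g)
  have "(\<integral>\<^sup>+y. f y \<partial>add_point \<gamma> x) = (\<integral>\<^sup>+y. g y \<partial>add_point \<gamma> x)" "(\<integral>\<^sup>+y. f y \<partial>\<gamma>) = (\<integral>\<^sup>+y. g y \<partial>\<gamma>)"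
    using cong(3) by (auto intro!: nn_integral_cong)
  with cong x show ?case by simp
next
  case (set A)
  then show ?case by (simp add: emeasure_add_point)
next
  case (mult u c)
  moreover from mult(2) have "u \<in> borel_measurable (add_point \<gamma> x)"
    by (simp cong: measurable_cong_sets)
  ultimately show ?case by (simp add: nn_integral_cmult distrib_left)
next
  case (add u v)
  moreover from add(1,3) have "u \<in> borel_measurable (add_point \<gamma> x)" "v \<in> borel_measurable (add_point \<gamma> x)"
    by (simp_all cong: measurable_cong_sets)
  ultimately show ?case by (simp add: nn_integral_add ac_simps)
next
  case (seq U)
  have *: "(\<integral>\<^sup>+y. (SUP i. U i y) \<partial>N) = (SUP i. \<integral>\<^sup>+y. U i y \<partial>N)" if "sets N = sets \<gamma>" for N
    using seq(1,3) that
    by (intro nn_integral_monotone_convergence_SUP) (auto simp: incseq_def le_fun_def cong: measurable_cong_sets)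
  have "(SUP i. (\<integral>\<^sup>+y. U i y \<partial>\<gamma>) + U i x) = (SUP i. \<integral>\<^sup>+y. U i y \<partial>\<gamma>) + (SUP i. U i x)"
    using seq(3) by (intro ennreal_SUP_add) (auto simp: incseq_def le_fun_def intro!: nn_integral_mono)
  then show ?case
    unfolding SUP_apply *[OF sets_add_point] *[OF refl] seq.IH .
qed

lemma integrable_add_point:
  fixes f :: "'a \<Rightarrow> real"
  assumes "integrable \<gamma> f" "x \<in> space \<gamma>"
  shows "integrable (add_point \<gamma> x) f"
  using assms unfolding integrable_iff_bounded
  by (auto simp: nn_integral_add_point less_top cong: measurable_cong_sets)

lemma integral_add_point:
  fixes f :: "'a \<Rightarrow> real"
  assumes f: "integrable \<gamma> f" and x: "x \<in> space \<gamma>"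
  shows "(\<integral>y. f y \<partial>add_point \<gamma> x) = (\<integral>y. f y \<partial>\<gamma>) + f x"
proof -
  note [measurable] = borel_measurable_integrable[OF f]
  have "(\<integral>\<^sup>+y. ennreal (f y) \<partial>\<gamma>) < top" "(\<integral>\<^sup>+y. ennreal (- f y) \<partial>\<gamma>) < top"
    using f unfolding real_integrable_def by (auto simp: less_top)
  then have "(\<integral>y. f y \<partial>add_point \<gamma> x) =
      (enn2real (\<integral>\<^sup>+y. ennreal (f y) \<partial>\<gamma>) + enn2real (ennreal (f x))) -
      (enn2real (\<integral>\<^sup>+y. ennreal (- f y) \<partial>\<gamma>) + enn2real (ennreal (- f x)))"
    using real_lebesgue_integral_def[OF integrable_add_point[OF f x]]
    by (simp add: nn_integral_add_point x enn2real_plus)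
  also have "\<dots> = (\<integral>y. f y \<partial>\<gamma>) + (enn2real (ennreal (f x)) - enn2real (ennreal (- f x)))"
    using real_lebesgue_integral_def[OF f] by simp
  also have "enn2real (ennreal (f x)) - enn2real (ennreal (- f x)) = f x"
    by (cases "0 \<le> f x") (simp_all add: ennreal_neg)
  finally show ?thesis .
qed

lemma add_point_in_configs:
  assumes \<gamma>: "\<gamma> \<in> configs M \<E>" and x: "x \<in> space M" and \<E>: "\<E> \<subseteq> sets M"
  shows "add_point \<gamma> x \<in> configs M \<E>"
proof -
  obtain N :: enat and y where s: "sets \<gamma> = sets M" and y: "\<forall>i. y i \<in> space M"
    and em: "\<forall>A\<in>sets M.
      emeasure \<gamma> A = (\<Sum>i. if enat i < N then emeasure (return M (y i)) A else 0)"
    and fin: "\<forall>E\<in>\<E>. emeasure \<gamma> E < \<infinity>"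
    using \<gamma> unfolding configs_def by blast
  note y = y[rule_format] and em = em[rule_format] and fin = fin[rule_format]
  define z where "z i = (case i of 0 \<Rightarrow> x | Suc j \<Rightarrow> y j)" for i
  have "emeasure (add_point \<gamma> x) A = (\<Sum>i. if enat i < eSuc N then emeasure (return M (z i)) A else 0)"
    if A: "A \<in> sets M" for A
  proof -
    let ?f = "\<lambda>i. if enat i < eSuc N then emeasure (return M (z i)) A else 0"
    have "(\<lambda>i. ?f (Suc i)) = (\<lambda>i. if enat i < N then emeasure (return M (y i)) A else 0)"
      by (auto simp: z_def fun_eq_iff eSuc_enat[symmetric])
    then have "(\<lambda>i. ?f (Suc i)) sums emeasure \<gamma> A"
      using em[OF A] by (simp add: summable_sums)
    then have "?f sums (emeasure \<gamma> A + ?f 0)" by (rule sums_Suc)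
    moreover have "?f 0 = indicator A x"
      using A by (simp add: z_def zero_enat_def[symmetric])
    ultimately show ?thesis
      using A s by (simp add: emeasure_add_point sums_unique)
  qed
  moreover have "z i \<in> space M" for i using x y by (simp add: z_def split: nat.split)
  moreover have "emeasure (add_point \<gamma> x) E < \<infinity>" if "E \<in> \<E>" for E
  proof -
    have "E \<in> sets \<gamma>" using that \<E> s by auto
    then show ?thesis using fin[OF that] by (simp add: emeasure_add_point indicator_def)
  qed
  ultimately show ?thesis
    unfolding configs_def using s by (intro CollectI conjI exI[of _ "eSuc N"] exI[of _ z]) auto
qed

section \<open>Cylinder functions and their increments\<close>

text \<open>A topological local diffusion space with a probability measure on its configurations.\<close>

locale diffusion_configs = topological_local_diffusion_space M \<E> D \<Gamma>
  for M :: "'a::t2_space measure" and \<E> :: "'a set set" and D :: "('a \<Rightarrow> real) set"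
    and \<Gamma> :: "('a \<Rightarrow> real) \<Rightarrow> ('a \<Rightarrow> real) \<Rightarrow> 'a \<Rightarrow> real" +
  fixes \<mu> :: "'a measure measure"
  assumes prob_mu: "prob_space \<mu>"
    and sets_mu: "sets \<mu> = sets (config_space M \<E>)"
begin

lemma space_mu: "space \<mu> = configs M \<E>"
  using sets_eq_imp_space_eq[OF sets_mu] unfolding config_space_def
  by (subst (asm) space_measure_of) blast+

lemma sets_mu_eq:
  "sets \<mu> = sigma_sets (configs M \<E>)
     {(\<lambda>\<gamma>. emeasure \<gamma> E) -` B \<inter> configs M \<E> |E B. E \<in> \<E> \<and> B \<in> sets borel}"
  unfolding sets_mu config_space_def by (rule sets_measure_of) blast

lemma E_sets: "E \<in> \<E> \<Longrightarrow> E \<in> sets M"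
proof -
  from localizing_ring have "\<E> \<subseteq> {A \<in> sets M. emeasure M A < \<infinity>}"
    unfolding localizing_ring_def by (elim conjE)
  then show "E \<in> \<E> \<Longrightarrow> E \<in> sets M" by blast
qed

lemma localizing_sequenceE:
  obtains Eh :: "nat \<Rightarrow> 'a set" where "\<And>h. Eh h \<in> \<E>" "incseq Eh" "(\<Union>h. Eh h) = UNIV"
    "\<And>E. E \<in> \<E> \<Longrightarrow> \<exists>h. E \<subseteq> Eh h"
proof -
  from localizing_ring have "\<exists>Eh :: nat \<Rightarrow> 'a set. (\<forall>h. Eh h \<in> sets M \<and> emeasure M (Eh h) < \<infinity>) \<and>
      incseq Eh \<and> (\<Union>h. Eh h) = UNIV \<and> \<E> = (\<Union>h. {A \<inter> Eh h |A. A \<in> sets M})"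
    unfolding localizing_ring_def by (elim conjE)
  then obtain Eh :: "nat \<Rightarrow> 'a set"
    where seq: "incseq Eh" "(\<Union>h. Eh h) = UNIV" and E_eq: "\<E> = (\<Union>h. {A \<inter> Eh h |A. A \<in> sets M})"
    by (elim exE conjE)
  have "UNIV \<in> sets M" using sets.top[of M] space_UNIV by simp
  then have in_E: "Eh h \<in> \<E>" for h unfolding E_eq by blast
  have covered: "\<exists>h. E \<subseteq> Eh h" if "E \<in> \<E>" for E using that unfolding E_eq by blast
  show ?thesis by (rule that[OF in_E seq covered])
qed

lemma sets_config: "\<gamma> \<in> space \<mu> \<Longrightarrow> sets \<gamma> = sets M"
  unfolding space_mu configs_def by blast

lemma space_config: "\<gamma> \<in> space \<mu> \<Longrightarrow> space \<gamma> = UNIV"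
  using sets_eq_imp_space_eq[OF sets_config] space_UNIV by simp

lemma measurable_config: "\<gamma> \<in> space \<mu> \<Longrightarrow> f \<in> measurable M N \<Longrightarrow> f \<in> measurable \<gamma> N"
  using measurable_cong_sets[OF sets_config refl] by blast

lemma config_finite: "\<gamma> \<in> space \<mu> \<Longrightarrow> E \<in> \<E> \<Longrightarrow> emeasure \<gamma> E < \<infinity>"
  unfolding space_mu configs_def by blast

lemma add_point_in_space: "\<gamma> \<in> space \<mu> \<Longrightarrow> add_point \<gamma> x \<in> space \<mu>"
  unfolding space_mu by (rule add_point_in_configs) (auto simp: space_UNIV E_sets)

lemma measurable_emeasure: "A \<in> sets M \<Longrightarrow> (\<lambda>\<gamma>. emeasure \<gamma> A) \<in> borel_measurable \<mu>"
  by (rule measurable_emeasure_config[OF localizing_ring space_UNIV sets_mu])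

lemma measurable_nn_integral:
  "h \<in> borel_measurable M \<Longrightarrow> (\<lambda>\<gamma>. \<integral>\<^sup>+x. h x \<partial>\<gamma>) \<in> borel_measurable \<mu>"
  by (rule measurable_nn_integral_kernel[where N = M])
    (auto simp: subalgebra_def sets_config space_config space_UNIV measurable_emeasure)

lemma measurable_integral:
  fixes h :: "'a \<Rightarrow> real"
  assumes [measurable]: "h \<in> borel_measurable M"
  shows "(\<lambda>\<gamma>. \<integral>x. h x \<partial>\<gamma>) \<in> borel_measurable \<mu>"
proof -
  let ?p = "\<lambda>\<gamma>. \<integral>\<^sup>+x. ennreal (h x) \<partial>\<gamma>" and ?n = "\<lambda>\<gamma>. \<integral>\<^sup>+x. ennreal (- h x) \<partial>\<gamma>"
  have "(\<integral>x. h x \<partial>\<gamma>) =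
      (if ?p \<gamma> \<noteq> \<infinity> \<and> ?n \<gamma> \<noteq> \<infinity> then enn2real (?p \<gamma>) - enn2real (?n \<gamma>) else 0)" if "\<gamma> \<in> space \<mu>" for \<gamma>
    using real_lebesgue_integral_def[of \<gamma> h] not_integrable_integral_eq[of \<gamma> h]
      measurable_config[OF that assms]
    by (auto simp: real_integrable_def)
  moreover have [measurable]: "?p \<in> borel_measurable \<mu>" "?n \<in> borel_measurable \<mu>"
    by (auto intro: measurable_nn_integral)
  ultimately show ?thesis by (simp cong: measurable_cong)
qed

lemma measurable_add_point: "(\<lambda>(\<gamma>, x). add_point \<gamma> x) \<in> measurable (\<mu> \<Otimes>\<^sub>M M) \<mu>"
proof (rule measurable_sigma_sets[OF sets_mu_eq])
  show "(\<lambda>(\<gamma>, x). add_point \<gamma> x) \<in> space (\<mu> \<Otimes>\<^sub>M M) \<rightarrow> configs M \<E>"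
    using add_point_in_space by (auto simp: space_pair_measure space_mu)
  fix Y assume "Y \<in> {(\<lambda>\<gamma>. emeasure \<gamma> E) -` B \<inter> configs M \<E> |E B. E \<in> \<E> \<and> B \<in> sets borel}"
  then obtain E B where Y: "Y = (\<lambda>\<gamma>. emeasure \<gamma> E) -` B \<inter> configs M \<E>" and E: "E \<in> \<E>"
    and B: "B \<in> sets borel" by blast
  note [measurable] = measurable_emeasure[OF E_sets[OF E]] E_sets[OF E]
  have "(\<lambda>(\<gamma>, x). add_point \<gamma> x) -` Y \<inter> space (\<mu> \<Otimes>\<^sub>M M) =
      (\<lambda>(\<gamma>, x). emeasure \<gamma> E + indicator E x) -` B \<inter> space (\<mu> \<Otimes>\<^sub>M M)"
    using add_point_in_space E_sets[OF E]
    by (auto simp: Y space_pair_measure space_mu[symmetric] emeasure_add_point sets_config)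
  also have "\<dots> \<in> sets (\<mu> \<Otimes>\<^sub>M M)"
    by (rule measurable_sets[OF _ B]) measurable
  finally show "(\<lambda>(\<gamma>, x). add_point \<gamma> x) -` Y \<inter> space (\<mu> \<Otimes>\<^sub>M M) \<in> sets (\<mu> \<Otimes>\<^sub>M M)" .
qed blast

lemma measurable_add_point_comp:
  assumes a: "a \<in> borel_measurable \<mu>"
  shows "(\<lambda>p. a (add_point (fst p) (snd p))) \<in> borel_measurable (\<mu> \<Otimes>\<^sub>M M)"
  using measurable_comp[OF measurable_add_point a] by (simp add: comp_def case_prod_beta)

lemma D_bounded:
  assumes "f \<in> D"
  shows "\<exists>C E. (\<forall>x. \<bar>f x\<bar> \<le> C) \<and> E \<in> \<E> \<and> (\<forall>x. x \<notin> E \<longrightarrow> f x = 0)"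
  using subsetD[OF D_subset assms] unfolding C0_funs_def bounded_iff by auto

lemma C0_measurable:
  assumes "f \<in> C0_funs \<E>"
  shows "f \<in> borel_measurable M"
proof -
  have "f \<in> borel_measurable borel"
    using assms unfolding C0_funs_def by (auto intro: borel_measurable_continuous_onI)
  then show ?thesis
    using measurable_mono[of borel borel borel M] borel_subset space_UNIV by auto
qed

lemma D_measurable: "f \<in> D \<Longrightarrow> f \<in> borel_measurable M"
  using C0_measurable D_subset by blast

lemma integrable_config:
  fixes f :: "'a \<Rightarrow> real"
  assumes "\<gamma> \<in> space \<mu>" "f \<in> borel_measurable M" "\<And>x. \<bar>f x\<bar> \<le> C" "E \<in> \<E>" "\<And>x. x \<notin> E \<Longrightarrow> f x = 0"
  shows "integrable \<gamma> f"
proof (rule integrableI_bounded_set[where A = E and B = C])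
  show "E \<in> sets \<gamma>" using E_sets[OF assms(4)] sets_config[OF assms(1)] by simp
  show "f \<in> borel_measurable \<gamma>" by (rule measurable_config[OF assms(1,2)])
  show "emeasure \<gamma> E < \<infinity>" by (rule config_finite[OF assms(1,4)])
  show "AE x in \<gamma>. x \<in> E \<longrightarrow> norm (f x) \<le> C" using assms(3) by simp
  show "AE x in \<gamma>. x \<notin> E \<longrightarrow> f x = 0" using assms(5) by simp
qed

lemma integrable_D:
  assumes "\<gamma> \<in> space \<mu>" "f \<in> D"
  shows "integrable \<gamma> f"
proof -
  obtain C E where C: "\<forall>x. \<bar>f x\<bar> \<le> C" and E: "E \<in> \<E>" "\<forall>x. x \<notin> E \<longrightarrow> f x = 0"
    using D_bounded[OF assms(2)] by blast
  show ?thesis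
    by (rule integrable_config[OF assms(1) D_measurable[OF assms(2)] C[rule_format] E(1) E(2)[rule_format]])
qed

lemma cyl_dataD: "(k, F, f) \<in> cyl_data D \<Longrightarrow> F \<in> Cb_smooth k" "(k, F, f) \<in> cyl_data D \<Longrightarrow> i < k \<Longrightarrow> f i \<in> D"
  unfolding cyl_data_def by auto

lemma cyl_data_partial_deriv: "(k, F, f) \<in> cyl_data D \<Longrightarrow> (k, partial_deriv i F, f) \<in> cyl_data D"
  unfolding cyl_data_def by (auto intro: Cb_smooth_partial_deriv)

lemma cyl_fun_measurable:
  assumes r: "r \<in> cyl_data D"
  shows "cyl_fun r \<in> borel_measurable \<mu>"
proof -
  obtain k F f where r_eq: "r = (k, F, f)" by (cases r)
  note F = cyl_dataD[OF r[unfolded r_eq]]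
  have "cyl_fun r = (\<lambda>\<gamma>. F (\<lambda>n. if n < k then \<integral>x. f n x \<partial>\<gamma> else 0))"
    unfolding r_eq by (intro ext) (auto intro!: Cb_smooth_cong[OF F(1)])
  moreover have "(\<lambda>\<gamma> n. if n < k then \<integral>x. f n x \<partial>\<gamma> else 0) \<in> borel_measurable \<mu>"
  proof (rule measurable_coordinatewise_then_product)
    show "(\<lambda>\<gamma>. if n < k then \<integral>x. f n x \<partial>\<gamma> else 0) \<in> borel_measurable \<mu>" for n
      using F(2)[of n] by (cases "n < k") (auto intro: measurable_integral D_measurable)
  qed
  moreover have "F \<in> borel_measurable borel"
    by (rule borel_measurable_continuous_onI[OF Cb_smooth_continuous[OF F(1)]])
  ultimately show ?thesis using measurable_comp by (auto simp: comp_def)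
qed

lemma cyl_fun_add_point:
  assumes r: "(k, F, f) \<in> cyl_data D" and \<gamma>: "\<gamma> \<in> space \<mu>"
  shows "cyl_fun (k, F, f) (add_point \<gamma> x) = F (\<lambda>n. (\<integral>y. f n y \<partial>\<gamma>) + f n x)"
  using cyl_dataD[OF r] \<gamma>
  by (auto intro!: Cb_smooth_cong[of F k] simp: integral_add_point integrable_D space_config)

end

text \<open>The increment of \<open>u\<close> under insertion of a point.\<close>

definition increment :: "('a measure \<Rightarrow> real) \<Rightarrow> 'a measure \<Rightarrow> 'a \<Rightarrow> real" where
  "increment u \<gamma> x = u (add_point \<gamma> x) - u \<gamma>"

context diffusion_configs begin

lemma increment_cyl_fun:
  assumes r: "(k, F, f) \<in> cyl_data D" and \<gamma>: "\<gamma> \<in> space \<mu>"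
  shows "increment (cyl_fun (k, F, f)) \<gamma> = comp0 (\<lambda>y. F (\<lambda>n. (\<integral>z. f n z \<partial>\<gamma>) + y n)) f"
  unfolding increment_def comp0_def cyl_fun_add_point[OF r \<gamma>] by auto

lemma increment_in_D:
  assumes "r \<in> cyl_data D" "\<gamma> \<in> space \<mu>"
  shows "increment (cyl_fun r) \<gamma> \<in> D"
proof -
  obtain k F f where r: "r = (k, F, f)" by (cases r)
  note r' = assms(1)[unfolded r]
  show ?thesis
    unfolding r increment_cyl_fun[OF r' assms(2)]
    by (rule D_comp[OF Cb_smooth_translate[OF cyl_dataD(1)[OF r']] cyl_dataD(2)[OF r']])
qed

text \<open>The chain rule applied to \<open>F(\<gamma>(f) + \<cdot>)\<close> and \<open>G(\<gamma>(g) + \<cdot>)\<close>.\<close>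

lemma Gamma_increment:
  assumes r: "(k, F, f) \<in> cyl_data D" and s: "(l, G, g) \<in> cyl_data D" and \<gamma>: "\<gamma> \<in> space \<mu>"
  shows "AE x in M. \<Gamma> (increment (cyl_fun (k, F, f)) \<gamma>) (increment (cyl_fun (l, G, g)) \<gamma>) x =
    (\<Sum>i<k. \<Sum>j<l. cyl_fun (k, partial_deriv i F, f) (add_point \<gamma> x)
      * cyl_fun (l, partial_deriv j G, g) (add_point \<gamma> x) * \<Gamma> (f i) (g j) x)"
  unfolding increment_cyl_fun[OF r \<gamma>] increment_cyl_fun[OF s \<gamma>]
    cyl_fun_add_point[OF cyl_data_partial_deriv[OF r] \<gamma>] cyl_fun_add_point[OF cyl_data_partial_deriv[OF s] \<gamma>]
  using Gamma_diffusion[OF Cb_smooth_translate[OF cyl_dataD(1)[OF r]] Cb_smooth_translate[OF cyl_dataD(1)[OF s]]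
      cyl_dataD(2)[OF r] cyl_dataD(2)[OF s]]
  by (simp add: partial_deriv_translate)

end


section \<open>The Georgii-Nguyen-Zessin identity\<close>

text \<open>Negative reals are sent to \<open>0\<close>, so the two summands are the contributions of the two sign
  patterns for which the product is positive.\<close>

lemma ennreal_mult_parts:
  "ennreal (a * b) = ennreal a * ennreal b + ennreal (- a) * ennreal (- b)"
proof (cases "0 \<le> a"; cases "0 \<le> b")
  assume "\<not> 0 \<le> a" "\<not> 0 \<le> b"
  then show ?thesis using ennreal_mult[of "- a" "- b"] by (simp add: ennreal_neg)
next
  assume "0 \<le> a" "\<not> 0 \<le> b"
  then show ?thesis by (simp add: ennreal_neg mult_nonneg_nonpos)
next
  assume "\<not> 0 \<le> a" "0 \<le> b"
  then show ?thesis by (simp add: ennreal_neg mult_nonpos_nonneg)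
qed (simp add: ennreal_mult ennreal_neg)

text \<open>Iterated integrals with respect to a family of measures, reduced to the iterated integrals of
  the positive and negative parts.\<close>

lemma iterated_integral_parts:
  fixes U :: "'c \<Rightarrow> 'b \<Rightarrow> real"
  assumes U: "\<And>\<gamma>. \<gamma> \<in> space S \<Longrightarrow> U \<gamma> \<in> borel_measurable (\<kappa> \<gamma>)"
    and p[measurable]: "(\<lambda>\<gamma>. \<integral>\<^sup>+x. ennreal (U \<gamma> x) \<partial>\<kappa> \<gamma>) \<in> borel_measurable S"
    and n[measurable]: "(\<lambda>\<gamma>. \<integral>\<^sup>+x. ennreal (- U \<gamma> x) \<partial>\<kappa> \<gamma>) \<in> borel_measurable S"
    and p_fin: "(\<integral>\<^sup>+\<gamma>. \<integral>\<^sup>+x. ennreal (U \<gamma> x) \<partial>\<kappa> \<gamma> \<partial>S) < \<infinity>"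
    and n_fin: "(\<integral>\<^sup>+\<gamma>. \<integral>\<^sup>+x. ennreal (- U \<gamma> x) \<partial>\<kappa> \<gamma> \<partial>S) < \<infinity>"
  shows "AE \<gamma> in S. integrable (\<kappa> \<gamma>) (U \<gamma>)"
    and "integrable S (\<lambda>\<gamma>. \<integral>x. U \<gamma> x \<partial>\<kappa> \<gamma>)"
    and "(\<integral>\<gamma>. \<integral>x. U \<gamma> x \<partial>\<kappa> \<gamma> \<partial>S) = enn2real (\<integral>\<^sup>+\<gamma>. \<integral>\<^sup>+x. ennreal (U \<gamma> x) \<partial>\<kappa> \<gamma> \<partial>S)
      - enn2real (\<integral>\<^sup>+\<gamma>. \<integral>\<^sup>+x. ennreal (- U \<gamma> x) \<partial>\<kappa> \<gamma> \<partial>S)"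
proof -
  let ?p = "\<lambda>\<gamma>. \<integral>\<^sup>+x. ennreal (U \<gamma> x) \<partial>\<kappa> \<gamma>" and ?n = "\<lambda>\<gamma>. \<integral>\<^sup>+x. ennreal (- U \<gamma> x) \<partial>\<kappa> \<gamma>"
  have p_AE: "AE \<gamma> in S. ?p \<gamma> \<noteq> \<infinity>" and n_AE: "AE \<gamma> in S. ?n \<gamma> \<noteq> \<infinity>"
    using nn_integral_PInf_AE[OF p] nn_integral_PInf_AE[OF n] p_fin n_fin by simp_all
  have eq: "(\<integral>x. U \<gamma> x \<partial>\<kappa> \<gamma>) = enn2real (?p \<gamma>) - enn2real (?n \<gamma>) \<and> integrable (\<kappa> \<gamma>) (U \<gamma>)"
    if "\<gamma> \<in> space S" "?p \<gamma> \<noteq> \<infinity>" "?n \<gamma> \<noteq> \<infinity>" for \<gamma>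
  proof -
    have "integrable (\<kappa> \<gamma>) (U \<gamma>)" using that U[OF that(1)] by (simp add: real_integrable_def)
    then show ?thesis using real_lebesgue_integral_def by blast
  qed
  show "AE \<gamma> in S. integrable (\<kappa> \<gamma>) (U \<gamma>)"
    using p_AE n_AE AE_space[of S] by eventually_elim (use eq in blast)
  have ie: "AE \<gamma> in S. (\<integral>x. U \<gamma> x \<partial>\<kappa> \<gamma>) = enn2real (?p \<gamma>) - enn2real (?n \<gamma>)"
    using p_AE n_AE AE_space[of S] by eventually_elim (use eq in blast)
  have parts: "integrable S (\<lambda>\<gamma>. enn2real (q \<gamma>)) \<and>
      (\<integral>\<gamma>. enn2real (q \<gamma>) \<partial>S) = enn2real (\<integral>\<^sup>+\<gamma>. q \<gamma> \<partial>S)"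
    if q[measurable]: "q \<in> borel_measurable S" and fin: "(\<integral>\<^sup>+\<gamma>. q \<gamma> \<partial>S) < \<infinity>"
      and AE: "AE \<gamma> in S. q \<gamma> \<noteq> \<infinity>" for q
  proof -
    have "(\<integral>\<^sup>+\<gamma>. ennreal (enn2real (q \<gamma>)) \<partial>S) = (\<integral>\<^sup>+\<gamma>. q \<gamma> \<partial>S)"
      using AE by (intro nn_integral_cong_AE) (auto simp: less_top)
    with fin show ?thesis
      by (auto intro!: integrableI_nonneg simp: integral_eq_nn_integral)
  qed
  note pp = parts[OF p p_fin p_AE] and nn = parts[OF n n_fin n_AE]
  have "(\<integral>x. U \<gamma> x \<partial>\<kappa> \<gamma>) =
      (if ?p \<gamma> \<noteq> \<infinity> \<and> ?n \<gamma> \<noteq> \<infinity> then enn2real (?p \<gamma>) - enn2real (?n \<gamma>) else 0)" if "\<gamma> \<in> space S" for \<gamma>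
    using eq[OF that] not_integrable_integral_eq[of "\<kappa> \<gamma>" "U \<gamma>"] by (auto simp: real_integrable_def)
  then have meas: "(\<lambda>\<gamma>. \<integral>x. U \<gamma> x \<partial>\<kappa> \<gamma>) \<in> borel_measurable S"
    by (simp cong: measurable_cong)
  have "integrable S (\<lambda>\<gamma>. enn2real (?p \<gamma>) - enn2real (?n \<gamma>))" using pp nn by simp
  then show "integrable S (\<lambda>\<gamma>. \<integral>x. U \<gamma> x \<partial>\<kappa> \<gamma>)"
    using integrable_cong_AE[OF meas _ ie] by simp
  have "(\<integral>\<gamma>. \<integral>x. U \<gamma> x \<partial>\<kappa> \<gamma> \<partial>S) = (\<integral>\<gamma>. enn2real (?p \<gamma>) - enn2real (?n \<gamma>) \<partial>S)"
    by (rule integral_cong_AE[OF meas _ ie]) measurable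
  then show "(\<integral>\<gamma>. \<integral>x. U \<gamma> x \<partial>\<kappa> \<gamma> \<partial>S) = enn2real (\<integral>\<^sup>+\<gamma>. ?p \<gamma> \<partial>S) - enn2real (\<integral>\<^sup>+\<gamma>. ?n \<gamma> \<partial>S)"
    using pp nn by simp
qed

text \<open>The assumption (GNZ) with fixed \<open>\<rho>\<close> and \<open>w\<close>.  The degeneracy condition is stated for \<open>\<Gamma>\<close>
  instead of \<open>\<l> \<circ> \<Gamma>\<close>, which makes no difference almost everywhere, and no lifting is fixed.\<close>

locale GNZ_configs = diffusion_configs M \<E> D \<Gamma> \<mu>
  for M :: "'a::t2_space measure" and \<E> :: "'a set set" and D :: "('a \<Rightarrow> real) set"
    and \<Gamma> :: "('a \<Rightarrow> real) \<Rightarrow> ('a \<Rightarrow> real) \<Rightarrow> 'a \<Rightarrow> real" and \<mu> :: "'a measure measure" +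
  fixes \<rho> :: "'a measure \<times> 'a \<Rightarrow> real" and w :: "'a \<Rightarrow> real"
  assumes intensity_finite: "\<And>E. E \<in> \<E> \<Longrightarrow> (\<integral>\<^sup>+\<gamma>. emeasure \<gamma> E \<partial>\<mu>) < \<infinity>"
    and rho_measurable: "\<rho> \<in> borel_measurable (\<mu> \<Otimes>\<^sub>M M)"
    and rho_nonneg: "\<And>p. p \<in> space (\<mu> \<Otimes>\<^sub>M M) \<Longrightarrow> 0 \<le> \<rho> p"
    and GNZ: "GNZ_identity M \<mu> \<rho>"
    and degenerate: "AE \<gamma> in \<mu>. \<forall>f\<in>D. (AE x in cond_measure M \<rho> \<gamma>. f x = 0) \<longrightarrow>
      (\<forall>g\<in>D. AE x in cond_measure M \<rho> \<gamma>. \<Gamma> f g x = 0)"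
    and w_measurable: "w \<in> borel_measurable M"
    and w_pos: "\<And>x. 0 < w x" and w_le_1: "\<And>x. w x \<le> 1"
    and w_integrable: "integrable (intensity M \<mu>) w"
    and closable: "AE \<gamma> in \<mu>. closable_form (density (cond_measure M \<rho> \<gamma>) (\<lambda>x. ennreal (w x))) D
      (\<lambda>f g. \<integral>x. \<Gamma> f g x * w x \<partial>cond_measure M \<rho> \<gamma>)"
begin

text \<open>The measures \<open>\<rho>(\<gamma>, \<cdot>) \<cdot> M\<close> on the fibres.\<close>

abbreviation m :: "'a measure \<Rightarrow> 'a measure" where
  "m \<equiv> cond_measure M \<rho>"

lemma section_measurable:
  "J \<in> measurable (\<mu> \<Otimes>\<^sub>M M) N \<Longrightarrow> \<gamma> \<in> space \<mu> \<Longrightarrow> (\<lambda>x. J (\<gamma>, x)) \<in> measurable M N"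
  by (rule measurable_compose[OF measurable_Pair1'])

lemma rho_section [measurable]: "\<gamma> \<in> space \<mu> \<Longrightarrow> (\<lambda>x. \<rho> (\<gamma>, x)) \<in> borel_measurable M"
  by (rule section_measurable[OF rho_measurable])

lemma sets_m [simp, measurable_cong]: "sets (m \<gamma>) = sets M"
  and space_m [simp]: "space (m \<gamma>) = UNIV"
  by (simp_all add: cond_measure_def space_UNIV)

lemma nn_integral_m:
  assumes "\<gamma> \<in> space \<mu>" "h \<in> borel_measurable M"
  shows "(\<integral>\<^sup>+x. h x \<partial>m \<gamma>) = (\<integral>\<^sup>+x. ennreal (\<rho> (\<gamma>, x)) * h x \<partial>M)"
  unfolding cond_measure_def using assms by (intro nn_integral_density) measurable

lemma AE_m:
  assumes \<gamma>: "\<gamma> \<in> space \<mu>" and "AE x in M. P x"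
  shows "AE x in m \<gamma>. P x"
  unfolding cond_measure_def
  by (subst AE_density) (use assms rho_section[OF \<gamma>] in auto)

lemma measurable_nn_integral_m:
  fixes J :: "'a measure \<times> 'a \<Rightarrow> ennreal"
  assumes J: "J \<in> borel_measurable (\<mu> \<Otimes>\<^sub>M M)"
  shows "(\<lambda>\<gamma>. \<integral>\<^sup>+x. J (\<gamma>, x) \<partial>m \<gamma>) \<in> borel_measurable \<mu>"
proof -
  note [measurable] = J rho_measurable
  have "(\<lambda>\<gamma>. \<integral>\<^sup>+x. ennreal (\<rho> (\<gamma>, x)) * J (\<gamma>, x) \<partial>M) \<in> borel_measurable \<mu>"
    by measurable
  then show ?thesis
    using nn_integral_m[OF _ section_measurable[OF J]] by (simp cong: measurable_cong)
qed

lemma measurable_integral_m: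
  fixes J :: "'a measure \<times> 'a \<Rightarrow> real"
  assumes J: "J \<in> borel_measurable (\<mu> \<Otimes>\<^sub>M M)"
  shows "(\<lambda>\<gamma>. \<integral>x. J (\<gamma>, x) \<partial>m \<gamma>) \<in> borel_measurable \<mu>"
proof -
  note [measurable] = J rho_measurable
  have "(\<lambda>\<gamma>. \<integral>x. \<rho> (\<gamma>, x) * J (\<gamma>, x) \<partial>M) \<in> borel_measurable \<mu>"
    by measurable
  moreover have "(\<integral>x. J (\<gamma>, x) \<partial>m \<gamma>) = (\<integral>x. \<rho> (\<gamma>, x) * J (\<gamma>, x) \<partial>M)" if \<gamma>: "\<gamma> \<in> space \<mu>" for \<gamma>
    unfolding cond_measure_def
    using integral_density[OF section_measurable[OF J \<gamma>] rho_section[OF \<gamma>]] rho_nonneg \<gamma>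
    by (simp add: space_pair_measure space_UNIV)
  ultimately show ?thesis by (simp cong: measurable_cong)
qed

text \<open>For non-negative \<open>u\<close> both sides of the identity are defined without further conditions.\<close>

lemma GNZ_nonneg:
  assumes u: "u \<in> borel_measurable (\<mu> \<Otimes>\<^sub>M M)" and nonneg: "\<And>p. 0 \<le> u p"
  shows "(\<integral>\<^sup>+\<gamma>. \<integral>\<^sup>+x. ennreal (u (\<gamma>, x)) \<partial>\<gamma> \<partial>\<mu>) =
    (\<integral>\<^sup>+\<gamma>. \<integral>\<^sup>+x. ennreal (u (add_point \<gamma> x, x)) \<partial>m \<gamma> \<partial>\<mu>)"
proof -
  have neg: "GNZ_left \<mu> (\<lambda>p. - u p) = 0"
    unfolding GNZ_left_def using nonneg by (simp add: ennreal_neg)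
  have "ennreal (- u (add_point \<gamma> x, x) * \<rho> (\<gamma>, x)) = 0" if "\<gamma> \<in> space \<mu>" for \<gamma> x
    using nonneg rho_nonneg[of "(\<gamma>, x)"] that
    by (simp add: space_pair_measure space_UNIV ennreal_neg)
  then have neg': "GNZ_right M \<mu> \<rho> (\<lambda>p. - u p) = 0"
    unfolding GNZ_right_def by (simp cong: nn_integral_cong)
  have "semi_bounded_on (space (\<mu> \<Otimes>\<^sub>M M)) u"
    unfolding semi_bounded_on_def using nonneg by blast
  then have "enn2ereal (GNZ_left \<mu> u) - enn2ereal (GNZ_left \<mu> (\<lambda>p. - u p)) =
      enn2ereal (GNZ_right M \<mu> \<rho> u) - enn2ereal (GNZ_right M \<mu> \<rho> (\<lambda>p. - u p))"
    using bspec[OF GNZ[unfolded GNZ_identity_def] u] neg neg' by simp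
  then have "GNZ_left \<mu> u = GNZ_right M \<mu> \<rho> u"
    unfolding neg neg' by (simp add: zero_ennreal.rep_eq enn2ereal_inject)
  also have "\<dots> = (\<integral>\<^sup>+\<gamma>. \<integral>\<^sup>+x. ennreal (u (add_point \<gamma> x, x)) \<partial>m \<gamma> \<partial>\<mu>)"
    unfolding GNZ_right_def
  proof (intro nn_integral_cong)
    fix \<gamma> assume \<gamma>: "\<gamma> \<in> space \<mu>"
    have "(\<lambda>p. u (add_point (fst p) (snd p), snd p)) \<in> borel_measurable (\<mu> \<Otimes>\<^sub>M M)"
      using measurable_compose[OF measurable_Pair[OF measurable_add_point measurable_snd] u]
      by (simp add: case_prod_beta)
    from section_measurable[OF this \<gamma>]
    have [measurable]: "(\<lambda>x. u (add_point \<gamma> x, x)) \<in> borel_measurable M" by simp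
    show "(\<integral>\<^sup>+x. ennreal (u (add_point \<gamma> x, x) * \<rho> (\<gamma>, x)) \<partial>M) =
        (\<integral>\<^sup>+x. ennreal (u (add_point \<gamma> x, x)) \<partial>m \<gamma>)"
      using rho_nonneg[of "(\<gamma>, _)"] \<gamma> nonneg
      by (subst nn_integral_m) (auto simp: space_pair_measure space_UNIV ennreal_mult mult.commute
          intro!: nn_integral_cong)
  qed
  finally show ?thesis unfolding GNZ_left_def .
qed

text \<open>The only test functions needed below are products.\<close>

lemma GNZ_product:
  assumes a: "a \<in> borel_measurable \<mu>" and h: "h \<in> borel_measurable M"
  shows "(\<integral>\<^sup>+\<gamma>. ennreal (a \<gamma>) * (\<integral>\<^sup>+x. ennreal (h x) \<partial>\<gamma>) \<partial>\<mu>) =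
    (\<integral>\<^sup>+\<gamma>. \<integral>\<^sup>+x. ennreal (a (add_point \<gamma> x)) * ennreal (h x) \<partial>m \<gamma> \<partial>\<mu>)"
proof -
  define u where "u p = max 0 (a (fst p)) * max 0 (h (snd p))" for p
  note [measurable] = a h
  have "u \<in> borel_measurable (\<mu> \<Otimes>\<^sub>M M)" unfolding u_def by measurable
  moreover have "0 \<le> u p" for p unfolding u_def by simp
  ultimately have "(\<integral>\<^sup>+\<gamma>. \<integral>\<^sup>+x. ennreal (u (\<gamma>, x)) \<partial>\<gamma> \<partial>\<mu>) =
      (\<integral>\<^sup>+\<gamma>. \<integral>\<^sup>+x. ennreal (u (add_point \<gamma> x, x)) \<partial>m \<gamma> \<partial>\<mu>)"
    by (rule GNZ_nonneg)
  moreover have "ennreal (u (\<gamma>, x)) = ennreal (a \<gamma>) * ennreal (h x)" for \<gamma> x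
  proof -
    have "ennreal (max 0 t) = ennreal t" for t by (simp add: max_def ennreal_neg)
    then show ?thesis unfolding u_def by (simp add: ennreal_mult)
  qed
  moreover have "(\<integral>\<^sup>+x. ennreal (a \<gamma>) * ennreal (h x) \<partial>\<gamma>) = ennreal (a \<gamma>) * (\<integral>\<^sup>+x. ennreal (h x) \<partial>\<gamma>)"
    if "\<gamma> \<in> space \<mu>" for \<gamma>
    by (rule nn_integral_cmult) (rule measurable_config[OF that], measurable)
  ultimately show ?thesis by (simp cong: nn_integral_cong)
qed

text \<open>The intensity is absolutely continuous with respect to \<open>M\<close>.\<close>

lemma AE_emeasure_config_null:
  assumes A: "A \<in> null_sets M"
  shows "AE \<gamma> in \<mu>. emeasure \<gamma> A = 0"
proof -
  have As: "A \<in> sets M" using A by blast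
  note ind[measurable] = borel_measurable_indicator[OF As]
  have "(\<integral>\<^sup>+x. ennreal 1 * ennreal (indicator A x) \<partial>m \<gamma>) = 0" if "\<gamma> \<in> space \<mu>" for \<gamma>
  proof -
    have "(\<integral>\<^sup>+x. ennreal 1 * ennreal (indicator A x) \<partial>m \<gamma>) = (\<integral>\<^sup>+x. 0 \<partial>m \<gamma>)"
      using AE_m[OF that AE_not_in[OF A]] by (intro nn_integral_cong_AE) auto
    then show ?thesis by simp
  qed
  then have "(\<integral>\<^sup>+\<gamma>. \<integral>\<^sup>+x. ennreal 1 * ennreal (indicator A x) \<partial>m \<gamma> \<partial>\<mu>) = 0"
    by (simp cong: nn_integral_cong)
  with GNZ_product[of "\<lambda>_. 1" "indicator A"]
  have "(\<integral>\<^sup>+\<gamma>. (\<integral>\<^sup>+x. ennreal (indicator A x) \<partial>\<gamma>) \<partial>\<mu>) = 0" by simp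
  moreover have "(\<integral>\<^sup>+x. ennreal (indicator A x) \<partial>\<gamma>) = emeasure \<gamma> A" if "\<gamma> \<in> space \<mu>" for \<gamma>
    using As sets_config[OF that] by (simp add: ennreal_indicator)
  ultimately have "(\<integral>\<^sup>+\<gamma>. emeasure \<gamma> A \<partial>\<mu>) = 0" by (simp cong: nn_integral_cong)
  then show ?thesis using measurable_emeasure[OF As] by (simp add: nn_integral_0_iff_AE)
qed

lemma AE_config:
  assumes "AE x in M. P x"
  shows "AE \<gamma> in \<mu>. AE x in \<gamma>. P x"
proof -
  from assms obtain N where N: "{x \<in> space M. \<not> P x} \<subseteq> N" "emeasure M N = 0" "N \<in> sets M"
    by (rule AE_E)
  then have "N \<in> null_sets M" by blast
  from AE_emeasure_config_null[OF this] AE_space[of \<mu>] show ?thesis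
  proof eventually_elim
    case (elim \<gamma>)
    then have "N \<in> null_sets \<gamma>" using N(3) sets_config[OF elim(2)] by blast
    then show ?case
      by (rule AE_I') (use N(1) space_UNIV in auto)
  qed
qed

lemma AE_m_finite: "AE \<gamma> in \<mu>. \<forall>E\<in>\<E>. emeasure (m \<gamma>) E < \<infinity>"
proof -
  obtain Eh :: "nat \<Rightarrow> 'a set" where Eh: "\<And>h. Eh h \<in> \<E>" "\<And>E. E \<in> \<E> \<Longrightarrow> \<exists>h. E \<subseteq> Eh h"
    using localizing_sequenceE by metis
  have "AE \<gamma> in \<mu>. emeasure (m \<gamma>) (Eh h) \<noteq> \<infinity>" for h
  proof -
    note Es = E_sets[OF Eh(1)[of h]]
    note [measurable] = borel_measurable_indicator[OF Es]
    have "(\<integral>\<^sup>+\<gamma>. emeasure \<gamma> (Eh h) \<partial>\<mu>) = (\<integral>\<^sup>+\<gamma>. ennreal 1 * (\<integral>\<^sup>+x. ennreal (indicator (Eh h) x) \<partial>\<gamma>) \<partial>\<mu>)"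
      using Es sets_config by (intro nn_integral_cong) (simp add: ennreal_indicator)
    also have "\<dots> = (\<integral>\<^sup>+\<gamma>. \<integral>\<^sup>+x. ennreal 1 * ennreal (indicator (Eh h) x) \<partial>m \<gamma> \<partial>\<mu>)"
      by (rule GNZ_product) measurable
    also have "\<dots> = (\<integral>\<^sup>+\<gamma>. emeasure (m \<gamma>) (Eh h) \<partial>\<mu>)"
      using Es by (intro nn_integral_cong) (simp add: ennreal_indicator)
    finally have "(\<integral>\<^sup>+\<gamma>. emeasure (m \<gamma>) (Eh h) \<partial>\<mu>) \<noteq> \<infinity>"
      using intensity_finite[OF Eh(1)[of h]] by simp
    moreover have "(\<lambda>\<gamma>. emeasure (m \<gamma>) (Eh h)) \<in> borel_measurable \<mu>"
    proof -
      have "(\<lambda>\<gamma>. \<integral>\<^sup>+x. indicator (Eh h) (snd (\<gamma>, x)) \<partial>m \<gamma>) \<in> borel_measurable \<mu>"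
        by (rule measurable_nn_integral_m) (use Es in measurable)
      then show ?thesis using Es by simp
    qed
    ultimately show ?thesis by (intro nn_integral_PInf_AE)
  qed
  then have "AE \<gamma> in \<mu>. \<forall>h. emeasure (m \<gamma>) (Eh h) \<noteq> \<infinity>" by (simp add: AE_all_countable)
  then show ?thesis
  proof eventually_elim
    case (elim \<gamma>)
    show ?case
    proof
      fix E assume "E \<in> \<E>"
      then obtain h where "E \<subseteq> Eh h" using Eh(2) by blast
      then have "emeasure (m \<gamma>) E \<le> emeasure (m \<gamma>) (Eh h)"
        using E_sets[OF Eh(1)] by (intro emeasure_mono) auto
      also have "\<dots> < \<infinity>" using elim by (simp add: less_top)
      finally show "emeasure (m \<gamma>) E < \<infinity>" .
    qed
  qed
qed

text \<open>A property of almost every configuration survives the insertion of a point.\<close>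

lemma AE_add_point:
  assumes "AE \<gamma> in \<mu>. P \<gamma>"
  shows "AE \<gamma> in \<mu>. AE x in m \<gamma>. P (add_point \<gamma> x)"
proof -
  from assms obtain N where N: "{\<gamma> \<in> space \<mu>. \<not> P \<gamma>} \<subseteq> N" "emeasure \<mu> N = 0" "N \<in> sets \<mu>"
    by (rule AE_E)
  note [measurable] = borel_measurable_indicator[OF N(3)]
  obtain Eh :: "nat \<Rightarrow> 'a set" where Eh: "\<And>h. Eh h \<in> \<E>" "(\<Union>h. Eh h) = UNIV"
    using localizing_sequenceE by metis
  have "AE \<gamma> in \<mu>. (\<integral>\<^sup>+x. ennreal (indicator N (add_point \<gamma> x)) * ennreal (indicator (Eh h) x) \<partial>m \<gamma>) = 0" for h
  proof -
    note [measurable] = borel_measurable_indicator[OF E_sets[OF Eh(1)[of h]]]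
    have "N \<in> null_sets \<mu>" using N by blast
    from AE_not_in[OF this]
    have "(\<integral>\<^sup>+\<gamma>. ennreal (indicator N \<gamma>) * (\<integral>\<^sup>+x. ennreal (indicator (Eh h) x) \<partial>\<gamma>) \<partial>\<mu>) = (\<integral>\<^sup>+\<gamma>. 0 \<partial>\<mu>)"
      by (intro nn_integral_cong_AE) (auto simp: indicator_def)
    then have "(\<integral>\<^sup>+\<gamma>. \<integral>\<^sup>+x. ennreal (indicator N (add_point \<gamma> x)) * ennreal (indicator (Eh h) x) \<partial>m \<gamma> \<partial>\<mu>) = 0"
      using GNZ_product[OF borel_measurable_indicator[OF N(3)] borel_measurable_indicator[OF E_sets[OF Eh(1)[of h]]]]
      by simp
    moreover have "(\<lambda>\<gamma>. \<integral>\<^sup>+x. (\<lambda>p. ennreal (indicator N (add_point (fst p) (snd p)))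
        * ennreal (indicator (Eh h) (snd p))) (\<gamma>, x) \<partial>m \<gamma>) \<in> borel_measurable \<mu>"
    proof (rule measurable_nn_integral_m)
      have [measurable]: "(\<lambda>p. indicator N (add_point (fst p) (snd p)) :: real) \<in> borel_measurable (\<mu> \<Otimes>\<^sub>M M)"
        by (rule measurable_add_point_comp) measurable
      show "(\<lambda>p. ennreal (indicator N (add_point (fst p) (snd p))) * ennreal (indicator (Eh h) (snd p)))
          \<in> borel_measurable (\<mu> \<Otimes>\<^sub>M M)" by measurable
    qed
    ultimately show ?thesis by (simp add: nn_integral_0_iff_AE)
  qed
  then have "AE \<gamma> in \<mu>. \<forall>h. (\<integral>\<^sup>+x. ennreal (indicator N (add_point \<gamma> x)) * ennreal (indicator (Eh h) x) \<partial>m \<gamma>) = 0"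
    by (simp add: AE_all_countable)
  then show ?thesis using AE_space[of \<mu>]
  proof eventually_elim
    case (elim \<gamma>)
    have "AE x in m \<gamma>. ennreal (indicator N (add_point \<gamma> x)) * ennreal (indicator (Eh h) x) = 0" for h
    proof -
      note [measurable] = borel_measurable_indicator[OF E_sets[OF Eh(1)[of h]]]
      have [measurable]: "(\<lambda>x. indicator N (add_point \<gamma> x) :: real) \<in> borel_measurable M"
        using section_measurable[OF measurable_add_point_comp[OF borel_measurable_indicator[OF N(3)]] elim(2)]
        by simp
      show ?thesis using elim(1) by (subst nn_integral_0_iff_AE[symmetric]) auto
    qed
    then have "AE x in m \<gamma>. \<forall>h. ennreal (indicator N (add_point \<gamma> x)) * ennreal (indicator (Eh h) x) = 0"
      unfolding AE_all_countable by blast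
    then show ?case
    proof eventually_elim
      case (elim x)
      obtain h where "x \<in> Eh h" using Eh(2) by blast
      with elim[rule_format, of h] have "add_point \<gamma> x \<notin> N" by (auto simp: indicator_def split: if_splits)
      then show ?case using N(1) add_point_in_space[OF \<open>\<gamma> \<in> space \<mu>\<close>] by blast
    qed
  qed
qed

text \<open>The identity for a bounded product \<open>a(\<gamma>) h(x)\<close> of arbitrary sign, with \<open>h\<close> vanishing almost
  everywhere outside a set in \<open>\<E>\<close>; all integrals are finite because the intensity is finite there.\<close>

lemma GNZ_bounded:
  fixes a :: "'a measure \<Rightarrow> real" and h :: "'a \<Rightarrow> real"
  assumes a: "a \<in> borel_measurable \<mu>" "0 \<le> C" "\<And>\<gamma>. \<bar>a \<gamma>\<bar> \<le> C"
    and h: "h \<in> borel_measurable M" "0 \<le> B" "\<And>x. \<bar>h x\<bar> \<le> B"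
    and E: "E \<in> \<E>" "AE x in M. x \<notin> E \<longrightarrow> h x = 0"
  shows "integrable \<mu> (\<lambda>\<gamma>. a \<gamma> * (\<integral>x. h x \<partial>\<gamma>))"
    and "AE \<gamma> in \<mu>. integrable (m \<gamma>) (\<lambda>x. a (add_point \<gamma> x) * h x)"
    and "integrable \<mu> (\<lambda>\<gamma>. \<integral>x. a (add_point \<gamma> x) * h x \<partial>m \<gamma>)"
    and "(\<integral>\<gamma>. a \<gamma> * (\<integral>x. h x \<partial>\<gamma>) \<partial>\<mu>) = (\<integral>\<gamma>. \<integral>x. a (add_point \<gamma> x) * h x \<partial>m \<gamma> \<partial>\<mu>)"
proof -
  note [measurable] = a(1) h(1)
  define L R where "L a = (\<integral>\<^sup>+\<gamma>. \<integral>\<^sup>+x. ennreal (a \<gamma> * h x) \<partial>\<gamma> \<partial>\<mu>)"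
    and "R a = (\<integral>\<^sup>+\<gamma>. \<integral>\<^sup>+x. ennreal (a (add_point \<gamma> x) * h x) \<partial>m \<gamma> \<partial>\<mu>)" for a :: "'a measure \<Rightarrow> real"
  have left: "(\<integral>\<^sup>+x. ennreal (a \<gamma> * h x) \<partial>\<gamma>) = ennreal (a \<gamma>) * (\<integral>\<^sup>+x. ennreal (h x) \<partial>\<gamma>)
      + ennreal (- a \<gamma>) * (\<integral>\<^sup>+x. ennreal (- h x) \<partial>\<gamma>)" if \<gamma>: "\<gamma> \<in> space \<mu>" for a \<gamma>
    unfolding ennreal_mult_parts using measurable_config[OF \<gamma> h(1)]
    by (simp add: nn_integral_add nn_integral_cmult)
  have left_meas: "(\<lambda>\<gamma>. \<integral>\<^sup>+x. ennreal (a \<gamma> * h x) \<partial>\<gamma>) \<in> borel_measurable \<mu>"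
    if [measurable]: "a \<in> borel_measurable \<mu>" for a
  proof -
    have [measurable]: "(\<lambda>\<gamma>. \<integral>\<^sup>+x. ennreal (h x) \<partial>\<gamma>) \<in> borel_measurable \<mu>"
      "(\<lambda>\<gamma>. \<integral>\<^sup>+x. ennreal (- h x) \<partial>\<gamma>) \<in> borel_measurable \<mu>"
      by (auto intro: measurable_nn_integral)
    show ?thesis by (simp add: left cong: measurable_cong)
  qed
  have shift_meas: "(\<lambda>p. a (add_point (fst p) (snd p))) \<in> borel_measurable (\<mu> \<Otimes>\<^sub>M M)"
    if "a \<in> borel_measurable \<mu>" for a :: "'a measure \<Rightarrow> real"
    using measurable_add_point_comp[OF that] .
  have right_meas: "(\<lambda>\<gamma>. \<integral>\<^sup>+x. ennreal (a (add_point \<gamma> x) * h x) \<partial>m \<gamma>) \<in> borel_measurable \<mu>"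
    if "a \<in> borel_measurable \<mu>" for a
  proof -
    note [measurable] = shift_meas[OF that]
    show ?thesis
      using measurable_nn_integral_m[of "\<lambda>p. ennreal (a (add_point (fst p) (snd p)) * h (snd p))"] by simp
  qed
  have LR: "L a = R a" if [measurable]: "a \<in> borel_measurable \<mu>" for a
  proof -
    have [measurable]: "(\<lambda>\<gamma>. \<integral>\<^sup>+x. ennreal (h x) \<partial>\<gamma>) \<in> borel_measurable \<mu>"
      "(\<lambda>\<gamma>. \<integral>\<^sup>+x. ennreal (- h x) \<partial>\<gamma>) \<in> borel_measurable \<mu>"
      by (auto intro: measurable_nn_integral)
    note sm[measurable] = shift_meas[OF that]
    have [measurable]: "(\<lambda>x. a (add_point \<gamma> x)) \<in> borel_measurable M" if "\<gamma> \<in> space \<mu>" for \<gamma>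
      using section_measurable[OF sm that] by simp
    have "L a = (\<integral>\<^sup>+\<gamma>. ennreal (a \<gamma>) * (\<integral>\<^sup>+x. ennreal (h x) \<partial>\<gamma>) \<partial>\<mu>)
        + (\<integral>\<^sup>+\<gamma>. ennreal (- a \<gamma>) * (\<integral>\<^sup>+x. ennreal (- h x) \<partial>\<gamma>) \<partial>\<mu>)"
      unfolding L_def by (simp add: left nn_integral_add cong: nn_integral_cong)
    also have "\<dots> = (\<integral>\<^sup>+\<gamma>. \<integral>\<^sup>+x. ennreal (a (add_point \<gamma> x)) * ennreal (h x) \<partial>m \<gamma> \<partial>\<mu>)
        + (\<integral>\<^sup>+\<gamma>. \<integral>\<^sup>+x. ennreal (- a (add_point \<gamma> x)) * ennreal (- h x) \<partial>m \<gamma> \<partial>\<mu>)"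
      by (intro arg_cong2[where f = "(+)"] GNZ_product) measurable
    also have "\<dots> = (\<integral>\<^sup>+\<gamma>. (\<integral>\<^sup>+x. ennreal (a (add_point \<gamma> x)) * ennreal (h x) \<partial>m \<gamma>)
        + (\<integral>\<^sup>+x. ennreal (- a (add_point \<gamma> x)) * ennreal (- h x) \<partial>m \<gamma>) \<partial>\<mu>)"
      using measurable_nn_integral_m[of "\<lambda>p. ennreal (a (add_point (fst p) (snd p))) * ennreal (h (snd p))"]
        measurable_nn_integral_m[of "\<lambda>p. ennreal (- a (add_point (fst p) (snd p))) * ennreal (- h (snd p))"]
      by (intro nn_integral_add[symmetric]) simp_all
    also have "\<dots> = R a"
      unfolding R_def ennreal_mult_parts by (intro nn_integral_cong nn_integral_add[symmetric]) auto
    finally show ?thesis .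
  qed
  have fin: "L b < \<infinity>" if b: "\<And>\<gamma>. \<bar>b \<gamma>\<bar> \<le> C" for b
  proof -
    have "AE \<gamma> in \<mu>. (\<integral>\<^sup>+x. ennreal (b \<gamma> * h x) \<partial>\<gamma>) \<le> ennreal (C * B) * emeasure \<gamma> E"
      using AE_config[OF E(2)] AE_space[of \<mu>]
    proof eventually_elim
      case (elim \<gamma>)
      have Es: "E \<in> sets \<gamma>" using E_sets[OF E(1)] sets_config[OF elim(2)] by simp
      have "b \<gamma> * h x \<le> C * B" for x
        using mult_mono[OF b[of \<gamma>] h(3)[of x] a(2)] by (simp add: abs_mult[symmetric])
      then have "(\<integral>\<^sup>+x. ennreal (b \<gamma> * h x) \<partial>\<gamma>) \<le> (\<integral>\<^sup>+x. ennreal (C * B) * indicator E x \<partial>\<gamma>)"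
        using elim(1) by (intro nn_integral_mono_AE) (auto simp: indicator_def intro!: ennreal_leI elim!: eventually_mono)
      then show ?case using Es by (simp add: nn_integral_cmult_indicator)
    qed
    then have "L b \<le> (\<integral>\<^sup>+\<gamma>. ennreal (C * B) * emeasure \<gamma> E \<partial>\<mu>)"
      unfolding L_def by (rule nn_integral_mono_AE)
    also have "\<dots> = ennreal (C * B) * (\<integral>\<^sup>+\<gamma>. emeasure \<gamma> E \<partial>\<mu>)"
      using measurable_emeasure[OF E_sets[OF E(1)]] by (rule nn_integral_cmult)
    also have "\<dots> < \<infinity>" using intensity_finite[OF E(1)] by (simp add: ennreal_mult_less_top)
    finally show ?thesis .
  qed
  have am: "(\<lambda>\<gamma>. - a \<gamma>) \<in> borel_measurable \<mu>" by measurable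
  have L1: "L a < \<infinity>" and L2: "L (\<lambda>\<gamma>. - a \<gamma>) < \<infinity>" by (rule fin, simp add: a(3))+
  have I1: "\<And>\<gamma>. \<gamma> \<in> space \<mu> \<Longrightarrow> (\<lambda>x. a \<gamma> * h x) \<in> borel_measurable \<gamma>"
    using measurable_config[OF _ h(1)] by measurable
  note left_int = iterated_integral_parts[where S = \<mu> and \<kappa> = "\<lambda>\<gamma>. \<gamma>" and U = "\<lambda>\<gamma> x. a \<gamma> * h x",
      OF I1 left_meas[OF a(1)] left_meas[OF am, unfolded mult_minus_left] L1[unfolded L_def]
        L2[unfolded L_def mult_minus_left]]
  have I2: "\<And>\<gamma>. \<gamma> \<in> space \<mu> \<Longrightarrow> (\<lambda>x. a (add_point \<gamma> x) * h x) \<in> borel_measurable (m \<gamma>)"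
    using section_measurable[OF shift_meas[OF a(1)]] by simp
  note right_int = iterated_integral_parts[where S = \<mu> and \<kappa> = m and U = "\<lambda>\<gamma> x. a (add_point \<gamma> x) * h x",
      OF I2 right_meas[OF a(1)] right_meas[OF am, unfolded mult_minus_left] L1[unfolded LR[OF a(1)] R_def]
        L2[unfolded LR[OF am] R_def mult_minus_left]]
  show "integrable \<mu> (\<lambda>\<gamma>. a \<gamma> * (\<integral>x. h x \<partial>\<gamma>))" using left_int(2) by simp
  show "AE \<gamma> in \<mu>. integrable (m \<gamma>) (\<lambda>x. a (add_point \<gamma> x) * h x)" by (rule right_int(1))
  show "integrable \<mu> (\<lambda>\<gamma>. \<integral>x. a (add_point \<gamma> x) * h x \<partial>m \<gamma>)" by (rule right_int(2))
  show "(\<integral>\<gamma>. a \<gamma> * (\<integral>x. h x \<partial>\<gamma>) \<partial>\<mu>) = (\<integral>\<gamma>. \<integral>x. a (add_point \<gamma> x) * h x \<partial>m \<gamma> \<partial>\<mu>)"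
    using left_int(3) right_int(3) LR[OF a(1)] LR[OF am] by (simp add: L_def R_def)
qed

end


section \<open>The algebra of cylinder functions\<close>

text \<open>Two presentations are brought to the same list \<open>h\<close> of functions by concatenation.\<close>

lemma cyl_data_binary:
  assumes r: "(k, F, f) \<in> cyl_data D" and s: "(l, G, g) \<in> cyl_data D"
  defines "h \<equiv> \<lambda>n. if n < k then f n else g (n - k)"
  shows "\<And>i. i < k + l \<Longrightarrow> h i \<in> D"
    and "cyl_fun (k, F, f) \<gamma> = F (\<lambda>n. \<integral>x. h n x \<partial>\<gamma>)"
    and "cyl_fun (l, G, g) \<gamma> = G (\<lambda>n. \<integral>x. h (k + n) x \<partial>\<gamma>)"
    and "F \<in> Cb_smooth (k + l)" and "(\<lambda>y. G (\<lambda>n. y (k + n))) \<in> Cb_smooth (k + l)"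
proof -
  have F: "F \<in> Cb_smooth k" "\<And>i. i < k \<Longrightarrow> f i \<in> D" and G: "G \<in> Cb_smooth l" "\<And>i. i < l \<Longrightarrow> g i \<in> D"
    using r s unfolding cyl_data_def by auto
  show "h i \<in> D" if "i < k + l" for i
    using that F(2)[of i] G(2)[of "i - k"] unfolding h_def by auto
  show "cyl_fun (k, F, f) \<gamma> = F (\<lambda>n. \<integral>x. h n x \<partial>\<gamma>)"
    unfolding cyl_fun.simps by (rule Cb_smooth_cong[OF F(1)]) (simp add: h_def)
  show "cyl_fun (l, G, g) \<gamma> = G (\<lambda>n. \<integral>x. h (k + n) x \<partial>\<gamma>)"
    by (simp add: h_def)
  show "F \<in> Cb_smooth (k + l)" by (rule Cb_smooth_mono[OF F(1)]) simp
  show "(\<lambda>y. G (\<lambda>n. y (k + n))) \<in> Cb_smooth (k + l)" by (rule Cb_smooth_shift[OF G(1)])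
qed

lemma cyl_fun_linear:
  assumes "r \<in> cyl_data D" "s \<in> cyl_data D"
  shows "\<exists>t\<in>cyl_data D. cyl_fun t = (\<lambda>\<gamma>. a * cyl_fun r \<gamma> + b * cyl_fun s \<gamma>)"
proof -
  obtain k F f l G g where r: "r = (k, F, f)" and s: "s = (l, G, g)" by (cases r; cases s) auto
  note c = cyl_data_binary[OF assms[unfolded r s]]
  let ?h = "\<lambda>n. if n < k then f n else g (n - k)"
  let ?H = "\<lambda>y. a * F y + b * G (\<lambda>n. y (k + n))"
  have "?H \<in> Cb_smooth (k + l)"
    using Cb_smooth_add[OF Cb_smooth_mult[OF Cb_smooth_const[of a] c(4)] Cb_smooth_mult[OF Cb_smooth_const[of b] c(5)]] .
  then have "(k + l, ?H, ?h) \<in> cyl_data D" using c(1) unfolding cyl_data_def by auto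
  moreover have "cyl_fun (k + l, ?H, ?h) = (\<lambda>\<gamma>. a * cyl_fun r \<gamma> + b * cyl_fun s \<gamma>)"
    unfolding r s c(2,3) by (rule ext) (rule cyl_fun.simps)
  ultimately show ?thesis by (rule bexI[rotated])
qed

lemma cyl_fun_mult:
  assumes "r \<in> cyl_data D" "s \<in> cyl_data D"
  shows "\<exists>t\<in>cyl_data D. cyl_fun t = (\<lambda>\<gamma>. cyl_fun r \<gamma> * cyl_fun s \<gamma>)"
proof -
  obtain k F f l G g where r: "r = (k, F, f)" and s: "s = (l, G, g)" by (cases r; cases s) auto
  note c = cyl_data_binary[OF assms[unfolded r s]]
  let ?h = "\<lambda>n. if n < k then f n else g (n - k)"
  let ?H = "\<lambda>y. F y * G (\<lambda>n. y (k + n))"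
  have "?H \<in> Cb_smooth (k + l)" using Cb_smooth_mult[OF c(4,5)] .
  then have "(k + l, ?H, ?h) \<in> cyl_data D" using c(1) unfolding cyl_data_def by auto
  moreover have "cyl_fun (k + l, ?H, ?h) = (\<lambda>\<gamma>. cyl_fun r \<gamma> * cyl_fun s \<gamma>)"
    unfolding r s c(2,3) by (rule ext) (rule cyl_fun.simps)
  ultimately show ?thesis by (rule bexI[rotated])
qed

lemma cyl_fun_const: "\<exists>t\<in>cyl_data D. cyl_fun t = (\<lambda>\<gamma>. c)"
  by (rule bexI[of _ "(0, \<lambda>_. c, \<lambda>_ _. 0)"]) (auto simp: cyl_data_def Cb_smooth_const)

section \<open>The form through increments\<close>

lemma increment_linear:
  "increment (\<lambda>\<gamma>. a * u \<gamma> + b * v \<gamma>) \<gamma> = (\<lambda>x. a * increment u \<gamma> x + b * increment v \<gamma> x)"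
  unfolding increment_def by (simp add: fun_eq_iff algebra_simps)

lemma cyl_fun_bound:
  assumes "r \<in> cyl_data D"
  shows "\<exists>C\<ge>0. \<forall>\<gamma>. \<bar>cyl_fun r \<gamma>\<bar> \<le> C"
proof -
  obtain k F f where r: "r = (k, F, f)" by (cases r)
  then have "F \<in> Cb_smooth k" using assms unfolding cyl_data_def by auto
  then obtain C where C: "\<forall>x. \<bar>F x\<bar> \<le> C"
    using Cb_smooth_bounded[of F k] unfolding bounded_iff by auto
  then have "0 \<le> C" using abs_ge_zero order_trans by blast
  with C show ?thesis unfolding r cyl_fun.simps by blast
qed

lemma integral_double_sum:
  fixes X :: "nat \<Rightarrow> nat \<Rightarrow> 'b \<Rightarrow> real"
  assumes X: "\<And>i j. i < k \<Longrightarrow> j < l \<Longrightarrow> integrable N (X i j)"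
  shows "integrable N (\<lambda>x. \<Sum>i<k. \<Sum>j<l. X i j x)"
    and "(\<integral>x. (\<Sum>i<k. \<Sum>j<l. X i j x) \<partial>N) = (\<Sum>i<k. \<Sum>j<l. \<integral>x. X i j x \<partial>N)"
proof -
  have inner: "integrable N (\<lambda>x. \<Sum>j<l. X i j x)" if "i < k" for i
    by (rule Bochner_Integration.integrable_sum) (simp add: X that)
  then show "integrable N (\<lambda>x. \<Sum>i<k. \<Sum>j<l. X i j x)"
    by (rule Bochner_Integration.integrable_sum) simp
  have "(\<integral>x. (\<Sum>i<k. \<Sum>j<l. X i j x) \<partial>N) = (\<Sum>i<k. \<integral>x. (\<Sum>j<l. X i j x) \<partial>N)"
    by (rule Bochner_Integration.integral_sum) (simp add: inner)
  also have "\<dots> = (\<Sum>i<k. \<Sum>j<l. \<integral>x. X i j x \<partial>N)"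
    by (intro sum.cong refl Bochner_Integration.integral_sum) (simp add: X)
  finally show "(\<integral>x. (\<Sum>i<k. \<Sum>j<l. X i j x) \<partial>N) = (\<Sum>i<k. \<Sum>j<l. \<integral>x. X i j x \<partial>N)" .
qed

context GNZ_configs begin

text \<open>The form, written without reference to a presentation of the cylinder functions or to a
  lifting.\<close>

definition energy :: "('a measure \<Rightarrow> real) \<Rightarrow> ('a measure \<Rightarrow> real) \<Rightarrow> real" where
  "energy u v = (\<integral>\<gamma>. \<integral>x. \<Gamma> (increment u \<gamma>) (increment v \<gamma>) x \<partial>m \<gamma> \<partial>\<mu>)"

lemma Gamma_measurable: "f \<in> D \<Longrightarrow> g \<in> D \<Longrightarrow> \<Gamma> f g \<in> borel_measurable M"
  using Gamma_Linf unfolding bdd_measurable_def by blast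

lemma bdd_measurableD:
  assumes "f \<in> bdd_measurable M"
  shows "f \<in> borel_measurable M" "\<exists>B\<ge>0. \<forall>x. \<bar>f x\<bar> \<le> B"
proof -
  show "f \<in> borel_measurable M" using assms unfolding bdd_measurable_def by blast
  have "bounded (range f)" using assms space_UNIV unfolding bdd_measurable_def by simp
  then obtain B where B: "\<forall>x. \<bar>f x\<bar> \<le> B" unfolding bounded_iff by auto
  then have "0 \<le> B" using abs_ge_zero order_trans by blast
  with B show "\<exists>B\<ge>0. \<forall>x. \<bar>f x\<bar> \<le> B" by blast
qed

lemma Gamma_support:
  assumes "f \<in> D" "g \<in> D"
  shows "\<exists>E\<in>\<E>. AE x in M. x \<notin> E \<longrightarrow> \<Gamma> f g x = 0"
proof -
  obtain h where h: "h \<in> bdd_measurable_loc M \<E>" and ae: "AE x in M. \<Gamma> f g x = h x"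
    using Gamma_loc[OF assms] by blast
  obtain E where "E \<in> \<E>" and E: "\<forall>x. x \<notin> E \<longrightarrow> h x = 0"
    using h unfolding bdd_measurable_loc_def by blast
  moreover have "AE x in M. x \<notin> E \<longrightarrow> \<Gamma> f g x = 0"
    using ae by eventually_elim (use E in auto)
  ultimately show ?thesis by blast
qed

lemma strong_liftingD:
  assumes "strong_lifting M L" "f \<in> D" "g \<in> D"
  shows "L (\<Gamma> f g) \<in> bdd_measurable M" "AE x in M. L (\<Gamma> f g) x = \<Gamma> f g x"
  using assms Gamma_Linf[OF assms(2,3)] unfolding strong_lifting_def by (elim conjE, blast)+

text \<open>One summand of the square field operator on configurations; \<open>r\<close> and \<open>s\<close> stand for partial
  derivatives of the given cylinder functions.\<close>

lemma cyl_term: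
  assumes L: "strong_lifting M L" and r: "r \<in> cyl_data D" and s: "s \<in> cyl_data D"
    and fg: "f \<in> D" "g \<in> D"
  defines "a \<equiv> \<lambda>\<gamma>. cyl_fun r \<gamma> * cyl_fun s \<gamma>" and "h \<equiv> L (\<Gamma> f g)"
  shows "integrable \<mu> (\<lambda>\<gamma>. a \<gamma> * (\<integral>x. h x \<partial>\<gamma>))"
    and "AE \<gamma> in \<mu>. integrable (m \<gamma>) (\<lambda>x. a (add_point \<gamma> x) * h x)"
    and "integrable \<mu> (\<lambda>\<gamma>. \<integral>x. a (add_point \<gamma> x) * h x \<partial>m \<gamma>)"
    and "(\<integral>\<gamma>. a \<gamma> * (\<integral>x. h x \<partial>\<gamma>) \<partial>\<mu>) = (\<integral>\<gamma>. \<integral>x. a (add_point \<gamma> x) * h x \<partial>m \<gamma> \<partial>\<mu>)"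
proof -
  obtain C where C: "0 \<le> C" "\<forall>\<gamma>. \<bar>cyl_fun r \<gamma>\<bar> \<le> C" using cyl_fun_bound[OF r] by blast
  obtain C' where C': "0 \<le> C'" "\<forall>\<gamma>. \<bar>cyl_fun s \<gamma>\<bar> \<le> C'" using cyl_fun_bound[OF s] by blast
  have a1: "a \<in> borel_measurable \<mu>"
    unfolding a_def using cyl_fun_measurable[OF r] cyl_fun_measurable[OF s] by measurable
  have a2: "0 \<le> C * C'" using C(1) C'(1) by simp
  have a3: "\<bar>a \<gamma>\<bar> \<le> C * C'" for \<gamma>
    unfolding a_def abs_mult by (rule mult_mono[OF C(2)[rule_format] C'(2)[rule_format] C(1)]) simp
  note h = bdd_measurableD[OF strong_liftingD(1)[OF L fg]]
  obtain B where B: "0 \<le> B" "\<forall>x. \<bar>h x\<bar> \<le> B" using h(2) unfolding h_def by blast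
  obtain E where E: "E \<in> \<E>" "AE x in M. x \<notin> E \<longrightarrow> \<Gamma> f g x = 0" using Gamma_support[OF fg] by blast
  have E': "AE x in M. x \<notin> E \<longrightarrow> h x = 0"
    using E(2) strong_liftingD(2)[OF L fg] unfolding h_def by eventually_elim simp
  note b = GNZ_bounded[OF a1 a2 a3 h(1)[folded h_def] B(1) B(2)[rule_format] E(1) E']
  show "integrable \<mu> (\<lambda>\<gamma>. a \<gamma> * (\<integral>x. h x \<partial>\<gamma>))"
    and "AE \<gamma> in \<mu>. integrable (m \<gamma>) (\<lambda>x. a (add_point \<gamma> x) * h x)"
    and "integrable \<mu> (\<lambda>\<gamma>. \<integral>x. a (add_point \<gamma> x) * h x \<partial>m \<gamma>)"
    and "(\<integral>\<gamma>. a \<gamma> * (\<integral>x. h x \<partial>\<gamma>) \<partial>\<mu>) = (\<integral>\<gamma>. \<integral>x. a (add_point \<gamma> x) * h x \<partial>m \<gamma> \<partial>\<mu>)"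
    by (rule b)+
qed

text \<open>A jointly measurable version of \<open>\<Gamma>\<close> of two increments.\<close>

lemma Gamma_increment_measurable_version:
  assumes r: "r \<in> cyl_data D" and s: "s \<in> cyl_data D"
  shows "\<exists>J\<in>borel_measurable (\<mu> \<Otimes>\<^sub>M M). \<forall>\<gamma>\<in>space \<mu>.
    AE x in M. \<Gamma> (increment (cyl_fun r) \<gamma>) (increment (cyl_fun s) \<gamma>) x = J (\<gamma>, x)"
proof -
  obtain k F f l G g where r_eq: "r = (k, F, f)" and s_eq: "s = (l, G, g)" by (cases r; cases s) auto
  note r' = r[unfolded r_eq] and s' = s[unfolded s_eq]
  let ?J = "\<lambda>p. \<Sum>i<k. \<Sum>j<l. cyl_fun (k, partial_deriv i F, f) (add_point (fst p) (snd p))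
      * cyl_fun (l, partial_deriv j G, g) (add_point (fst p) (snd p)) * \<Gamma> (f i) (g j) (snd p)"
  have "?J \<in> borel_measurable (\<mu> \<Otimes>\<^sub>M M)"
  proof (intro borel_measurable_sum borel_measurable_times)
    fix i j assume "i \<in> {..<k}" "j \<in> {..<l}"
    then have "\<Gamma> (f i) (g j) \<in> borel_measurable M"
      using cyl_dataD(2)[OF r'] cyl_dataD(2)[OF s'] by (intro Gamma_measurable) auto
    then show "(\<lambda>p. \<Gamma> (f i) (g j) (snd p)) \<in> borel_measurable (\<mu> \<Otimes>\<^sub>M M)"
      by (rule measurable_compose[OF measurable_snd])
  qed (rule measurable_add_point_comp[OF cyl_fun_measurable[OF cyl_data_partial_deriv]], rule r' s')+
  moreover have "\<forall>\<gamma>\<in>space \<mu>.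
      AE x in M. \<Gamma> (increment (cyl_fun r) \<gamma>) (increment (cyl_fun s) \<gamma>) x = ?J (\<gamma>, x)"
    unfolding r_eq s_eq fst_conv snd_conv using Gamma_increment[OF r' s'] by blast
  ultimately show ?thesis by (intro bexI[of _ ?J])
qed

lemma energy_density_measurable:
  assumes r: "r \<in> cyl_data D" and s: "s \<in> cyl_data D"
  shows "(\<lambda>\<gamma>. \<integral>x. \<Gamma> (increment (cyl_fun r) \<gamma>) (increment (cyl_fun s) \<gamma>) x \<partial>m \<gamma>) \<in> borel_measurable \<mu>"
    and "(\<lambda>\<gamma>. \<integral>\<^sup>+x. ennreal (\<Gamma> (increment (cyl_fun r) \<gamma>) (increment (cyl_fun s) \<gamma>) x) \<partial>m \<gamma>) \<in> borel_measurable \<mu>"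
proof -
  obtain J where J: "J \<in> borel_measurable (\<mu> \<Otimes>\<^sub>M M)"
    and eq: "\<forall>\<gamma>\<in>space \<mu>. AE x in M. \<Gamma> (increment (cyl_fun r) \<gamma>) (increment (cyl_fun s) \<gamma>) x = J (\<gamma>, x)"
    using Gamma_increment_measurable_version[OF r s] by blast
  have "(\<integral>x. \<Gamma> (increment (cyl_fun r) \<gamma>) (increment (cyl_fun s) \<gamma>) x \<partial>m \<gamma>) = (\<integral>x. J (\<gamma>, x) \<partial>m \<gamma>)"
    "(\<integral>\<^sup>+x. ennreal (\<Gamma> (increment (cyl_fun r) \<gamma>) (increment (cyl_fun s) \<gamma>) x) \<partial>m \<gamma>) =
      (\<integral>\<^sup>+x. ennreal (J (\<gamma>, x)) \<partial>m \<gamma>)" if \<gamma>: "\<gamma> \<in> space \<mu>" for \<gamma>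
  proof -
    have ae: "AE x in m \<gamma>. \<Gamma> (increment (cyl_fun r) \<gamma>) (increment (cyl_fun s) \<gamma>) x = J (\<gamma>, x)"
      using AE_m[OF \<gamma>] eq \<gamma> by blast
    have "\<Gamma> (increment (cyl_fun r) \<gamma>) (increment (cyl_fun s) \<gamma>) \<in> borel_measurable (m \<gamma>)"
      using Gamma_measurable[OF increment_in_D[OF r \<gamma>] increment_in_D[OF s \<gamma>]] by measurable
    moreover have "(\<lambda>x. J (\<gamma>, x)) \<in> borel_measurable (m \<gamma>)"
      using section_measurable[OF J \<gamma>] by measurable
    ultimately show "(\<integral>x. \<Gamma> (increment (cyl_fun r) \<gamma>) (increment (cyl_fun s) \<gamma>) x \<partial>m \<gamma>) = (\<integral>x. J (\<gamma>, x) \<partial>m \<gamma>)"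
      using ae by (rule integral_cong_AE)
    show "(\<integral>\<^sup>+x. ennreal (\<Gamma> (increment (cyl_fun r) \<gamma>) (increment (cyl_fun s) \<gamma>) x) \<partial>m \<gamma>) =
        (\<integral>\<^sup>+x. ennreal (J (\<gamma>, x)) \<partial>m \<gamma>)"
      using ae by (intro nn_integral_cong_AE) auto
  qed
  moreover have "(\<lambda>\<gamma>. \<integral>\<^sup>+x. ennreal (J (\<gamma>, x)) \<partial>m \<gamma>) \<in> borel_measurable \<mu>"
    by (rule measurable_nn_integral_m) (use J in measurable)
  ultimately show "(\<lambda>\<gamma>. \<integral>x. \<Gamma> (increment (cyl_fun r) \<gamma>) (increment (cyl_fun s) \<gamma>) x \<partial>m \<gamma>) \<in> borel_measurable \<mu>"
    and "(\<lambda>\<gamma>. \<integral>\<^sup>+x. ennreal (\<Gamma> (increment (cyl_fun r) \<gamma>) (increment (cyl_fun s) \<gamma>) x) \<partial>m \<gamma>) \<in> borel_measurable \<mu>"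
    using measurable_integral_m[OF J] by (simp_all cong: measurable_cong)
qed

text \<open>The Georgii-Nguyen-Zessin identity turns the square field on configurations, evaluated at
  \<open>\<gamma> + \<delta>\<^sub>x\<close>, into \<open>\<Gamma>\<close> of increments by the chain rule; since the measures \<open>m \<gamma>\<close> are absolutely
  continuous, the lifting is no longer visible.\<close>

theorem cyl_Gamma_energy:
  assumes L: "strong_lifting M L" and r: "r \<in> cyl_data D" and s: "s \<in> cyl_data D"
  shows "integrable \<mu> (cyl_Gamma \<Gamma> L r s)"
    and "integrable \<mu> (\<lambda>\<gamma>. \<integral>x. \<Gamma> (increment (cyl_fun r) \<gamma>) (increment (cyl_fun s) \<gamma>) x \<partial>m \<gamma>)"
    and "(\<integral>\<gamma>. cyl_Gamma \<Gamma> L r s \<gamma> \<partial>\<mu>) = energy (cyl_fun r) (cyl_fun s)"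
proof -
  obtain k F f l G g where r_eq: "r = (k, F, f)" and s_eq: "s = (l, G, g)" by (cases r; cases s) auto
  note r' = r[unfolded r_eq] and s' = s[unfolded s_eq]
  define A where "A i j \<gamma> = cyl_fun (k, partial_deriv i F, f) \<gamma> * cyl_fun (l, partial_deriv j G, g) \<gamma>" for i j \<gamma>
  define H where "H i j = L (\<Gamma> (f i) (g j))" for i j
  let ?e = "\<lambda>\<gamma>. \<integral>x. \<Gamma> (increment (cyl_fun r) \<gamma>) (increment (cyl_fun s) \<gamma>) x \<partial>m \<gamma>"
  let ?T = "\<lambda>\<gamma>. \<Sum>i<k. \<Sum>j<l. \<integral>x. A i j (add_point \<gamma> x) * H i j x \<partial>m \<gamma>"
  have fg: "f i \<in> D" "g j \<in> D" if "i < k" "j < l" for i j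
    using cyl_dataD(2)[OF r'] cyl_dataD(2)[OF s'] that by auto
  have t: "integrable \<mu> (\<lambda>\<gamma>. A i j \<gamma> * (\<integral>x. H i j x \<partial>\<gamma>))"
    "AE \<gamma> in \<mu>. integrable (m \<gamma>) (\<lambda>x. A i j (add_point \<gamma> x) * H i j x)"
    "integrable \<mu> (\<lambda>\<gamma>. \<integral>x. A i j (add_point \<gamma> x) * H i j x \<partial>m \<gamma>)"
    "(\<integral>\<gamma>. A i j \<gamma> * (\<integral>x. H i j x \<partial>\<gamma>) \<partial>\<mu>) = (\<integral>\<gamma>. \<integral>x. A i j (add_point \<gamma> x) * H i j x \<partial>m \<gamma> \<partial>\<mu>)"
    if "i < k" "j < l" for i j
    unfolding A_def H_def
    by (rule cyl_term[OF L cyl_data_partial_deriv[OF r'] cyl_data_partial_deriv[OF s'] fg[OF that]])+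
  have G_eq: "cyl_Gamma \<Gamma> L r s = (\<lambda>\<gamma>. \<Sum>i<k. \<Sum>j<l. A i j \<gamma> * (\<integral>x. H i j x \<partial>\<gamma>))"
    unfolding r_eq s_eq A_def H_def by (rule ext) simp
  show "integrable \<mu> (cyl_Gamma \<Gamma> L r s)"
    unfolding G_eq by (rule integral_double_sum(1)[OF t(1)])
  have T_int: "integrable \<mu> ?T"
    by (rule integral_double_sum(1)[OF t(3)])
  have "AE \<gamma> in \<mu>. \<forall>i j. i < k \<and> j < l \<longrightarrow> integrable (m \<gamma>) (\<lambda>x. A i j (add_point \<gamma> x) * H i j x)"
    unfolding AE_all_countable using t(2) by auto
  then have e_eq: "AE \<gamma> in \<mu>. ?e \<gamma> = ?T \<gamma>"
    using AE_space[of \<mu>]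
  proof eventually_elim
    case (elim \<gamma>)
    note \<gamma> = elim(2)
    have int: "integrable (m \<gamma>) (\<lambda>x. A i j (add_point \<gamma> x) * H i j x)" if "i < k" "j < l" for i j
      using elim(1) that by blast
    have "AE x in m \<gamma>. \<forall>i j. i < k \<and> j < l \<longrightarrow> H i j x = \<Gamma> (f i) (g j) x"
      unfolding AE_all_countable H_def using AE_m[OF \<gamma> strong_liftingD(2)[OF L fg]] by auto
    with AE_m[OF \<gamma> Gamma_increment[OF r' s' \<gamma>]]
    have ae: "AE x in m \<gamma>. \<Gamma> (increment (cyl_fun r) \<gamma>) (increment (cyl_fun s) \<gamma>) x =
        (\<Sum>i<k. \<Sum>j<l. A i j (add_point \<gamma> x) * H i j x)"
      unfolding r_eq s_eq A_def
      by eventually_elim (auto intro!: sum.cong)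
    have sum_int: "integrable (m \<gamma>) (\<lambda>x. \<Sum>i<k. \<Sum>j<l. A i j (add_point \<gamma> x) * H i j x)"
      by (rule integral_double_sum(1)[OF int])
    have "?e \<gamma> = (\<integral>x. (\<Sum>i<k. \<Sum>j<l. A i j (add_point \<gamma> x) * H i j x) \<partial>m \<gamma>)"
      by (rule integral_cong_AE[OF _ borel_measurable_integrable[OF sum_int] ae])
        (use Gamma_measurable[OF increment_in_D[OF r \<gamma>] increment_in_D[OF s \<gamma>]] in measurable)
    also have "\<dots> = ?T \<gamma>"
      by (rule integral_double_sum(2)[OF int])
    finally show ?case .
  qed
  show "integrable \<mu> ?e"
    using T_int integrable_cong_AE[OF energy_density_measurable(1)[OF r s] borel_measurable_integrable[OF T_int] e_eq]
    by blast
  have "(\<integral>\<gamma>. cyl_Gamma \<Gamma> L r s \<gamma> \<partial>\<mu>) = (\<Sum>i<k. \<Sum>j<l. \<integral>\<gamma>. A i j \<gamma> * (\<integral>x. H i j x \<partial>\<gamma>) \<partial>\<mu>)"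
    unfolding G_eq by (rule integral_double_sum(2)[OF t(1)])
  also have "\<dots> = (\<Sum>i<k. \<Sum>j<l. \<integral>\<gamma>. \<integral>x. A i j (add_point \<gamma> x) * H i j x \<partial>m \<gamma> \<partial>\<mu>)"
    using t(4) by (intro sum.cong) auto
  also have "\<dots> = (\<integral>\<gamma>. ?T \<gamma> \<partial>\<mu>)"
    by (rule integral_double_sum(2)[OF t(3), symmetric])
  also have "\<dots> = (\<integral>\<gamma>. ?e \<gamma> \<partial>\<mu>)"
    by (rule integral_cong_AE[symmetric, OF energy_density_measurable(1)[OF r s] borel_measurable_integrable[OF T_int] e_eq])
  finally show "(\<integral>\<gamma>. cyl_Gamma \<Gamma> L r s \<gamma> \<partial>\<mu>) = energy (cyl_fun r) (cyl_fun s)"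
    unfolding energy_def .
qed

section \<open>The forms on the fibres\<close>

text \<open>The configurations \<open>\<gamma>\<close> for which \<open>m \<gamma>\<close> is finite on \<open>\<E>\<close>, so that \<open>\<Gamma> f g\<close> is integrable for
  \<open>f\<close>, \<open>g\<close> in \<open>D\<close>.\<close>

definition good :: "'a measure \<Rightarrow> bool" where
  "good \<gamma> \<longleftrightarrow> \<gamma> \<in> space \<mu> \<and> (\<forall>E\<in>\<E>. emeasure (m \<gamma>) E < \<infinity>)"

lemma AE_good: "AE \<gamma> in \<mu>. good \<gamma>"
  using AE_m_finite AE_space[of \<mu>] unfolding good_def by eventually_elim blast

lemma good_space: "good \<gamma> \<Longrightarrow> \<gamma> \<in> space \<mu>"
  unfolding good_def by blast

lemma Gamma_integrable_m:
  assumes \<gamma>: "good \<gamma>" and "f \<in> D" "g \<in> D"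
  shows "integrable (m \<gamma>) (\<Gamma> f g)"
proof -
  obtain B where B: "\<forall>x. \<bar>\<Gamma> f g x\<bar> \<le> B" using bdd_measurableD(2)[OF Gamma_Linf[OF assms(2,3)]] by blast
  obtain E where E: "E \<in> \<E>" "AE x in M. x \<notin> E \<longrightarrow> \<Gamma> f g x = 0"
    using Gamma_support[OF assms(2,3)] by blast
  show ?thesis
  proof (rule integrableI_bounded_set[where A = E and B = B])
    show "E \<in> sets (m \<gamma>)" using E_sets[OF E(1)] by simp
    show "\<Gamma> f g \<in> borel_measurable (m \<gamma>)" using Gamma_measurable[OF assms(2,3)] by measurable
    show "emeasure (m \<gamma>) E < \<infinity>" using \<gamma> E(1) unfolding good_def by blast
    show "AE x in m \<gamma>. x \<in> E \<longrightarrow> norm (\<Gamma> f g x) \<le> B" using B by simp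
    show "AE x in m \<gamma>. x \<notin> E \<longrightarrow> \<Gamma> f g x = 0" by (rule AE_m[OF good_space[OF \<gamma>] E(2)])
  qed
qed

lemma fibre_linear:
  assumes \<gamma>: "good \<gamma>" and f: "f \<in> D" and g: "g \<in> D" and h: "h \<in> D"
  shows "(\<integral>x. \<Gamma> (\<lambda>y. a * f y + b * g y) h x \<partial>m \<gamma>) = a * (\<integral>x. \<Gamma> f h x \<partial>m \<gamma>) + b * (\<integral>x. \<Gamma> g h x \<partial>m \<gamma>)"
proof -
  have "(\<integral>x. \<Gamma> (\<lambda>y. a * f y + b * g y) h x \<partial>m \<gamma>) = (\<integral>x. a * \<Gamma> f h x + b * \<Gamma> g h x \<partial>m \<gamma>)"
    using Gamma_integrable_m[OF \<gamma> D_lin[OF f g] h] Gamma_integrable_m[OF \<gamma> f h] Gamma_integrable_m[OF \<gamma> g h]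
    by (intro integral_cong_AE AE_m[OF good_space[OF \<gamma>] Gamma_lin[OF f g h]]) auto
  then show ?thesis
    using Gamma_integrable_m[OF \<gamma> f h] Gamma_integrable_m[OF \<gamma> g h] by simp
qed

lemma fibre_sym:
  assumes \<gamma>: "good \<gamma>" and f: "f \<in> D" and g: "g \<in> D"
  shows "(\<integral>x. \<Gamma> f g x \<partial>m \<gamma>) = (\<integral>x. \<Gamma> g f x \<partial>m \<gamma>)"
  using Gamma_integrable_m[OF \<gamma> f g] Gamma_integrable_m[OF \<gamma> g f]
  by (intro integral_cong_AE AE_m[OF good_space[OF \<gamma>] Gamma_sym[OF f g]]) auto

lemma fibre_nonneg:
  assumes \<gamma>: "\<gamma> \<in> space \<mu>" and f: "f \<in> D"
  shows "0 \<le> (\<integral>x. \<Gamma> f f x \<partial>m \<gamma>)"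
  by (rule integral_nonneg_AE[OF AE_m[OF \<gamma> Gamma_nonneg[OF f]]])

text \<open>Only the values of the increments \<open>m \<gamma>\<close>-almost everywhere matter.\<close>

lemma fibre_cong:
  assumes \<gamma>: "good \<gamma>" and deg: "\<forall>f\<in>D. (AE x in m \<gamma>. f x = 0) \<longrightarrow> (\<forall>g\<in>D. AE x in m \<gamma>. \<Gamma> f g x = 0)"
    and f: "f \<in> D" and f': "f' \<in> D" and g: "g \<in> D" and ae: "AE x in m \<gamma>. f x = f' x"
  shows "(\<integral>x. \<Gamma> f g x \<partial>m \<gamma>) = (\<integral>x. \<Gamma> f' g x \<partial>m \<gamma>)"
proof -
  have d: "(\<lambda>x. 1 * f x + (-1) * f' x) \<in> D" by (rule D_lin[OF f f'])
  have zero: "AE x in m \<gamma>. 1 * f x + (-1) * f' x = 0" using ae by eventually_elim simp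
  have "AE x in m \<gamma>. \<Gamma> (\<lambda>x. 1 * f x + (-1) * f' x) g x = 0"
    by (rule bspec[OF mp[OF bspec[OF deg d] zero] g])
  with AE_m[OF good_space[OF \<gamma>] Gamma_lin[OF f f' g, of 1 "-1"]]
  have "AE x in m \<gamma>. \<Gamma> f g x = \<Gamma> f' g x"
  proof eventually_elim
    case (elim x)
    from trans[OF elim(1)[symmetric] elim(2)] show ?case by simp
  qed
  then show ?thesis
    using Gamma_integrable_m[OF \<gamma> f g] Gamma_integrable_m[OF \<gamma> f' g] by (intro integral_cong_AE) auto
qed

lemma energy_sym:
  assumes r: "r \<in> cyl_data D" and s: "s \<in> cyl_data D"
  shows "energy (cyl_fun r) (cyl_fun s) = energy (cyl_fun s) (cyl_fun r)"
  unfolding energy_def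
proof (rule integral_cong_AE[OF energy_density_measurable(1)[OF r s] energy_density_measurable(1)[OF s r]])
  show "AE \<gamma> in \<mu>. (\<integral>x. \<Gamma> (increment (cyl_fun r) \<gamma>) (increment (cyl_fun s) \<gamma>) x \<partial>m \<gamma>) =
      (\<integral>x. \<Gamma> (increment (cyl_fun s) \<gamma>) (increment (cyl_fun r) \<gamma>) x \<partial>m \<gamma>)"
    using AE_good
  proof eventually_elim
    case (elim \<gamma>)
    note \<gamma> = good_space[OF elim]
    show ?case by (rule fibre_sym[OF elim increment_in_D[OF r \<gamma>] increment_in_D[OF s \<gamma>]])
  qed
qed

lemma energy_cong_left:
  assumes r: "r \<in> cyl_data D" and r': "r' \<in> cyl_data D" and s: "s \<in> cyl_data D"
    and ae: "AE \<gamma> in \<mu>. cyl_fun r \<gamma> = cyl_fun r' \<gamma>"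
  shows "energy (cyl_fun r) (cyl_fun s) = energy (cyl_fun r') (cyl_fun s)"
  unfolding energy_def
proof (rule integral_cong_AE[OF energy_density_measurable(1)[OF r s] energy_density_measurable(1)[OF r' s]])
  show "AE \<gamma> in \<mu>. (\<integral>x. \<Gamma> (increment (cyl_fun r) \<gamma>) (increment (cyl_fun s) \<gamma>) x \<partial>m \<gamma>) =
      (\<integral>x. \<Gamma> (increment (cyl_fun r') \<gamma>) (increment (cyl_fun s) \<gamma>) x \<partial>m \<gamma>)"
    using AE_good degenerate ae AE_add_point[OF ae]
  proof eventually_elim
    case (elim \<gamma>)
    note \<gamma> = good_space[OF elim(1)]
    have "AE x in m \<gamma>. increment (cyl_fun r) \<gamma> x = increment (cyl_fun r') \<gamma> x"
      using elim(4) by eventually_elim (simp add: increment_def elim(3))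
    then show ?case
      by (rule fibre_cong[OF elim(1,2) increment_in_D[OF r \<gamma>] increment_in_D[OF r' \<gamma>] increment_in_D[OF s \<gamma>]])
  qed
qed

lemma energy_cong:
  assumes r: "r \<in> cyl_data D" "r' \<in> cyl_data D" and s: "s \<in> cyl_data D" "s' \<in> cyl_data D"
    and ae: "AE \<gamma> in \<mu>. cyl_fun r \<gamma> = cyl_fun r' \<gamma>" "AE \<gamma> in \<mu>. cyl_fun s \<gamma> = cyl_fun s' \<gamma>"
  shows "energy (cyl_fun r) (cyl_fun s) = energy (cyl_fun r') (cyl_fun s')"
  using energy_cong_left[OF r s(1) ae(1)] energy_cong_left[OF s r(2) ae(2)]
    energy_sym[OF r(2) s(1)] energy_sym[OF r(2) s(2)] by simp

lemma energy_nonneg: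
  assumes r: "r \<in> cyl_data D"
  shows "0 \<le> energy (cyl_fun r) (cyl_fun r)"
  unfolding energy_def
proof (rule integral_nonneg_AE)
  show "AE \<gamma> in \<mu>. 0 \<le> (\<integral>x. \<Gamma> (increment (cyl_fun r) \<gamma>) (increment (cyl_fun r) \<gamma>) x \<partial>m \<gamma>)"
    using fibre_nonneg[OF _ increment_in_D[OF r]] by (intro AE_I2) blast
qed

lemma energy_linear:
  assumes L: "strong_lifting M L"
    and r: "r \<in> cyl_data D" and s: "s \<in> cyl_data D" and t: "t \<in> cyl_data D" and q: "q \<in> cyl_data D"
    and q_eq: "cyl_fun q = (\<lambda>\<gamma>. a * cyl_fun r \<gamma> + b * cyl_fun s \<gamma>)"
  shows "energy (cyl_fun q) (cyl_fun t) = a * energy (cyl_fun r) (cyl_fun t) + b * energy (cyl_fun s) (cyl_fun t)"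
proof -
  note int = cyl_Gamma_energy(2)[OF L r t] cyl_Gamma_energy(2)[OF L s t]
  have "energy (cyl_fun q) (cyl_fun t) = (\<integral>\<gamma>. a * (\<integral>x. \<Gamma> (increment (cyl_fun r) \<gamma>) (increment (cyl_fun t) \<gamma>) x \<partial>m \<gamma>)
      + b * (\<integral>x. \<Gamma> (increment (cyl_fun s) \<gamma>) (increment (cyl_fun t) \<gamma>) x \<partial>m \<gamma>) \<partial>\<mu>)"
    unfolding energy_def
  proof (rule integral_cong_AE[OF energy_density_measurable(1)[OF q t]])
    show "AE \<gamma> in \<mu>. (\<integral>x. \<Gamma> (increment (cyl_fun q) \<gamma>) (increment (cyl_fun t) \<gamma>) x \<partial>m \<gamma>) =
        a * (\<integral>x. \<Gamma> (increment (cyl_fun r) \<gamma>) (increment (cyl_fun t) \<gamma>) x \<partial>m \<gamma>)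
        + b * (\<integral>x. \<Gamma> (increment (cyl_fun s) \<gamma>) (increment (cyl_fun t) \<gamma>) x \<partial>m \<gamma>)"
      unfolding q_eq increment_linear using AE_good
    proof eventually_elim
      case (elim \<gamma>)
      note \<gamma> = good_space[OF elim]
      show ?case
        by (rule fibre_linear[OF elim increment_in_D[OF r \<gamma>] increment_in_D[OF s \<gamma>] increment_in_D[OF t \<gamma>]])
    qed
  qed (use int in \<open>auto intro!: borel_measurable_add borel_measurable_times\<close>)
  also have "\<dots> = a * energy (cyl_fun r) (cyl_fun t) + b * energy (cyl_fun s) (cyl_fun t)"
    unfolding energy_def using int by simp
  finally show ?thesis .
qed

end

section \<open>Closability\<close>

lemma ennreal_suminf_finite_imp_tendsto_0:
  fixes f :: "nat \<Rightarrow> ennreal"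
  assumes "(\<Sum>i. f i) \<noteq> \<infinity>"
  shows "f \<longlonglongrightarrow> 0"
proof -
  have fin: "f i \<noteq> top" for i
    using ennreal_suminf_lessD[of f top i] assms by (simp add: less_top)
  then have eq: "f = (\<lambda>i. ennreal (enn2real (f i)))" by (simp add: less_top fun_eq_iff)
  have "summable (\<lambda>i. enn2real (f i))"
    using assms by (intro summable_suminf_not_top) (simp_all add: eq[symmetric])
  then have "(\<lambda>i. ennreal (enn2real (f i))) \<longlonglongrightarrow> ennreal 0"
    by (intro tendsto_ennrealI summable_LIMSEQ_zero)
  then show ?thesis using eq by simp
qed

lemma AE_tendsto_0_if_summable:
  fixes u :: "nat \<Rightarrow> 'b \<Rightarrow> ennreal"
  assumes [measurable]: "\<And>k. u k \<in> borel_measurable N" and fin: "(\<Sum>k. \<integral>\<^sup>+x. u k x \<partial>N) < \<infinity>"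
  shows "AE x in N. (\<Sum>k. u k x) \<noteq> \<infinity>" and "AE x in N. (\<lambda>k. u k x) \<longlonglongrightarrow> 0"
proof -
  have "(\<integral>\<^sup>+x. (\<Sum>k. u k x) \<partial>N) = (\<Sum>k. \<integral>\<^sup>+x. u k x \<partial>N)" by (rule nn_integral_suminf) measurable
  then show *: "AE x in N. (\<Sum>k. u k x) \<noteq> \<infinity>"
    using fin by (intro nn_integral_PInf_AE borel_measurable_suminf) simp_all
  then show "AE x in N. (\<lambda>k. u k x) \<longlonglongrightarrow> 0"
    by eventually_elim (rule ennreal_suminf_finite_imp_tendsto_0)
qed

lemma suminf_ennreal_geometric_finite:
  assumes "\<And>k. f k \<le> ennreal (1 / 2 ^ k)"
  shows "(\<Sum>k. f k) < (\<infinity>::ennreal)"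
proof -
  have "(\<Sum>k. f k) \<le> (\<Sum>k. ennreal (1 / 2 ^ k))" by (intro suminf_le assms) auto
  also have "\<dots> = ennreal (\<Sum>k. (1 / 2) ^ k)"
    by (subst suminf_ennreal2[symmetric]) (auto simp: power_one_over intro!: summable_geometric)
  also have "\<dots> < \<infinity>" by simp
  finally show ?thesis .
qed

lemma ennreal_two_sum:
  "0 \<le> a \<Longrightarrow> 0 \<le> b \<Longrightarrow> ennreal (2 * a + 2 * b) = 2 * ennreal a + 2 * ennreal b"
  by (simp add: ennreal_mult')

context GNZ_configs begin

lemma Gamma_add_left:
  assumes "f \<in> D" "g \<in> D" "h \<in> D"
  shows "AE x in M. \<Gamma> (\<lambda>y. f y + g y) h x = \<Gamma> f h x + \<Gamma> g h x"
  using Gamma_lin[OF assms, of 1 1] by simp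

lemma D_add: "f \<in> D \<Longrightarrow> g \<in> D \<Longrightarrow> (\<lambda>x. f x + g x) \<in> D"
  using D_lin[of f g 1 1] by simp

lemma D_minus: "f \<in> D \<Longrightarrow> (\<lambda>x. - f x) \<in> D"
  using D_lin[of f f "-1" 0] by simp

lemma D_diff: "f \<in> D \<Longrightarrow> g \<in> D \<Longrightarrow> (\<lambda>x. f x - g x) \<in> D"
  using D_lin[of f g 1 "-1"] by simp

lemma Gamma_minus_left:
  assumes "f \<in> D" "h \<in> D"
  shows "AE x in M. \<Gamma> (\<lambda>y. - f y) h x = - \<Gamma> f h x"
  using Gamma_lin[OF assms(1,1,2), of "-1" 0] by simp

lemma Gamma_minus:
  assumes f: "f \<in> D"
  shows "AE x in M. \<Gamma> (\<lambda>y. - f y) (\<lambda>y. - f y) x = \<Gamma> f f x"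
  using Gamma_minus_left[OF f D_minus[OF f]] Gamma_sym[OF f D_minus[OF f]] Gamma_minus_left[OF f f]
  by eventually_elim simp

lemma Gamma_zero:
  assumes "h \<in> D"
  shows "AE x in M. \<Gamma> (\<lambda>_. 0) h x = 0"
  using Gamma_lin[OF assms assms assms, of 0 0] by simp

text \<open>This is \<open>\<Gamma>(f - g, f - g) \<ge> 0\<close>.\<close>

lemma Gamma_diff_nonneg:
  assumes f: "f \<in> D" and g: "g \<in> D"
  shows "AE x in M. 2 * \<Gamma> f g x \<le> \<Gamma> f f x + \<Gamma> g g x"
  using Gamma_add_left[OF f D_minus[OF g] D_add[OF f D_minus[OF g]]]
    Gamma_nonneg[OF D_add[OF f D_minus[OF g]]]
    Gamma_sym[OF f D_add[OF f D_minus[OF g]]] Gamma_sym[OF D_minus[OF g] D_add[OF f D_minus[OF g]]]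
    Gamma_add_left[OF f D_minus[OF g] f] Gamma_add_left[OF f D_minus[OF g] D_minus[OF g]]
    Gamma_minus_left[OF g f] Gamma_minus[OF g] Gamma_sym[OF f D_minus[OF g]] Gamma_sym[OF f g]
  by eventually_elim simp

lemma Gamma_sum_le:
  assumes f: "f \<in> D" and g: "g \<in> D"
  shows "AE x in M. \<Gamma> (\<lambda>y. f y + g y) (\<lambda>y. f y + g y) x \<le> 2 * \<Gamma> f f x + 2 * \<Gamma> g g x"
  using Gamma_add_left[OF f g D_add[OF f g]]
    Gamma_sym[OF f D_add[OF f g]] Gamma_sym[OF g D_add[OF f g]]
    Gamma_add_left[OF f g f] Gamma_add_left[OF f g g] Gamma_sym[OF f g] Gamma_diff_nonneg[OF f g]
  by eventually_elim simp

text \<open>The quadratic form on the fibre over \<open>\<gamma>\<close>, with values in \<open>[0, \<infinity>]\<close>.\<close>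

definition en :: "'a measure \<Rightarrow> ('a \<Rightarrow> real) \<Rightarrow> ennreal" where
  "en \<gamma> f = (\<integral>\<^sup>+x. ennreal (\<Gamma> f f x) \<partial>m \<gamma>)"

lemma en_eq:
  assumes "good \<gamma>" "f \<in> D"
  shows "en \<gamma> f = ennreal (\<integral>x. \<Gamma> f f x \<partial>m \<gamma>)"
  unfolding en_def
  by (rule nn_integral_eq_integral[OF Gamma_integrable_m[OF assms assms(2)]
      AE_m[OF good_space[OF assms(1)] Gamma_nonneg[OF assms(2)]]])

lemma en_sum_le:
  assumes \<gamma>: "\<gamma> \<in> space \<mu>" and f: "f \<in> D" and g: "g \<in> D"
  shows "en \<gamma> (\<lambda>x. f x + g x) \<le> 2 * en \<gamma> f + 2 * en \<gamma> g"
proof -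
  have [measurable]: "\<Gamma> f f \<in> borel_measurable M" "\<Gamma> g g \<in> borel_measurable M"
    using f g by (auto intro: Gamma_measurable)
  have "AE x in M. ennreal (\<Gamma> (\<lambda>y. f y + g y) (\<lambda>y. f y + g y) x) \<le>
      2 * ennreal (\<Gamma> f f x) + 2 * ennreal (\<Gamma> g g x)"
    using Gamma_sum_le[OF f g] Gamma_nonneg[OF f] Gamma_nonneg[OF g]
  proof eventually_elim
    case (elim x)
    show ?case using ennreal_leI[OF elim(1)] unfolding ennreal_two_sum[OF elim(2,3)] .
  qed
  then have "en \<gamma> (\<lambda>x. f x + g x) \<le> (\<integral>\<^sup>+x. 2 * ennreal (\<Gamma> f f x) + 2 * ennreal (\<Gamma> g g x) \<partial>m \<gamma>)"
    unfolding en_def by (intro nn_integral_mono_AE AE_m[OF \<gamma>])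
  also have "\<dots> = 2 * en \<gamma> f + 2 * en \<gamma> g"
    unfolding en_def by (simp add: nn_integral_add nn_integral_cmult)
  finally show ?thesis .
qed

lemma en_minus:
  assumes \<gamma>: "\<gamma> \<in> space \<mu>" and f: "f \<in> D"
  shows "en \<gamma> (\<lambda>x. - f x) = en \<gamma> f"
proof -
  have "AE x in m \<gamma>. ennreal (\<Gamma> (\<lambda>y. - f y) (\<lambda>y. - f y) x) = ennreal (\<Gamma> f f x)"
    using AE_m[OF \<gamma> Gamma_minus[OF f]] by eventually_elim simp
  then show ?thesis unfolding en_def by (rule nn_integral_cong_AE)
qed

lemma en_zero:
  assumes \<gamma>: "\<gamma> \<in> space \<mu>"
  shows "en \<gamma> (\<lambda>_. 0) = 0"
proof -
  have "AE x in m \<gamma>. ennreal (\<Gamma> (\<lambda>_. 0) (\<lambda>_. 0) x) = 0"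
    using AE_m[OF \<gamma> Gamma_zero[OF D_zero]] by eventually_elim simp
  then have "en \<gamma> (\<lambda>_. 0) = (\<integral>\<^sup>+x. 0 \<partial>m \<gamma>)" unfolding en_def by (rule nn_integral_cong_AE)
  then show ?thesis by simp
qed

text \<open>The factor 2 lost in each application of the quasi-triangle inequality is absorbed by the
  geometric decay of the steps.\<close>

lemma en_telescope:
  assumes \<gamma>: "\<gamma> \<in> space \<mu>" and f: "\<And>k. f k \<in> D" and C: "0 \<le> C"
    and step: "\<And>k. en \<gamma> (\<lambda>x. f (Suc k) x - f k x) \<le> ennreal (C / 4 ^ k)"
  shows "en \<gamma> (\<lambda>x. f (j + d) x - f j x) \<le> ennreal (4 * C / 4 ^ j)"
proof (induction d arbitrary: j)
  case 0
  then show ?case using en_zero[OF \<gamma>] by simp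
next
  case (Suc d)
  have "en \<gamma> (\<lambda>x. f (j + Suc d) x - f j x) =
      en \<gamma> (\<lambda>x. (f (Suc j + d) x - f (Suc j) x) + (f (Suc j) x - f j x))"
    by simp
  also have "\<dots> \<le> 2 * en \<gamma> (\<lambda>x. f (Suc j + d) x - f (Suc j) x) + 2 * en \<gamma> (\<lambda>x. f (Suc j) x - f j x)"
    by (rule en_sum_le[OF \<gamma> D_diff[OF f f] D_diff[OF f f]])
  also have "\<dots> \<le> 2 * ennreal (4 * C / 4 ^ Suc j) + 2 * ennreal (C / 4 ^ j)"
    by (intro add_mono mult_left_mono Suc.IH step) auto
  also have "\<dots> = ennreal (2 * (4 * C / 4 ^ Suc j) + 2 * (C / 4 ^ j))"
    by (rule ennreal_two_sum[symmetric]) (use C in auto)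
  also have "2 * (4 * C / 4 ^ Suc j) + 2 * (C / 4 ^ j) = 4 * C / 4 ^ j" by simp
  finally show ?case .
qed

text \<open>If \<open>f k\<close> is Cauchy on the fibre and tends to \<open>0\<close> in \<open>L\<^sup>2(w m\<^sub>\<gamma>)\<close>, closability makes the
  \<open>w\<close>-weighted energies of \<open>f k\<close> tend to \<open>0\<close>.  The weight is removed by means of
  \<open>min 1 (N w) \<up> 1\<close>: multiply \<open>\<Gamma>(g, g) \<le> 2 \<Gamma>(g - f k, g - f k) + 2 \<Gamma>(f k, f k)\<close> by it and let first
  \<open>k\<close>, then \<open>N\<close> tend to infinity.\<close>

lemma fibre_liminf:
  assumes \<gamma>: "good \<gamma>"
    and clos: "closable_form (density (m \<gamma>) (\<lambda>x. ennreal (w x))) D (\<lambda>f g. \<integral>x. \<Gamma> f g x * w x \<partial>m \<gamma>)"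
    and f: "\<And>k. f k \<in> D" and C: "0 \<le> C"
    and step: "\<And>k. en \<gamma> (\<lambda>x. f (Suc k) x - f k x) \<le> ennreal (C / 4 ^ k)"
    and lim: "(\<lambda>k. \<integral>\<^sup>+x. ennreal ((f k x)\<^sup>2) * ennreal (w x) \<partial>m \<gamma>) \<longlonglongrightarrow> 0"
    and g: "g \<in> D"
  shows "en \<gamma> g \<le> liminf (\<lambda>k. 2 * en \<gamma> (\<lambda>x. g x - f k x))"
proof -
  note sp = good_space[OF \<gamma>] and [measurable] = w_measurable
  have fm[measurable]: "f k \<in> borel_measurable M" for k using D_measurable[OF f] .
  have w01: "0 \<le> w x" "w x \<le> 1" for x using w_pos[of x] w_le_1[of x] by auto
  let ?Q = "\<lambda>f g. \<integral>x. \<Gamma> f g x * w x \<partial>m \<gamma>"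
  have Q_int: "integrable (m \<gamma>) (\<lambda>x. \<Gamma> h h x * w x)" if h: "h \<in> D" for h
  proof (rule Bochner_Integration.integrable_bound[OF Gamma_integrable_m[OF \<gamma> h h]])
    show "(\<lambda>x. \<Gamma> h h x * w x) \<in> borel_measurable (m \<gamma>)"
      using Gamma_measurable[OF h h] by measurable
    show "AE x in m \<gamma>. norm (\<Gamma> h h x * w x) \<le> norm (\<Gamma> h h x)"
      using w01 by (auto simp: abs_mult intro!: mult_left_le)
  qed
  have Q_le: "?Q h h \<le> c" if h: "h \<in> D" and c: "0 \<le> c" "en \<gamma> h \<le> ennreal c" for h c
  proof -
    have "?Q h h \<le> (\<integral>x. \<Gamma> h h x \<partial>m \<gamma>)"
    proof (rule integral_mono_AE[OF Q_int[OF h] Gamma_integrable_m[OF \<gamma> h h]])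
      show "AE x in m \<gamma>. \<Gamma> h h x * w x \<le> \<Gamma> h h x"
        using AE_m[OF sp Gamma_nonneg[OF h]] by eventually_elim (intro mult_left_le w01)
    qed
    also have "\<dots> \<le> c" using c en_eq[OF \<gamma> h] by simp
    finally show ?thesis .
  qed
  have diff_le: "en \<gamma> (\<lambda>x. f i x - f j x) \<le> ennreal (4 * C / 4 ^ n)" if "n \<le> i" "n \<le> j" for i j n
  proof -
    have less: "en \<gamma> (\<lambda>x. f i x - f j x) \<le> ennreal (4 * C / 4 ^ n)" if "n \<le> j" "j \<le> i" for i j
    proof -
      have "en \<gamma> (\<lambda>x. f i x - f j x) \<le> ennreal (4 * C / 4 ^ j)"
        using en_telescope[OF sp f C step, of j "i - j"] that by simp
      also have "\<dots> \<le> ennreal (4 * C / 4 ^ n)"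
        using C that by (intro ennreal_leI divide_left_mono power_increasing) auto
      finally show ?thesis .
    qed
    show ?thesis
    proof (cases "j \<le> i")
      case True
      then show ?thesis using less that by blast
    next
      case False
      have "en \<gamma> (\<lambda>x. f i x - f j x) = en \<gamma> (\<lambda>x. f j x - f i x)"
        using en_minus[OF sp D_diff[OF f f], of j i] by simp
      then show ?thesis using less[of i j] that False by simp
    qed
  qed
  have "form_Cauchy ?Q f"
    unfolding form_Cauchy_def
  proof (intro allI impI)
    fix e :: real assume "0 < e"
    have "(\<lambda>n. 4 * C / 4 ^ n) \<longlonglongrightarrow> 0"
      using LIMSEQ_divide_realpow_zero[of 4 "4 * C"] by simp
    then have "\<forall>\<^sub>F n in sequentially. 4 * C / 4 ^ n < e"
      using \<open>0 < e\<close> by (rule order_tendstoD)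
    then obtain n where n: "4 * C / 4 ^ n < e" using eventually_happens'[OF sequentially_bot] by blast
    have "?Q (\<lambda>x. f i x - f j x) (\<lambda>x. f i x - f j x) < e" if "n \<le> i" "n \<le> j" for i j
      using Q_le[OF D_diff[OF f f] _ diff_le[OF that]] C n by (simp add: le_less_trans)
    then show "\<exists>N. \<forall>i\<ge>N. \<forall>j\<ge>N. ?Q (\<lambda>x. f i x - f j x) (\<lambda>x. f i x - f j x) < e" by blast
  qed
  moreover have "L2_tendsto (density (m \<gamma>) (\<lambda>x. ennreal (w x))) f (\<lambda>_. 0)"
    unfolding L2_tendsto_def using lim by (simp add: nn_integral_density mult.commute)
  ultimately have Q0: "(\<lambda>k. ?Q (f k) (f k)) \<longlonglongrightarrow> 0"
    using clos f unfolding closable_form_def by blast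
  have part: "(\<integral>\<^sup>+x. ennreal (\<Gamma> g g x) * ennreal (min 1 (real N * w x)) \<partial>m \<gamma>)
      \<le> liminf (\<lambda>k. 2 * en \<gamma> (\<lambda>x. g x - f k x))" (is "?I \<le> _") for N
  proof -
    have "?I - ennreal (2 * real N * ?Q (f k) (f k)) \<le> 2 * en \<gamma> (\<lambda>x. g x - f k x)" for k
    proof -
      note d = D_diff[OF g f[of k]]
      note [measurable] = Gamma_measurable[OF d d] Gamma_measurable[OF f[of k] f[of k]]
      have "AE x in M. \<Gamma> g g x \<le> 2 * \<Gamma> (\<lambda>x. g x - f k x) (\<lambda>x. g x - f k x) x + 2 * \<Gamma> (f k) (f k) x"
        using Gamma_sum_le[OF d f[of k]] by simp
      then have "AE x in M. ennreal (\<Gamma> g g x) * ennreal (min 1 (real N * w x)) \<le>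
          2 * ennreal (\<Gamma> (\<lambda>x. g x - f k x) (\<lambda>x. g x - f k x) x)
          + ennreal (2 * real N) * ennreal (\<Gamma> (f k) (f k) x * w x)"
        using Gamma_nonneg[OF d] Gamma_nonneg[OF f[of k]] Gamma_nonneg[OF g]
      proof eventually_elim
        case (elim x)
        let ?a = "\<Gamma> (\<lambda>x. g x - f k x) (\<lambda>x. g x - f k x) x" and ?b = "\<Gamma> (f k) (f k) x"
        let ?c = "min 1 (real N * w x)"
        have c: "0 \<le> ?c" "?c \<le> 1" "?c \<le> real N * w x" using w01 by auto
        have "\<Gamma> g g x * ?c \<le> (2 * ?a + 2 * ?b) * ?c" using elim(1) c(1) by (rule mult_right_mono)
        also have "\<dots> = 2 * (?a * ?c) + 2 * (?b * ?c)" by (simp add: algebra_simps)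
        also have "\<dots> \<le> 2 * (?a * 1) + 2 * (?b * (real N * w x))"
          using elim(2,3) c by (intro add_mono mult_left_mono) auto
        finally have "ennreal (\<Gamma> g g x * ?c) \<le> ennreal (2 * ?a + 2 * real N * (?b * w x))"
          by (intro ennreal_leI) (simp add: algebra_simps)
        then show ?case using elim(2-4) c w01 by (simp add: ennreal_mult')
      qed
      from AE_m[OF sp this]
      have "?I \<le> (\<integral>\<^sup>+x. 2 * ennreal (\<Gamma> (\<lambda>x. g x - f k x) (\<lambda>x. g x - f k x) x)
          + ennreal (2 * real N) * ennreal (\<Gamma> (f k) (f k) x * w x) \<partial>m \<gamma>)"
        by (rule nn_integral_mono_AE)
      also have "\<dots> = 2 * en \<gamma> (\<lambda>x. g x - f k x)
          + ennreal (2 * real N) * (\<integral>\<^sup>+x. ennreal (\<Gamma> (f k) (f k) x * w x) \<partial>m \<gamma>)"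
        unfolding en_def by (simp add: nn_integral_add nn_integral_cmult)
      also have "(\<integral>\<^sup>+x. ennreal (\<Gamma> (f k) (f k) x * w x) \<partial>m \<gamma>) = ennreal (?Q (f k) (f k))"
        using AE_m[OF sp Gamma_nonneg[OF f[of k]]] w01
        by (intro nn_integral_eq_integral Q_int f) (auto elim!: eventually_mono)
      also have "ennreal (2 * real N) * ennreal (?Q (f k) (f k)) = ennreal (2 * real N * ?Q (f k) (f k))"
        by (simp add: ennreal_mult')
      finally show ?thesis by (simp add: ennreal_minus_le_iff add.commute)
    qed
    then have "liminf (\<lambda>k. ?I - ennreal (2 * real N * ?Q (f k) (f k))) \<le> liminf (\<lambda>k. 2 * en \<gamma> (\<lambda>x. g x - f k x))"
      by (intro Liminf_mono always_eventually) blast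
    moreover have "liminf (\<lambda>k. ?I - ennreal (2 * real N * ?Q (f k) (f k))) = ?I"
    proof (rule lim_imp_Liminf)
      have "(\<lambda>k. 2 * real N * ?Q (f k) (f k)) \<longlonglongrightarrow> 2 * real N * 0"
        by (intro tendsto_mult tendsto_const Q0)
      then have "(\<lambda>k. ennreal (2 * real N * ?Q (f k) (f k))) \<longlonglongrightarrow> ennreal (2 * real N * 0)"
        by (rule tendsto_ennrealI)
      moreover have "?I \<noteq> top"
      proof -
        have "?I \<le> en \<gamma> g"
          unfolding en_def by (intro nn_integral_mono) (auto intro!: mult_left_le simp: ennreal_le_1)
        then show ?thesis using en_eq[OF \<gamma> g] by (auto simp: top_unique)
      qed
      ultimately have "(\<lambda>k. ?I - ennreal (2 * real N * ?Q (f k) (f k))) \<longlonglongrightarrow> ?I - ennreal (2 * real N * 0)"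
        by (intro tendsto_diff_ennreal tendsto_const) auto
      then show "(\<lambda>k. ?I - ennreal (2 * real N * ?Q (f k) (f k))) \<longlonglongrightarrow> ?I" by simp
    qed simp
    ultimately show ?thesis by simp
  qed
  have SUP1: "(SUP N. ennreal (min 1 (real N * w x))) = 1" for x
  proof (rule antisym)
    show "(SUP N. ennreal (min 1 (real N * w x))) \<le> 1"
      by (intro SUP_least) (simp add: ennreal_le_1)
    obtain N :: nat where "1 < real N * w x" using reals_Archimedean3[OF w_pos[of x]] by blast
    then have "ennreal (min 1 (real N * w x)) = 1" by simp
    then show "1 \<le> (SUP N. ennreal (min 1 (real N * w x)))" by (metis SUP_upper UNIV_I)
  qed
  note [measurable] = Gamma_measurable[OF g g]
  have "en \<gamma> g = (\<integral>\<^sup>+x. (SUP N. ennreal (\<Gamma> g g x) * ennreal (min 1 (real N * w x))) \<partial>m \<gamma>)"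
    unfolding en_def by (simp add: SUP_mult_left_ennreal[symmetric] SUP1)
  also have "\<dots> = (SUP N. \<integral>\<^sup>+x. ennreal (\<Gamma> g g x) * ennreal (min 1 (real N * w x)) \<partial>m \<gamma>)"
  proof (rule nn_integral_monotone_convergence_SUP)
    show "incseq (\<lambda>N x. ennreal (\<Gamma> g g x) * ennreal (min 1 (real N * w x)))"
      using w01 by (intro incseq_SucI le_funI mult_left_mono ennreal_leI min.mono mult_right_mono) auto
  qed measurable
  also have "\<dots> \<le> liminf (\<lambda>k. 2 * en \<gamma> (\<lambda>x. g x - f k x))"
    by (intro SUP_least part)
  finally show ?thesis .
qed

lemma nn_integral_intensity:
  assumes "h \<in> borel_measurable M"
  shows "(\<integral>\<^sup>+x. h x \<partial>intensity M \<mu>) = (\<integral>\<^sup>+\<gamma>. \<integral>\<^sup>+x. h x \<partial>\<gamma> \<partial>\<mu>)"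
proof -
  have sets_int[measurable_cong]: "sets (intensity M \<mu>) = sets M"
    unfolding intensity_def by (simp add: sets.space_closed sets.sigma_sets_eq)
  have sp_int: "space (intensity M \<mu>) = UNIV"
    using sets_eq_imp_space_eq[OF sets_int] space_UNIV by simp
  show ?thesis
    using assms
  proof (induction rule: borel_measurable_induct)
    case (cong f g)
    then have "f = g" using space_UNIV by auto
    with cong(4) show ?case by simp
  next
    case (set A)
    have "(\<integral>\<^sup>+x. indicator A x \<partial>intensity M \<mu>) = (\<integral>\<^sup>+\<gamma>. emeasure \<gamma> A \<partial>\<mu>)"
      using set emeasure_intensity[OF localizing_ring space_UNIV sets_mu set] by (simp add: sets_int)
    also have "\<dots> = (\<integral>\<^sup>+\<gamma>. \<integral>\<^sup>+x. indicator A x \<partial>\<gamma> \<partial>\<mu>)"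
      using set sets_config by (intro nn_integral_cong) simp
    finally show ?case .
  next
    case (mult u c)
    have "(\<integral>\<^sup>+\<gamma>. \<integral>\<^sup>+x. c * u x \<partial>\<gamma> \<partial>\<mu>) = (\<integral>\<^sup>+\<gamma>. c * (\<integral>\<^sup>+x. u x \<partial>\<gamma>) \<partial>\<mu>)"
      by (intro nn_integral_cong nn_integral_cmult measurable_config[OF _ mult(2)])
    also have "\<dots> = c * (\<integral>\<^sup>+\<gamma>. \<integral>\<^sup>+x. u x \<partial>\<gamma> \<partial>\<mu>)"
      by (intro nn_integral_cmult measurable_nn_integral mult(2))
    finally show ?case using mult by (simp add: nn_integral_cmult)
  next
    case (add u v)
    have "(\<integral>\<^sup>+\<gamma>. \<integral>\<^sup>+x. v x + u x \<partial>\<gamma> \<partial>\<mu>) = (\<integral>\<^sup>+\<gamma>. (\<integral>\<^sup>+x. v x \<partial>\<gamma>) + (\<integral>\<^sup>+x. u x \<partial>\<gamma>) \<partial>\<mu>)"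
      by (intro nn_integral_cong nn_integral_add measurable_config[OF _ add.hyps(1)] measurable_config[OF _ add.hyps(3)])
    also have "\<dots> = (\<integral>\<^sup>+\<gamma>. \<integral>\<^sup>+x. v x \<partial>\<gamma> \<partial>\<mu>) + (\<integral>\<^sup>+\<gamma>. \<integral>\<^sup>+x. u x \<partial>\<gamma> \<partial>\<mu>)"
      by (intro nn_integral_add measurable_nn_integral add.hyps(1,3))
    finally show ?case using add by (simp add: nn_integral_add)
  next
    case (seq U)
    have inc: "incseq (\<lambda>i. U i x)" for x using seq(3) by (auto simp: incseq_def le_fun_def)
    have "(\<integral>\<^sup>+\<gamma>. \<integral>\<^sup>+x. (SUP i. U i x) \<partial>\<gamma> \<partial>\<mu>) = (\<integral>\<^sup>+\<gamma>. (SUP i. \<integral>\<^sup>+x. U i x \<partial>\<gamma>) \<partial>\<mu>)"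
      by (intro nn_integral_cong nn_integral_monotone_convergence_SUP measurable_config[OF _ seq(1)] seq(3))
    also have "\<dots> = (SUP i. \<integral>\<^sup>+\<gamma>. \<integral>\<^sup>+x. U i x \<partial>\<gamma> \<partial>\<mu>)"
      using seq(3) by (intro nn_integral_monotone_convergence_SUP measurable_nn_integral seq(1))
        (auto simp: incseq_def le_fun_def intro!: nn_integral_mono)
    also have "\<dots> = (SUP i. \<integral>\<^sup>+x. U i x \<partial>intensity M \<mu>)" using seq.IH by simp
    also have "\<dots> = (\<integral>\<^sup>+x. (SUP i. U i x) \<partial>intensity M \<mu>)"
      using seq(1) by (intro nn_integral_monotone_convergence_SUP[symmetric] seq(3)) measurable
    finally show ?case unfolding SUP_apply by simp
  qed
qed

text \<open>Both follow from integrability of \<open>w\<close> with respect to the intensity, the second one by the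
  Georgii-Nguyen-Zessin identity.\<close>

lemma AE_weight_finite:
  shows "AE \<gamma> in \<mu>. (\<integral>\<^sup>+x. ennreal (w x) \<partial>\<gamma>) \<noteq> \<infinity>"
    and "AE \<gamma> in \<mu>. (\<integral>\<^sup>+x. ennreal (w x) \<partial>m \<gamma>) \<noteq> \<infinity>"
proof -
  note [measurable] = w_measurable
  have "(\<integral>\<^sup>+x. ennreal (norm (w x)) \<partial>intensity M \<mu>) < \<infinity>"
    using w_integrable unfolding integrable_iff_bounded by blast
  then have fin: "(\<integral>\<^sup>+\<gamma>. \<integral>\<^sup>+x. ennreal (w x) \<partial>\<gamma> \<partial>\<mu>) \<noteq> \<infinity>"
    using nn_integral_intensity[of "\<lambda>x. ennreal (w x)"] less_imp_le[OF w_pos] by simp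
  then show "AE \<gamma> in \<mu>. (\<integral>\<^sup>+x. ennreal (w x) \<partial>\<gamma>) \<noteq> \<infinity>"
    by (intro nn_integral_PInf_AE measurable_nn_integral) measurable
  have "(\<integral>\<^sup>+\<gamma>. \<integral>\<^sup>+x. ennreal (w x) \<partial>m \<gamma> \<partial>\<mu>) = (\<integral>\<^sup>+\<gamma>. \<integral>\<^sup>+x. ennreal (w x) \<partial>\<gamma> \<partial>\<mu>)"
    using GNZ_product[of "\<lambda>_. 1" w] by simp
  then show "AE \<gamma> in \<mu>. (\<integral>\<^sup>+x. ennreal (w x) \<partial>m \<gamma>) \<noteq> \<infinity>"
    using fin measurable_nn_integral_m[of "\<lambda>p. ennreal (w (snd p))"] by (intro nn_integral_PInf_AE) simp_all
qed

end


lemma fast_subsequence: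
  fixes P :: "nat \<Rightarrow> nat \<Rightarrow> bool"
  assumes "\<And>k. \<exists>N. \<forall>i\<ge>N. P k i"
  shows "\<exists>\<sigma> :: nat \<Rightarrow> nat. strict_mono \<sigma> \<and> (\<forall>k. \<forall>i\<ge>\<sigma> k. P k i)"
proof -
  obtain N where N: "\<forall>k. \<forall>i\<ge>N k. P k i" using assms by metis
  define \<sigma> where "\<sigma> k = k + (\<Sum>i\<le>k. N i)" for k
  have "strict_mono \<sigma>" unfolding strict_mono_Suc_iff \<sigma>_def by simp
  moreover have "N k \<le> \<sigma> k" for k
    unfolding \<sigma>_def using member_le_sum[of k "{..k}" N] by simp
  ultimately show ?thesis using N order_trans by blast
qed

context GNZ_configs begin

lemma energy_nn:
  assumes L: "strong_lifting M L" and r: "r \<in> cyl_data D"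
  shows "(\<integral>\<^sup>+\<gamma>. en \<gamma> (increment (cyl_fun r) \<gamma>) \<partial>\<mu>) = ennreal (energy (cyl_fun r) (cyl_fun r))"
proof -
  have "(\<integral>\<^sup>+\<gamma>. en \<gamma> (increment (cyl_fun r) \<gamma>) \<partial>\<mu>) =
      (\<integral>\<^sup>+\<gamma>. ennreal (\<integral>x. \<Gamma> (increment (cyl_fun r) \<gamma>) (increment (cyl_fun r) \<gamma>) x \<partial>m \<gamma>) \<partial>\<mu>)"
  proof (rule nn_integral_cong_AE)
    show "AE \<gamma> in \<mu>. en \<gamma> (increment (cyl_fun r) \<gamma>) =
        ennreal (\<integral>x. \<Gamma> (increment (cyl_fun r) \<gamma>) (increment (cyl_fun r) \<gamma>) x \<partial>m \<gamma>)"
      using AE_good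
    proof eventually_elim
      case (elim \<gamma>)
      show ?case by (rule en_eq[OF elim increment_in_D[OF r good_space[OF elim]]])
    qed
  qed
  also have "\<dots> = ennreal (energy (cyl_fun r) (cyl_fun r))"
    unfolding energy_def
    by (rule nn_integral_eq_integral[OF cyl_Gamma_energy(2)[OF L r r]])
      (rule AE_I2, rule fibre_nonneg, assumption, rule increment_in_D[OF r])
  finally show ?thesis .
qed

lemma en_measurable:
  assumes r: "r \<in> cyl_data D"
  shows "(\<lambda>\<gamma>. en \<gamma> (increment (cyl_fun r) \<gamma>)) \<in> borel_measurable \<mu>"
  unfolding en_def by (rule energy_density_measurable(2)[OF r r])

text \<open>Convergence in \<open>L\<^sup>2(\<mu>)\<close>, fast enough, passes to the increments on almost every fibre.  The
  Georgii-Nguyen-Zessin identity is applied with the additional factor \<open>1 / (1 + \<gamma>(w))\<close>, which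
  compensates \<open>\<gamma>(w)\<close> and is bounded below along \<open>\<gamma> + \<delta>\<^sub>x\<close> for fixed \<open>\<gamma>\<close>.\<close>

lemma AE_increment_tendsto_0:
  assumes c: "\<And>k. r k \<in> cyl_data D"
    and fast: "\<And>k. (\<integral>\<^sup>+\<gamma>. ennreal ((cyl_fun (r k) \<gamma>)\<^sup>2) \<partial>\<mu>) \<le> ennreal (1 / 2 ^ k)"
  shows "AE \<gamma> in \<mu>. (\<lambda>k. \<integral>\<^sup>+x. ennreal ((increment (cyl_fun (r k)) \<gamma> x)\<^sup>2) * ennreal (w x) \<partial>m \<gamma>) \<longlonglongrightarrow> 0"
proof -
  define u where "u k = cyl_fun (r k)" for k
  have u[measurable]: "u k \<in> borel_measurable \<mu>" for k unfolding u_def by (rule cyl_fun_measurable[OF c])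
  have w0: "0 \<le> w x" for x using w_pos[of x] by simp
  define W where "W \<gamma> = (\<integral>x. w x \<partial>\<gamma>)" for \<gamma> :: "'a measure"
  have W[measurable]: "W \<in> borel_measurable \<mu>" unfolding W_def by (rule measurable_integral[OF w_measurable])
  have W0: "0 \<le> W \<gamma>" for \<gamma> unfolding W_def using w0 by (simp add: integral_nonneg_AE)
  define \<phi> where "\<phi> \<gamma> = 1 / (1 + W \<gamma>)" for \<gamma>
  have \<phi>[measurable]: "\<phi> \<in> borel_measurable \<mu>" unfolding \<phi>_def by measurable
  have \<phi>0: "0 \<le> \<phi> \<gamma>" for \<gamma> unfolding \<phi>_def using W0[of \<gamma>] by simp
  have W_eq: "(\<integral>\<^sup>+x. ennreal (w x) \<partial>\<gamma>) = ennreal (W \<gamma>) \<and> integrable \<gamma> w"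
    if "\<gamma> \<in> space \<mu>" "(\<integral>\<^sup>+x. ennreal (w x) \<partial>\<gamma>) \<noteq> \<infinity>" for \<gamma>
  proof -
    have "integrable \<gamma> w"
      using that measurable_config[OF that(1) w_measurable] w0
      by (simp add: integrable_iff_bounded less_top)
    then show ?thesis unfolding W_def using w0 by (simp add: nn_integral_eq_integral)
  qed
  have "(\<Sum>k. \<integral>\<^sup>+\<gamma>. ennreal ((u k \<gamma>)\<^sup>2) \<partial>\<mu>) < \<infinity>"
    by (rule suminf_ennreal_geometric_finite) (use fast in \<open>simp add: u_def\<close>)
  then have pointwise: "AE \<gamma> in \<mu>. (\<lambda>k. ennreal ((u k \<gamma>)\<^sup>2)) \<longlonglongrightarrow> 0"
    by (intro AE_tendsto_0_if_summable(2)) measurable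
  let ?S = "\<lambda>k \<gamma>. \<integral>\<^sup>+x. ennreal ((u k (add_point \<gamma> x))\<^sup>2 * \<phi> (add_point \<gamma> x)) * ennreal (w x) \<partial>m \<gamma>"
  have S_meas: "?S k \<in> borel_measurable \<mu>" for k
  proof -
    note [measurable] = measurable_add_point_comp[OF u[of k]] measurable_add_point_comp[OF \<phi>] w_measurable
    show ?thesis
      using measurable_nn_integral_m[of "\<lambda>p. ennreal ((u k (add_point (fst p) (snd p)))\<^sup>2
        * \<phi> (add_point (fst p) (snd p))) * ennreal (w (snd p))"] by simp
  qed
  have S_le: "(\<integral>\<^sup>+\<gamma>. ?S k \<gamma> \<partial>\<mu>) \<le> ennreal (1 / 2 ^ k)" for k
  proof -
    have "(\<integral>\<^sup>+\<gamma>. ?S k \<gamma> \<partial>\<mu>) = (\<integral>\<^sup>+\<gamma>. ennreal ((u k \<gamma>)\<^sup>2 * \<phi> \<gamma>) * (\<integral>\<^sup>+x. ennreal (w x) \<partial>\<gamma>) \<partial>\<mu>)"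
      by (rule GNZ_product[symmetric, OF _ w_measurable]) measurable
    also have "\<dots> \<le> (\<integral>\<^sup>+\<gamma>. ennreal ((u k \<gamma>)\<^sup>2) \<partial>\<mu>)"
    proof (rule nn_integral_mono_AE)
      show "AE \<gamma> in \<mu>. ennreal ((u k \<gamma>)\<^sup>2 * \<phi> \<gamma>) * (\<integral>\<^sup>+x. ennreal (w x) \<partial>\<gamma>) \<le> ennreal ((u k \<gamma>)\<^sup>2)"
        using AE_weight_finite(1) AE_space[of \<mu>]
      proof eventually_elim
        case (elim \<gamma>)
        have "\<phi> \<gamma> * W \<gamma> \<le> 1" unfolding \<phi>_def using W0[of \<gamma>] by simp
        then have "(u k \<gamma>)\<^sup>2 * (\<phi> \<gamma> * W \<gamma>) \<le> (u k \<gamma>)\<^sup>2" by (intro mult_left_le) simp_all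
        then have "ennreal ((u k \<gamma>)\<^sup>2 * \<phi> \<gamma> * W \<gamma>) \<le> ennreal ((u k \<gamma>)\<^sup>2)"
          by (intro ennreal_leI) (simp add: mult.assoc)
        then show ?case using W_eq[OF elim(2,1)] \<phi>0[of \<gamma>] W0[of \<gamma>] by (simp add: ennreal_mult)
      qed
    qed
    also have "\<dots> \<le> ennreal (1 / 2 ^ k)" using fast[of k] unfolding u_def .
    finally show ?thesis .
  qed
  have shifted: "AE \<gamma> in \<mu>. (\<lambda>k. ?S k \<gamma>) \<longlonglongrightarrow> 0"
    by (rule AE_tendsto_0_if_summable(2)[OF S_meas suminf_ennreal_geometric_finite[OF S_le]])
  show ?thesis
    using pointwise shifted AE_weight_finite AE_space[of \<mu>]
  proof eventually_elim
    case (elim \<gamma>)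
    note \<gamma> = elim(5)
    have wm[measurable]: "w \<in> borel_measurable (m \<gamma>)" using w_measurable by measurable
    have um[measurable]: "(\<lambda>x. u k (add_point \<gamma> x)) \<in> borel_measurable (m \<gamma>)" for k
      using section_measurable[OF measurable_add_point_comp[OF u[of k]] \<gamma>] by simp
    have \<phi>m[measurable]: "(\<lambda>x. \<phi> (add_point \<gamma> x)) \<in> borel_measurable (m \<gamma>)"
      using section_measurable[OF measurable_add_point_comp[OF \<phi>] \<gamma>] by simp
    have \<phi>_ge: "1 \<le> (2 + W \<gamma>) * \<phi> (add_point \<gamma> x)" for x
    proof -
      have "W (add_point \<gamma> x) = W \<gamma> + w x"
        unfolding W_def using W_eq[OF \<gamma> elim(3)] space_config[OF \<gamma>] by (simp add: integral_add_point)
      then show ?thesis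
        unfolding \<phi>_def using W0[of \<gamma>] w_pos[of x] w_le_1[of x] by simp
    qed
    let ?Z = "\<integral>\<^sup>+x. ennreal (w x) \<partial>m \<gamma>"
    have le: "(\<integral>\<^sup>+x. ennreal ((increment (u k) \<gamma> x)\<^sup>2) * ennreal (w x) \<partial>m \<gamma>) \<le>
        ennreal (2 * (2 + W \<gamma>)) * ?S k \<gamma> + 2 * ?Z * ennreal ((u k \<gamma>)\<^sup>2)" for k
    proof -
      have "ennreal ((increment (u k) \<gamma> x)\<^sup>2) * ennreal (w x) \<le>
          ennreal (2 * (2 + W \<gamma>)) * (ennreal ((u k (add_point \<gamma> x))\<^sup>2 * \<phi> (add_point \<gamma> x)) * ennreal (w x))
          + ennreal (2 * (u k \<gamma>)\<^sup>2) * ennreal (w x)" for x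
      proof -
        let ?a = "(u k (add_point \<gamma> x))\<^sup>2"
        have "(increment (u k) \<gamma> x)\<^sup>2 \<le> 2 * ?a + 2 * (u k \<gamma>)\<^sup>2"
          unfolding increment_def using square_sum_le[of "u k (add_point \<gamma> x)" "- u k \<gamma>"] by simp
        also have "?a \<le> ?a * ((2 + W \<gamma>) * \<phi> (add_point \<gamma> x))"
          using mult_left_mono[OF \<phi>_ge[of x], of ?a] by simp
        finally have "(increment (u k) \<gamma> x)\<^sup>2 * w x \<le>
            (2 * (?a * ((2 + W \<gamma>) * \<phi> (add_point \<gamma> x))) + 2 * (u k \<gamma>)\<^sup>2) * w x"
          using w0[of x] by (intro mult_right_mono) auto
        also have "\<dots> = 2 * (2 + W \<gamma>) * (?a * \<phi> (add_point \<gamma> x) * w x) + 2 * (u k \<gamma>)\<^sup>2 * w x"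
          by (simp add: algebra_simps)
        finally have "ennreal ((increment (u k) \<gamma> x)\<^sup>2 * w x) \<le>
            ennreal (2 * (2 + W \<gamma>) * (?a * \<phi> (add_point \<gamma> x) * w x) + 2 * (u k \<gamma>)\<^sup>2 * w x)"
          by (rule ennreal_leI)
        also have "\<dots> = ennreal (2 * (2 + W \<gamma>) * (?a * \<phi> (add_point \<gamma> x) * w x)) + ennreal (2 * (u k \<gamma>)\<^sup>2 * w x)"
          using W0[of \<gamma>] w0[of x] \<phi>0 by (intro ennreal_plus) auto
        also have "ennreal (2 * (2 + W \<gamma>) * (?a * \<phi> (add_point \<gamma> x) * w x)) =
            ennreal (2 * (2 + W \<gamma>)) * (ennreal (?a * \<phi> (add_point \<gamma> x)) * ennreal (w x))"
          using W0[of \<gamma>] w0[of x] \<phi>0 by (subst ennreal_mult) (auto simp: ennreal_mult)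
        also have "ennreal (2 * (u k \<gamma>)\<^sup>2 * w x) = ennreal (2 * (u k \<gamma>)\<^sup>2) * ennreal (w x)"
          using w0[of x] by (intro ennreal_mult) auto
        also have "ennreal ((increment (u k) \<gamma> x)\<^sup>2 * w x) = ennreal ((increment (u k) \<gamma> x)\<^sup>2) * ennreal (w x)"
          using w0[of x] by (intro ennreal_mult) auto
        finally show ?thesis .
      qed
      then have "(\<integral>\<^sup>+x. ennreal ((increment (u k) \<gamma> x)\<^sup>2) * ennreal (w x) \<partial>m \<gamma>) \<le>
          (\<integral>\<^sup>+x. ennreal (2 * (2 + W \<gamma>)) * (ennreal ((u k (add_point \<gamma> x))\<^sup>2 * \<phi> (add_point \<gamma> x)) * ennreal (w x))
          + ennreal (2 * (u k \<gamma>)\<^sup>2) * ennreal (w x) \<partial>m \<gamma>)"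
        by (intro nn_integral_mono) blast
      also have "\<dots> = ennreal (2 * (2 + W \<gamma>)) * ?S k \<gamma> + ennreal (2 * (u k \<gamma>)\<^sup>2) * ?Z"
        by (simp add: nn_integral_add nn_integral_cmult)
      also have "ennreal (2 * (u k \<gamma>)\<^sup>2) * ?Z = 2 * ?Z * ennreal ((u k \<gamma>)\<^sup>2)"
        by (simp add: ennreal_mult' ac_simps)
      finally show ?thesis .
    qed
    have "(\<lambda>k. ennreal (2 * (2 + W \<gamma>)) * ?S k \<gamma> + 2 * ?Z * ennreal ((u k \<gamma>)\<^sup>2)) \<longlonglongrightarrow>
        ennreal (2 * (2 + W \<gamma>)) * 0 + 2 * ?Z * 0"
      using elim(4) by (intro tendsto_add ennreal_tendsto_cmult elim(1,2)) (simp_all add: less_top ennreal_mult_less_top)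
    then have "(\<lambda>k. ennreal (2 * (2 + W \<gamma>)) * ?S k \<gamma> + 2 * ?Z * ennreal ((u k \<gamma>)\<^sup>2)) \<longlonglongrightarrow> 0"
      by simp
    with le have "(\<lambda>k. \<integral>\<^sup>+x. ennreal ((increment (u k) \<gamma> x)\<^sup>2) * ennreal (w x) \<partial>m \<gamma>) \<longlonglongrightarrow> 0"
      by (rule tendsto_0_le_ennreal)
    then show ?case unfolding u_def .
  qed
qed

text \<open>Closability on presentations; \<open>d i j\<close> presents the difference of the \<open>i\<close>-th and the \<open>j\<close>-th
  function.\<close>

theorem energy_closable:
  assumes L: "strong_lifting M L" and r: "\<And>n. r n \<in> cyl_data D"
    and d: "\<And>i j. d i j \<in> cyl_data D" "\<And>i j. cyl_fun (d i j) = (\<lambda>\<gamma>. cyl_fun (r i) \<gamma> - cyl_fun (r j) \<gamma>)"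
    and Cauchy: "\<And>e. 0 < e \<Longrightarrow> \<exists>N. \<forall>i\<ge>N. \<forall>j\<ge>N. energy (cyl_fun (d i j)) (cyl_fun (d i j)) < e"
    and L2: "(\<lambda>n. \<integral>\<^sup>+\<gamma>. ennreal ((cyl_fun (r n) \<gamma>)\<^sup>2) \<partial>\<mu>) \<longlonglongrightarrow> 0"
  shows "(\<lambda>n. energy (cyl_fun (r n)) (cyl_fun (r n))) \<longlonglongrightarrow> 0"
proof -
  let ?E = "\<lambda>i j. energy (cyl_fun (d i j)) (cyl_fun (d i j))"
  \<comment> \<open>The rate \<open>8\<^sup>-\<^sup>k\<close> leaves energies \<open>O(4\<^sup>-\<^sup>k)\<close> on almost every fibre, as needed for \<open>fibre_liminf\<close>.\<close>
  let ?P = "\<lambda>k i. (\<forall>j\<ge>i. ?E j i < 1 / 8 ^ k) \<and> (\<integral>\<^sup>+\<gamma>. ennreal ((cyl_fun (r i) \<gamma>)\<^sup>2) \<partial>\<mu>) < ennreal (1 / 2 ^ k)"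
  have "\<exists>N. \<forall>i\<ge>N. ?P k i" for k
  proof -
    obtain N1 where N1: "\<forall>i\<ge>N1. \<forall>j\<ge>N1. ?E i j < 1 / 8 ^ k" using Cauchy[of "1 / 8 ^ k"] by auto
    have "\<forall>\<^sub>F n in sequentially. (\<integral>\<^sup>+\<gamma>. ennreal ((cyl_fun (r n) \<gamma>)\<^sup>2) \<partial>\<mu>) < ennreal (1 / 2 ^ k)"
      using L2 by (rule order_tendstoD) simp
    then obtain N2 where N2: "\<forall>n\<ge>N2. (\<integral>\<^sup>+\<gamma>. ennreal ((cyl_fun (r n) \<gamma>)\<^sup>2) \<partial>\<mu>) < ennreal (1 / 2 ^ k)"
      unfolding eventually_sequentially by blast
    show ?thesis
    proof (intro exI[of _ "max N1 N2"] allI impI conjI)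
      fix i assume i: "max N1 N2 \<le> i"
      show "?E j i < 1 / 8 ^ k" if "i \<le> j" for j using N1 i that by simp
      show "(\<integral>\<^sup>+\<gamma>. ennreal ((cyl_fun (r i) \<gamma>)\<^sup>2) \<partial>\<mu>) < ennreal (1 / 2 ^ k)" using N2 i by simp
    qed
  qed
  from fast_subsequence[of ?P, OF this] obtain \<sigma> where \<sigma>: "strict_mono \<sigma>" "\<forall>k. \<forall>i\<ge>\<sigma> k. ?P k i"
    by blast
  have fast_L2: "(\<integral>\<^sup>+\<gamma>. ennreal ((cyl_fun (r (\<sigma> k)) \<gamma>)\<^sup>2) \<partial>\<mu>) \<le> ennreal (1 / 2 ^ k)" for k
    using \<sigma>(2) by (simp add: less_imp_le)
  have fast_E: "?E (\<sigma> (Suc k)) (\<sigma> k) \<le> 1 / 8 ^ k" for k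
    using \<sigma>(2)[rule_format, of k "\<sigma> k"] strict_monoD[OF \<sigma>(1), of k "Suc k"] by (simp add: less_imp_le)
  let ?V = "\<lambda>k \<gamma>. ennreal (4 ^ k) * en \<gamma> (increment (cyl_fun (d (\<sigma> (Suc k)) (\<sigma> k))) \<gamma>)"
  have "(\<integral>\<^sup>+\<gamma>. ?V k \<gamma> \<partial>\<mu>) \<le> ennreal (1 / 2 ^ k)" for k
  proof -
    have "(\<integral>\<^sup>+\<gamma>. ?V k \<gamma> \<partial>\<mu>) = ennreal (4 ^ k) * ennreal (?E (\<sigma> (Suc k)) (\<sigma> k))"
      using nn_integral_cmult[OF en_measurable[OF d(1)]] energy_nn[OF L d(1)] by simp
    also have "\<dots> = ennreal (4 ^ k * ?E (\<sigma> (Suc k)) (\<sigma> k))"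
      by (rule ennreal_mult'[symmetric]) simp
    also have "\<dots> \<le> ennreal (4 ^ k * (1 / 8 ^ k))"
      using fast_E by (intro ennreal_leI mult_left_mono) auto
    also have "4 ^ k * (1 / 8 ^ k) = (1 / 2 ^ k :: real)"
      using power_divide[of "4::real" 8 k] power_one_over[of "2::real" k] by simp
    finally show ?thesis .
  qed
  then have step: "AE \<gamma> in \<mu>. (\<Sum>k. ?V k \<gamma>) \<noteq> \<infinity>"
    by (intro AE_tendsto_0_if_summable(1) suminf_ennreal_geometric_finite) (use en_measurable[OF d(1)] in measurable)
  have inc_d: "increment (cyl_fun (d i j)) \<gamma> = (\<lambda>x. increment (cyl_fun (r i)) \<gamma> x - increment (cyl_fun (r j)) \<gamma> x)" for i j \<gamma>
    unfolding d(2) increment_def by auto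
  have fibre: "AE \<gamma> in \<mu>. en \<gamma> (increment (cyl_fun (r n)) \<gamma>) \<le>
      liminf (\<lambda>k. 2 * en \<gamma> (increment (cyl_fun (d n (\<sigma> k))) \<gamma>))" for n
    using AE_good closable step AE_increment_tendsto_0[of "\<lambda>k. r (\<sigma> k)", OF r fast_L2]
  proof eventually_elim
    case (elim \<gamma>)
    note sp = good_space[OF elim(1)]
    define C where "C = enn2real (\<Sum>k. ?V k \<gamma>)"
    show ?case
      unfolding inc_d
    proof (rule fibre_liminf[OF elim(1,2), of "\<lambda>k. increment (cyl_fun (r (\<sigma> k))) \<gamma>" C])
      fix k
      show "increment (cyl_fun (r (\<sigma> k))) \<gamma> \<in> D" by (rule increment_in_D[OF r sp])
      have "?V k \<gamma> \<le> (\<Sum>k. ?V k \<gamma>)"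
        using sum_le_suminf[OF summableI, of "{k}" "\<lambda>k. ?V k \<gamma>"] by simp
      also have "\<dots> = ennreal C" unfolding C_def using elim(3) by (simp add: less_top)
      finally have "ennreal (1 / 4 ^ k) * ?V k \<gamma> \<le> ennreal (1 / 4 ^ k) * ennreal C"
        by (rule mult_left_mono) simp
      moreover have "ennreal (1 / 4 ^ k) * ?V k \<gamma> = en \<gamma> (increment (cyl_fun (d (\<sigma> (Suc k)) (\<sigma> k))) \<gamma>)"
        by (simp add: mult.assoc[symmetric] ennreal_mult'[symmetric])
      moreover have "ennreal (1 / 4 ^ k) * ennreal C = ennreal (C / 4 ^ k)"
        by (simp add: ennreal_mult'[symmetric])
      ultimately show "en \<gamma> (\<lambda>x. increment (cyl_fun (r (\<sigma> (Suc k)))) \<gamma> x - increment (cyl_fun (r (\<sigma> k))) \<gamma> x)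
          \<le> ennreal (C / 4 ^ k)"
        unfolding inc_d by simp
    next
      show "0 \<le> C" unfolding C_def by simp
      show "increment (cyl_fun (r n)) \<gamma> \<in> D" by (rule increment_in_D[OF r sp])
    qed (rule elim(4))
  qed
  have bound: "energy (cyl_fun (r n)) (cyl_fun (r n)) \<le> 2 * e"
    if e: "0 < e" and N: "\<forall>i\<ge>N. \<forall>j\<ge>N. ?E i j < e" and n: "N \<le> n" for n N e
  proof -
    have "ennreal (energy (cyl_fun (r n)) (cyl_fun (r n))) = (\<integral>\<^sup>+\<gamma>. en \<gamma> (increment (cyl_fun (r n)) \<gamma>) \<partial>\<mu>)"
      by (rule energy_nn[OF L r, symmetric])
    also have "\<dots> \<le> (\<integral>\<^sup>+\<gamma>. liminf (\<lambda>k. 2 * en \<gamma> (increment (cyl_fun (d n (\<sigma> k))) \<gamma>)) \<partial>\<mu>)"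
      by (rule nn_integral_mono_AE[OF fibre])
    also have "\<dots> \<le> liminf (\<lambda>k. \<integral>\<^sup>+\<gamma>. 2 * en \<gamma> (increment (cyl_fun (d n (\<sigma> k))) \<gamma>) \<partial>\<mu>)"
      by (rule nn_integral_liminf) (use en_measurable[OF d(1)] in measurable)
    also have "\<dots> \<le> liminf (\<lambda>k::nat. ennreal (2 * e))"
    proof (rule Liminf_mono)
      have "(\<integral>\<^sup>+\<gamma>. 2 * en \<gamma> (increment (cyl_fun (d n (\<sigma> k))) \<gamma>) \<partial>\<mu>) \<le> ennreal (2 * e)" if "N \<le> k" for k
      proof -
        have "N \<le> \<sigma> k" using that seq_suble[OF \<sigma>(1), of k] by simp
        then have lt: "?E n (\<sigma> k) < e" using N n by blast
        have "(\<integral>\<^sup>+\<gamma>. 2 * en \<gamma> (increment (cyl_fun (d n (\<sigma> k))) \<gamma>) \<partial>\<mu>) = 2 * ennreal (?E n (\<sigma> k))"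
          using nn_integral_cmult[OF en_measurable[OF d(1)]] energy_nn[OF L d(1)] by simp
        also have "\<dots> = ennreal (2 * ?E n (\<sigma> k))" by (simp add: ennreal_mult')
        also have "\<dots> \<le> ennreal (2 * e)" using lt by (intro ennreal_leI) simp
        finally show ?thesis .
      qed
      then show "\<forall>\<^sub>F k in sequentially. (\<integral>\<^sup>+\<gamma>. 2 * en \<gamma> (increment (cyl_fun (d n (\<sigma> k))) \<gamma>) \<partial>\<mu>) \<le> ennreal (2 * e)"
        unfolding eventually_sequentially by blast
    qed
    also have "\<dots> = ennreal (2 * e)" by (simp add: Liminf_const)
    finally show ?thesis using e by simp
  qed
  show ?thesis
  proof (rule LIMSEQ_I)
    fix e :: real assume e: "0 < e"
    obtain N where N: "\<forall>i\<ge>N. \<forall>j\<ge>N. ?E i j < e / 3" using Cauchy[of "e / 3"] e by auto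
    have "norm (energy (cyl_fun (r n)) (cyl_fun (r n)) - 0) < e" if "N \<le> n" for n
      using bound[OF _ N that] energy_nonneg[OF r[of n]] e by simp
    then show "\<exists>N. \<forall>n\<ge>N. norm (energy (cyl_fun (r n)) (cyl_fun (r n)) - 0) < e" by blast
  qed
qed

end


section \<open>Density of the cylinder functions\<close>

context GNZ_configs begin

text \<open>A continuous image of a second countable space is hereditarily Lindelof.\<close>

lemma countable_subcover:
  assumes op: "\<And>U. U \<in> \<U> \<Longrightarrow> open (U :: 'a set)"
  shows "\<exists>\<V>. countable \<V> \<and> \<V> \<subseteq> \<U> \<and> \<Union>\<V> = \<Union>\<U>"
proof -
  obtain P :: "'a topology" and f where sc: "second_countable P"
    and cont: "continuous_map P euclidean f" and bij: "bij_betw f (topspace P) (UNIV :: 'a set)"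
    using Luzin unfolding Luzin_space_def by auto
  obtain \<B> where \<B>: "countable \<B>"
    and base: "\<forall>U x. openin P U \<and> x \<in> U \<longrightarrow> (\<exists>V\<in>\<B>. x \<in> V \<and> V \<subseteq> U)"
    using sc unfolding second_countable_def by blast
  define \<B>' where "\<B>' = {V \<in> \<B>. \<exists>U\<in>\<U>. f ` V \<subseteq> U}"
  have "\<forall>V\<in>\<B>'. \<exists>U. U \<in> \<U> \<and> f ` V \<subseteq> U" unfolding \<B>'_def by blast
  from bchoice[OF this] obtain c where c: "\<forall>V\<in>\<B>'. c V \<in> \<U> \<and> f ` V \<subseteq> c V" by blast
  have "countable \<B>'" unfolding \<B>'_def by (rule countable_subset[OF _ \<B>]) blast
  moreover have "x \<in> \<Union>(c ` \<B>')" if "U \<in> \<U>" "x \<in> U" for x U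
  proof -
    obtain y where y: "y \<in> topspace P" "x = f y"
      using bij unfolding bij_betw_def by blast
    have "openin P {z \<in> topspace P. f z \<in> U}"
      using openin_continuous_map_preimage[OF cont] op[OF that(1)] by auto
    moreover have "y \<in> {z \<in> topspace P. f z \<in> U}" using y that by simp
    ultimately obtain V where V: "V \<in> \<B>" "y \<in> V" "V \<subseteq> {z \<in> topspace P. f z \<in> U}"
      using base by blast
    then have "V \<in> \<B>'" unfolding \<B>'_def using that(1) by blast
    with c V(2) y(2) show ?thesis by blast
  qed
  ultimately show ?thesis using c by (intro exI[of _ "c ` \<B>'"]) blast
qed

lemma open_iff_generated_by_D:
  "open U \<longleftrightarrow> generate_topology_on {f -` V |f V. f \<in> D \<and> open V} U"
  using openin_topology_generated_by_iff[of "{f -` V |f V. f \<in> D \<and> open V}" U]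
  unfolding D_generates open_openin[symmetric] .

lemma D_separates:
  assumes "\<And>f. f \<in> D \<Longrightarrow> f x = f y"
  shows "x = y"
proof (rule ccontr)
  assume "x \<noteq> y"
  then obtain U where U: "open U" "x \<in> U" "y \<notin> U" using t1_space by blast
  from U(1)[unfolded open_iff_generated_by_D] have "x \<in> U \<longleftrightarrow> y \<in> U"
  proof induction
    case (Basis s)
    then obtain f V where "f \<in> D" "s = f -` V" by blast
    then show ?case using assms[of f] by simp
  qed auto
  with U show False by simp
qed

text \<open>The points at which some function in \<open>D\<close> does not vanish.\<close>

definition nonzero_set :: "'a set" where
  "nonzero_set = {x. \<exists>f\<in>D. f x \<noteq> 0}"

text \<open>It may happen that all functions in \<open>D\<close> vanish at some point (if the whole space belongs to the
  localizing ring), but this is at most one point, because \<open>D\<close> separates points, and a null set,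
  because \<open>M\<close> is atomless.\<close>

lemma AE_nonzero_set: "AE x in M. x \<in> nonzero_set"
proof (cases "- nonzero_set = {}")
  case True
  then show ?thesis by auto
next
  case False
  then obtain z where z: "z \<notin> nonzero_set" by blast
  have "x = z" if "x \<notin> nonzero_set" for x
    using that z unfolding nonzero_set_def by (intro D_separates) auto
  moreover have "emeasure M {z} = 0"
  proof (rule ccontr)
    assume "emeasure M {z} \<noteq> 0"
    then have "emeasure M {z} > 0" by (simp add: zero_less_iff_neq_zero)
    then obtain B where "B \<subseteq> {z}" "0 < emeasure M B" "emeasure M B < emeasure M {z}"
      using atomless singletons[of z] unfolding atomless_def by blast
    then show False by (cases "B = {}") (auto dest: subset_singletonD)
  qed
  then have "{z} \<in> null_sets M" using singletons[of z] by blast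
  from AE_not_in[OF this] show ?thesis
    by eventually_elim (use calculation in auto)
qed

lemma D_borel: "f \<in> D \<Longrightarrow> f \<in> borel_measurable borel"
  using D_subset unfolding C0_funs_def by (auto intro: borel_measurable_continuous_onI)

lemma nonzero_sequence:
  shows "\<exists>f :: nat \<Rightarrow> 'a \<Rightarrow> real. (\<forall>n. f n \<in> D) \<and> (\<Union>n. {x. f n x \<noteq> 0}) = nonzero_set"
proof -
  let ?U = "(\<lambda>f. {x. f x \<noteq> 0}) ` D"
  have "open U" if U: "U \<in> ?U" for U
  proof -
    obtain f where f: "f \<in> D" "U = {x. f x \<noteq> 0}" using U by blast
    have "continuous_on UNIV f" using f(1) D_subset unfolding C0_funs_def by blast
    then have "open (f -` (- {0}))" by (intro open_vimage) auto
    moreover have "f -` (- {0}) = U" unfolding f(2) by auto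
    ultimately show ?thesis by simp
  qed
  from countable_subcover[of ?U, OF this] obtain \<V> where \<V>: "countable \<V>" "\<V> \<subseteq> ?U" "\<Union>\<V> = \<Union>?U"
    by blast
  then have "\<forall>V\<in>\<V>. \<exists>f. f \<in> D \<and> V = {x. f x \<noteq> 0}" by blast
  from bchoice[OF this] obtain c where c: "\<forall>V\<in>\<V>. c V \<in> D \<and> V = {x. c V x \<noteq> 0}" by blast
  define F where "F = insert (\<lambda>_. 0) (c ` \<V>)"
  have F: "countable F" "F \<noteq> {}" "F \<subseteq> D" unfolding F_def using \<V>(1) c D_zero by auto
  have r: "range (from_nat_into F) = F" by (rule range_from_nat_into[OF F(2,1)])
  have sub: "(\<Union>f\<in>F. {x. f x \<noteq> 0}) = (\<Union>V\<in>\<V>. {x. c V x \<noteq> 0})" unfolding F_def by simp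
  have "(\<Union>n. {x. from_nat_into F n x \<noteq> 0}) = (\<Union>f\<in>range (from_nat_into F). {x. f x \<noteq> 0})"
    by simp
  also have "\<dots> = (\<Union>V\<in>\<V>. {x. c V x \<noteq> 0})" unfolding r by (rule sub)
  also have "\<dots> = (\<Union>V\<in>\<V>. V)"
    by (rule SUP_cong[OF refl]) (rule conjunct2[OF bspec[OF c], symmetric])
  also have "\<dots> = nonzero_set" using \<V>(3) by (auto simp: nonzero_set_def)
  finally have "(\<Union>n. {x. from_nat_into F n x \<noteq> 0}) = nonzero_set" .
  moreover have "from_nat_into F n \<in> D" for n using r F(3) by blast
  ultimately show ?thesis by blast
qed

text \<open>The cylinder functions proper, not only up to null sets.\<close>

definition cyl_algebra :: "('a measure \<Rightarrow> real) set" where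
  "cyl_algebra = cyl_fun ` cyl_data D"

text \<open>The \<open>\<sigma>\<close>-algebra generated by the cylinder functions.\<close>

definition cyl_sigma :: "'a measure measure" where
  "cyl_sigma = sigma (space \<mu>) {u -` {a<..} \<inter> space \<mu> |u a. u \<in> cyl_algebra}"

lemma space_cyl_sigma [simp]: "space cyl_sigma = space \<mu>"
  unfolding cyl_sigma_def by (rule space_measure_of) blast

lemma measurable_cyl_sigma_cong:
  assumes "f \<in> borel_measurable cyl_sigma" "\<And>\<gamma>. \<gamma> \<in> space \<mu> \<Longrightarrow> f \<gamma> = g \<gamma>"
  shows "g \<in> borel_measurable cyl_sigma"
  using assms(1) measurable_cong[of cyl_sigma f g] assms(2) by simp

lemma sets_cyl_sigma: "sets cyl_sigma = sigma_sets (space \<mu>) {u -` {a<..} \<inter> space \<mu> |u a. u \<in> cyl_algebra}"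
  unfolding cyl_sigma_def by (rule sets_measure_of) blast

lemma cyl_algebra_measurable:
  assumes "u \<in> cyl_algebra"
  shows "u \<in> borel_measurable cyl_sigma"
  unfolding borel_measurable_iff_greater
proof
  fix a
  have "{x \<in> space cyl_sigma. a < u x} = u -` {a<..} \<inter> space \<mu>" by auto
  also have "\<dots> \<in> sets cyl_sigma" unfolding sets_cyl_sigma using assms by (intro sigma_sets.Basic) blast
  finally show "{x \<in> space cyl_sigma. a < u x} \<in> sets cyl_sigma" .
qed

text \<open>The functions \<open>n sin (f\<^sup>\<star> / n)\<close> are multiples of cylinder functions and converge to \<open>f\<^sup>\<star>\<close>.\<close>

lemma star_measurable:
  assumes f: "f \<in> D"
  shows "(\<lambda>\<gamma>. \<integral>x. f x \<partial>\<gamma>) \<in> borel_measurable cyl_sigma"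
proof (rule borel_measurable_LIMSEQ_real)
  let ?r = "\<lambda>n. (1, \<lambda>x. sin (1 / real (Suc n) * x 0), \<lambda>_. f)"
  have "?r n \<in> cyl_data D" for n
    unfolding cyl_data_def using f Cb_smooth_sin[of "1 / real (Suc n)"] by simp
  then have "cyl_fun (?r n) \<in> borel_measurable cyl_sigma" for n
    unfolding cyl_algebra_def by (intro cyl_algebra_measurable) (simp add: cyl_algebra_def)
  then have "(\<lambda>\<gamma>. real (Suc n) * cyl_fun (?r n) \<gamma>) \<in> borel_measurable cyl_sigma" for n
    by (intro borel_measurable_times borel_measurable_const)
  then show "(\<lambda>\<gamma>. real (Suc n) * sin (1 / real (Suc n) * (\<integral>x. f x \<partial>\<gamma>))) \<in> borel_measurable cyl_sigma" for n
    by simp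
  have lim: "(\<lambda>n. real (Suc n) * sin (1 / real (Suc n) * t)) \<longlonglongrightarrow> t" for t :: real
  proof -
    have "((\<lambda>h. sin (h * t)) has_real_derivative t) (at 0)"
      by (auto intro!: derivative_eq_intros)
    then have "((\<lambda>h. sin (h * t) / h) \<longlongrightarrow> t) (at 0)" unfolding DERIV_def by simp
    moreover have "filterlim (\<lambda>n. 1 / real (Suc n)) (at 0) sequentially"
      using LIMSEQ_inverse_real_of_nat by (simp add: filterlim_at inverse_eq_divide)
    ultimately have "(\<lambda>n. sin (1 / real (Suc n) * t) / (1 / real (Suc n))) \<longlonglongrightarrow> t"
      by (rule filterlim_compose)
    then show ?thesis by (simp add: mult.commute)
  qed
  show "(\<lambda>n. real (Suc n) * sin (1 / real (Suc n) * (\<integral>x. f x \<partial>\<gamma>))) \<longlonglongrightarrow> (\<integral>x. f x \<partial>\<gamma>)" for \<gamma>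
    by (rule lim)
qed

text \<open>\<open>D\<close> contains no non-zero constants unless the whole space belongs to \<open>\<E>\<close>; adding them gives
  a unital algebra of bounded functions.\<close>

definition D_plus_const :: "('a \<Rightarrow> real) set" where
  "D_plus_const = {\<lambda>x. c + f x |c f. f \<in> D}"

lemma D_plus_constI: "f \<in> D \<Longrightarrow> (\<lambda>x. c + f x) \<in> D_plus_const"
  unfolding D_plus_const_def by blast

lemma D_plus_constE:
  assumes "u \<in> D_plus_const"
  shows "\<exists>c f. f \<in> D \<and> u = (\<lambda>x. c + f x)"
  using assms unfolding D_plus_const_def by blast

text \<open>\<open>D\<close> generates the topology by arbitrary unions, which may be taken countable.\<close>

lemma borel_in_sigma_D:
  assumes "B \<in> sets borel"
  shows "B \<in> sigma_sets UNIV {u -` {a<..} \<inter> UNIV |u a. u \<in> D_plus_const}" (is "_ \<in> sigma_sets UNIV ?G")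
proof -
  define S where "S = sigma (UNIV :: 'a set) ?G"
  have sets_S: "sets S = sigma_sets UNIV ?G" and space_S: "space S = UNIV"
    unfolding S_def by (simp_all add: sets_measure_of space_measure_of)
  have f_meas: "f \<in> borel_measurable S" if f: "f \<in> D" for f
    unfolding borel_measurable_iff_greater
  proof
    fix a
    have "(\<lambda>x. 0 + f x) -` {a<..} \<inter> UNIV \<in> sets S"
      unfolding sets_S using D_plus_constI[OF f, of 0] by (intro sigma_sets.Basic) blast
    moreover have "{x \<in> space S. a < f x} = (\<lambda>x. 0 + f x) -` {a<..} \<inter> UNIV"
      using space_S by auto
    ultimately show "{x \<in> space S. a < f x} \<in> sets S" by simp
  qed
  have op: "U \<in> sets S" if "open U" for U
    using that unfolding open_iff_generated_by_D
  proof induction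
    case Empty
    then show ?case by simp
  next
    case (Int a b)
    then show ?case by simp
  next
    case (UN K)
    have "open k" if "k \<in> K" for k
      unfolding open_iff_generated_by_D by (rule UN.hyps[OF that])
    from countable_subcover[of K, OF this] obtain \<V> where \<V>: "countable \<V>" "\<V> \<subseteq> K" "\<Union>\<V> = \<Union>K" by blast
    have "\<Union>\<V> \<in> sets S" using \<V>(1,2) UN.IH by (intro sets.countable_Union) auto
    then show ?case unfolding \<V>(3) .
  next
    case (Basis s)
    then obtain f V where f: "f \<in> D" "open V" "s = f -` V" by blast
    have "f -` V \<inter> space S \<in> sets S" using f_meas[OF f(1)] f(2) by (intro measurable_sets) auto
    then show ?case unfolding f(3) space_S by simp
  qed
  have "B \<in> sigma_sets UNIV {U. open U}" using assms by (simp add: borel_def)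
  then have "B \<in> sets S"
  proof induction
    case (Compl a)
    then show ?case using sets.compl_sets[of a S] space_S by simp
  qed (auto intro: op)
  then show ?thesis unfolding sets_S .
qed

lemma D_plus_const_mult:
  assumes "u \<in> D_plus_const" "v \<in> D_plus_const"
  shows "(\<lambda>x. u x * v x) \<in> D_plus_const"
proof -
  obtain c f where f: "f \<in> D" "u = (\<lambda>x. c + f x)" using D_plus_constE[OF assms(1)] by blast
  obtain d g where g: "g \<in> D" "v = (\<lambda>x. d + g x)" using D_plus_constE[OF assms(2)] by blast
  have "(\<lambda>x. 1 * (d * f x + c * g x) + 1 * (f x * g x)) \<in> D"
    using D_lin[OF D_lin[OF f(1) g(1), of d c] D_mult[OF f(1) g(1)], of 1 1] .
  from D_plus_constI[OF this, of "c * d"] show ?thesis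
    unfolding f(2) g(2) by (simp add: algebra_simps)
qed

lemma D_plus_const_add:
  assumes "u \<in> D_plus_const" "v \<in> D_plus_const"
  shows "(\<lambda>x. u x + v x) \<in> D_plus_const"
proof -
  obtain c f where f: "f \<in> D" "u = (\<lambda>x. c + f x)" using D_plus_constE[OF assms(1)] by blast
  obtain d g where g: "g \<in> D" "v = (\<lambda>x. d + g x)" using D_plus_constE[OF assms(2)] by blast
  from D_plus_constI[OF D_add[OF f(1) g(1)], of "c + d"] show ?thesis
    unfolding f(2) g(2) by (simp add: algebra_simps)
qed

lemma integrable_mult_D:
  assumes \<gamma>: "\<gamma> \<in> space \<mu>" and h: "h \<in> borel_measurable M" "\<And>x. \<bar>h x\<bar> \<le> C" and f: "f \<in> D"
  shows "integrable \<gamma> (\<lambda>x. h x * f x)"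
proof -
  have "integrable \<gamma> (\<lambda>x. C * f x)" using integrable_D[OF \<gamma> f] by simp
  moreover have "(\<lambda>x. h x * f x) \<in> borel_measurable \<gamma>"
    using measurable_config[OF \<gamma> h(1)] measurable_config[OF \<gamma> D_measurable[OF f]] by measurable
  moreover have "norm (h x * f x) \<le> norm (C * f x)" for x
    using mult_right_mono[OF h(2)[of x], of "\<bar>f x\<bar>"] h(2)[of x] by (simp add: abs_mult)
  then have "AE x in \<gamma>. norm (h x * f x) \<le> norm (C * f x)" by (intro AE_I2)
  ultimately show ?thesis by (rule Bochner_Integration.integrable_bound)
qed

text \<open>For fixed \<open>f\<close> in \<open>D\<close>, the functions \<open>h\<close> such that \<open>\<gamma> \<mapsto> \<gamma>(h f)\<close> is measurable are closed under
  bounded limits, because \<open>f\<close> is integrable with respect to each configuration.\<close>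

lemma star_indicator_measurable:
  assumes B: "B \<in> sets borel" and f: "f \<in> D"
  shows "(\<lambda>\<gamma>. \<integral>x. indicator B x * f x \<partial>\<gamma>) \<in> borel_measurable cyl_sigma"
proof -
  define H where "H = {h. h \<in> borel_measurable M \<and> (\<exists>C. \<forall>x. \<bar>h x\<bar> \<le> C) \<and>
      (\<lambda>\<gamma>. \<integral>x. h x * f x \<partial>\<gamma>) \<in> borel_measurable cyl_sigma}"
  have "indicator B \<in> H"
  proof (rule functional_monotone_class[of D_plus_const UNIV H, OF _ D_plus_const_add D_plus_const_mult _ _ _ _ borel_in_sigma_D[OF B]])
    show "(\<lambda>_. c) \<in> D_plus_const" for c using D_plus_constI[OF D_zero, of c] by simp
    show bdd: "\<exists>C. \<forall>x\<in>UNIV. \<bar>u x\<bar> \<le> C" if u: "u \<in> D_plus_const" for u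
    proof -
      obtain c g where g: "g \<in> D" "u = (\<lambda>x. c + g x)" using D_plus_constE[OF u] by blast
      obtain C where C: "\<forall>x. \<bar>g x\<bar> \<le> C" using D_bounded[OF g(1)] by blast
      have "\<bar>u x\<bar> \<le> \<bar>c\<bar> + C" for x
        unfolding g(2) using abs_triangle_ineq[of c "g x"] C[rule_format, of x] by linarith
      then show ?thesis by blast
    qed
    show "D_plus_const \<subseteq> H"
    proof
      fix u assume u: "u \<in> D_plus_const"
      obtain c g where g: "g \<in> D" "u = (\<lambda>x. c + g x)" using D_plus_constE[OF u] by blast
      have "(\<lambda>x. c * f x + 1 * (g x * f x)) \<in> D" by (rule D_lin[OF f D_mult[OF g(1) f]])
      from star_measurable[OF this]
      have "(\<lambda>\<gamma>. \<integral>x. u x * f x \<partial>\<gamma>) \<in> borel_measurable cyl_sigma" unfolding g(2) by (simp add: algebra_simps)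
      moreover have "u \<in> borel_measurable M" unfolding g(2) using D_measurable[OF g(1)] by measurable
      ultimately show "u \<in> H" unfolding H_def using bdd[OF u] by blast
    qed
    show "(\<lambda>x. a * u x + b * v x) \<in> H" if u: "u \<in> H" and v: "v \<in> H" for u v a b
    proof -
      obtain C where C: "\<forall>x. \<bar>u x\<bar> \<le> C" using u unfolding H_def by blast
      obtain C' where C': "\<forall>x. \<bar>v x\<bar> \<le> C'" using v unfolding H_def by blast
      have um[measurable]: "u \<in> borel_measurable M" and vm[measurable]: "v \<in> borel_measurable M"
        using u v unfolding H_def by blast+
      have "\<bar>a * u x + b * v x\<bar> \<le> \<bar>a\<bar> * C + \<bar>b\<bar> * C'" for x
        using abs_triangle_ineq[of "a * u x" "b * v x"] mult_left_mono[of "\<bar>u x\<bar>" C "\<bar>a\<bar>"]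
          mult_left_mono[of "\<bar>v x\<bar>" C' "\<bar>b\<bar>"] C C' by (simp add: abs_mult)
      moreover have split: "(\<integral>x. (a * u x + b * v x) * f x \<partial>\<gamma>) = a * (\<integral>x. u x * f x \<partial>\<gamma>) + b * (\<integral>x. v x * f x \<partial>\<gamma>)"
        if \<gamma>: "\<gamma> \<in> space \<mu>" for \<gamma>
      proof -
        have "(\<integral>x. (a * u x + b * v x) * f x \<partial>\<gamma>) = (\<integral>x. a * (u x * f x) + b * (v x * f x) \<partial>\<gamma>)"
          by (simp add: algebra_simps)
        then show ?thesis
          using integrable_mult_D[OF \<gamma> um C[rule_format] f] integrable_mult_D[OF \<gamma> vm C'[rule_format] f] by simp
      qed
      moreover have "(\<lambda>\<gamma>. \<integral>x. u x * f x \<partial>\<gamma>) \<in> borel_measurable cyl_sigma"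
        "(\<lambda>\<gamma>. \<integral>x. v x * f x \<partial>\<gamma>) \<in> borel_measurable cyl_sigma"
        using u v unfolding H_def by blast+
      then have "(\<lambda>\<gamma>. a * (\<integral>x. u x * f x \<partial>\<gamma>) + b * (\<integral>x. v x * f x \<partial>\<gamma>)) \<in> borel_measurable cyl_sigma"
        by (intro borel_measurable_add borel_measurable_times borel_measurable_const)
      then have "(\<lambda>\<gamma>. \<integral>x. (a * u x + b * v x) * f x \<partial>\<gamma>) \<in> borel_measurable cyl_sigma"
        by (rule measurable_cyl_sigma_cong) (rule split[symmetric])
      moreover have "(\<lambda>x. a * u x + b * v x) \<in> borel_measurable M" by measurable
      ultimately show ?thesis unfolding H_def by blast
    qed
    show "u \<in> H" if U: "\<And>n. U n \<in> H" and C: "\<And>n x. x \<in> UNIV \<Longrightarrow> \<bar>U n x\<bar> \<le> C"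
      and lim: "\<And>x. x \<in> UNIV \<Longrightarrow> (\<lambda>n. U n x) \<longlonglongrightarrow> u x" for U u C
    proof -
      have Um[measurable]: "U n \<in> borel_measurable M" for n using U unfolding H_def by blast
      have um[measurable]: "u \<in> borel_measurable M"
        by (rule borel_measurable_LIMSEQ_real[OF lim Um]) simp
      have uC: "\<bar>u x\<bar> \<le> C" for x
        by (rule LIMSEQ_le_const2[OF tendsto_rabs[OF lim[OF UNIV_I]]]) (use C in auto)
      have conv: "(\<lambda>n. \<integral>x. U n x * f x \<partial>\<gamma>) \<longlonglongrightarrow> (\<integral>x. u x * f x \<partial>\<gamma>)" if \<gamma>: "\<gamma> \<in> space \<mu>" for \<gamma>
      proof (rule integral_dominated_convergence[where w = "\<lambda>x. C * \<bar>f x\<bar>"])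
        show "integrable \<gamma> (\<lambda>x. C * \<bar>f x\<bar>)" using integrable_D[OF \<gamma> f] by simp
        show "(\<lambda>x. u x * f x) \<in> borel_measurable \<gamma>" "(\<lambda>x. U n x * f x) \<in> borel_measurable \<gamma>" for n
          using measurable_config[OF \<gamma> um] measurable_config[OF \<gamma> Um] measurable_config[OF \<gamma> D_measurable[OF f]]
          by measurable
        show "AE x in \<gamma>. (\<lambda>n. U n x * f x) \<longlonglongrightarrow> u x * f x"
          by (intro AE_I2 tendsto_mult tendsto_const lim UNIV_I)
        show "AE x in \<gamma>. norm (U n x * f x) \<le> C * \<bar>f x\<bar>" for n
          using C by (auto simp: abs_mult intro!: mult_right_mono)
      qed
      have "(\<lambda>\<gamma>. \<integral>x. u x * f x \<partial>\<gamma>) \<in> borel_measurable cyl_sigma"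
      proof (rule borel_measurable_LIMSEQ_real)
        show "(\<lambda>n. \<integral>x. U n x * f x \<partial>\<gamma>) \<longlonglongrightarrow> (\<integral>x. u x * f x \<partial>\<gamma>)" if "\<gamma> \<in> space cyl_sigma" for \<gamma>
          using conv that by simp
        show "(\<lambda>\<gamma>. \<integral>x. U n x * f x \<partial>\<gamma>) \<in> borel_measurable cyl_sigma" for n
          using U unfolding H_def by blast
      qed
      then show ?thesis unfolding H_def using um uC by blast
    qed
  qed
  then show ?thesis unfolding H_def by blast
qed

lemma subalgebra_config: "\<gamma> \<in> space \<mu> \<Longrightarrow> subalgebra \<gamma> borel"
  unfolding subalgebra_def using borel_subset sets_config space_config by auto

text \<open>On \<open>{f \<noteq> 0}\<close> a configuration is recovered from the measure with density \<open>f\<^sup>2\<close> by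
  division; countably many such sets cover \<open>nonzero_set\<close>.\<close>

lemma emeasure_borel_measurable:
  assumes B: "B \<in> sets borel"
  shows "(\<lambda>\<gamma>. emeasure \<gamma> (B \<inter> nonzero_set)) \<in> borel_measurable cyl_sigma"
proof -
  obtain f :: "nat \<Rightarrow> 'a \<Rightarrow> real" where f: "\<forall>n. f n \<in> D" and U: "(\<Union>n. {x. f n x \<noteq> 0}) = nonzero_set"
    using nonzero_sequence by blast
  note f = f[rule_format]
  have fb[measurable]: "f n \<in> borel_measurable borel" for n by (rule D_borel[OF f])
  define A where "A = disjointed (\<lambda>n. {x. f n x \<noteq> 0})"
  have A_sub: "A n \<subseteq> {x. f n x \<noteq> 0}" for n unfolding A_def by (rule disjointed_subset)
  have "range (\<lambda>n. {x. f n x \<noteq> 0}) \<subseteq> sets borel"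
    using measurable_sets[OF fb, of "- {0}"] by (auto simp: vimage_def)
  then have A_sets: "A n \<in> sets borel" for n
    unfolding A_def using sets.range_disjointed_sets[of "\<lambda>n. {x. f n x \<noteq> 0}" borel] by blast
  have A_UN: "(\<Union>n. A n) = nonzero_set" unfolding A_def UN_disjointed_eq U ..
  have part: "(\<lambda>\<gamma>. emeasure \<gamma> (B \<inter> A n)) \<in> borel_measurable cyl_sigma" for n
  proof -
    define \<kappa> where "\<kappa> \<gamma> = density \<gamma> (\<lambda>x. ennreal ((f n x)\<^sup>2))" for \<gamma> :: "'a measure"
    define g where "g x = indicator (B \<inter> A n) x * ennreal (1 / (f n x)\<^sup>2)" for x
    have BA: "B \<inter> A n \<in> sets borel" using B A_sets by blast
    have fm: "f n \<in> borel_measurable \<gamma>" if "\<gamma> \<in> space \<mu>" for \<gamma>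
      by (rule measurable_config[OF that D_measurable[OF f]])
    have gb: "g \<in> borel_measurable borel"
      unfolding g_def using BA by measurable
    have "(\<lambda>\<gamma>. \<integral>\<^sup>+x. g x \<partial>\<kappa> \<gamma>) \<in> borel_measurable cyl_sigma"
    proof (rule measurable_nn_integral_kernel[OF _ _ gb])
      show "subalgebra (\<kappa> \<gamma>) borel" if "\<gamma> \<in> space cyl_sigma" for \<gamma>
        using subalgebra_config[of \<gamma>] that unfolding \<kappa>_def subalgebra_def by simp
      fix S :: "'a set" assume S: "S \<in> sets borel"
      have eq: "emeasure (\<kappa> \<gamma>) S = ennreal (\<integral>x. indicator S x * (f n x * f n x) \<partial>\<gamma>)" if \<gamma>: "\<gamma> \<in> space \<mu>" for \<gamma>
      proof -
        have SM: "S \<in> sets M" using S borel_subset by blast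
        then have S': "S \<in> sets \<gamma>" using sets_config[OF \<gamma>] by simp
        have "emeasure (\<kappa> \<gamma>) S = (\<integral>\<^sup>+x. ennreal ((f n x)\<^sup>2) * indicator S x \<partial>\<gamma>)"
          unfolding \<kappa>_def
        proof (rule emeasure_density[OF _ S'])
          note [measurable] = fm[OF \<gamma>]
          show "(\<lambda>x. ennreal ((f n x)\<^sup>2)) \<in> borel_measurable \<gamma>" by measurable
        qed
        also have "\<dots> = (\<integral>\<^sup>+x. ennreal (indicator S x * (f n x * f n x)) \<partial>\<gamma>)"
          by (intro nn_integral_cong) (simp add: indicator_def power2_eq_square)
        also have "\<dots> = ennreal (\<integral>x. indicator S x * (f n x * f n x) \<partial>\<gamma>)"
          by (intro nn_integral_eq_integral integrable_mult_D[OF \<gamma> borel_measurable_indicator[OF SM] _ D_mult[OF f f], of 1])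
            (auto simp: indicator_def)
        finally show ?thesis .
      qed
      have "(\<lambda>\<gamma>. ennreal (\<integral>x. indicator S x * (f n x * f n x) \<partial>\<gamma>)) \<in> borel_measurable cyl_sigma"
        by (rule measurable_compose[OF star_indicator_measurable[OF S D_mult[OF f f]] measurable_ennreal])
      then show "(\<lambda>\<gamma>. emeasure (\<kappa> \<gamma>) S) \<in> borel_measurable cyl_sigma"
        by (rule measurable_cyl_sigma_cong) (rule eq[symmetric])
    qed
    moreover have "(\<integral>\<^sup>+x. g x \<partial>\<kappa> \<gamma>) = emeasure \<gamma> (B \<inter> A n)" if \<gamma>: "\<gamma> \<in> space \<mu>" for \<gamma>
    proof -
      have "(\<integral>\<^sup>+x. g x \<partial>\<kappa> \<gamma>) = (\<integral>\<^sup>+x. ennreal ((f n x)\<^sup>2) * g x \<partial>\<gamma>)"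
        unfolding \<kappa>_def
      proof (rule nn_integral_density[OF _ measurable_from_subalg[OF subalgebra_config[OF \<gamma>] gb]])
        note [measurable] = fm[OF \<gamma>]
        show "(\<lambda>x. ennreal ((f n x)\<^sup>2)) \<in> borel_measurable \<gamma>" by measurable
      qed
      also have "\<dots> = (\<integral>\<^sup>+x. indicator (B \<inter> A n) x \<partial>\<gamma>)"
      proof (rule nn_integral_cong)
        fix x
        show "ennreal ((f n x)\<^sup>2) * g x = indicator (B \<inter> A n) x"
        proof (cases "x \<in> B \<inter> A n")
          case True
          then have "f n x \<noteq> 0" using A_sub by blast
          then show ?thesis using True by (simp add: g_def ennreal_mult'[symmetric])
        qed (simp add: g_def)
      qed
      also have "\<dots> = emeasure \<gamma> (B \<inter> A n)"
        using BA subalgebra_config[OF \<gamma>] unfolding subalgebra_def by (intro nn_integral_indicator) blast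
      finally show ?thesis .
    qed
    ultimately show ?thesis by (rule measurable_cyl_sigma_cong)
  qed
  have total: "emeasure \<gamma> (B \<inter> nonzero_set) = (\<Sum>n. emeasure \<gamma> (B \<inter> A n))" if \<gamma>: "\<gamma> \<in> space \<mu>" for \<gamma>
  proof -
    have "(\<Sum>n. emeasure \<gamma> (B \<inter> A n)) = emeasure \<gamma> (\<Union>n. B \<inter> A n)"
    proof (rule suminf_emeasure)
      show "range (\<lambda>n. B \<inter> A n) \<subseteq> sets \<gamma>"
        using B A_sets subalgebra_config[OF \<gamma>] unfolding subalgebra_def by blast
      show "disjoint_family (\<lambda>n. B \<inter> A n)"
        using disjoint_family_disjointed[of "\<lambda>n. {x. f n x \<noteq> 0}"] unfolding A_def[symmetric] disjoint_family_on_def by blast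
    qed
    also have "(\<Union>n. B \<inter> A n) = B \<inter> nonzero_set" using A_UN by blast
    finally show ?thesis ..
  qed
  have "(\<lambda>\<gamma>. \<Sum>n. emeasure \<gamma> (B \<inter> A n)) \<in> borel_measurable cyl_sigma"
    using part by measurable
  then show ?thesis by (rule measurable_cyl_sigma_cong) (rule total[symmetric])
qed

lemma sets_M_borel_AE:
  assumes A: "A \<in> sets M"
  shows "\<exists>B\<in>sets borel. AE x in M. x \<in> A \<longleftrightarrow> x \<in> B"
proof -
  let ?N = "restr_to_subalg M borel"
  have sub: "subalgebra M borel" unfolding subalgebra_def using borel_subset space_UNIV by simp
  have N_eq: "?N = measure_of UNIV (sets borel) (emeasure M)"
    unfolding restr_to_subalg_def space_UNIV ..
  have sN: "sets ?N = sets borel" by (rule sets_restr_to_subalg[OF sub])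
  have A': "A \<in> sets (completion ?N)" using A subset_completion unfolding N_eq by blast
  obtain N where N: "N \<in> null_sets ?N" "null_part ?N A \<subseteq> N" using null_part[OF A'] by blast
  have Nb: "N \<in> sets borel" using null_setsD2[OF N(1)] sN by simp
  have "emeasure M N = 0" using emeasure_restr_to_subalg[OF sub Nb] null_setsD1[OF N(1)] by simp
  then have "N \<in> null_sets M" using Nb borel_subset by (intro null_setsI) auto
  from AE_not_in[OF this] have "AE x in M. x \<in> A \<longleftrightarrow> x \<in> main_part ?N A"
    using main_part_null_part_Un[OF A'] N(2) by (auto elim!: eventually_mono)
  moreover have "main_part ?N A \<in> sets borel" using main_part_sets[OF A'] sN by simp
  ultimately show ?thesis by blast
qed

text \<open>Sets in \<open>\<Sigma>\<close> are Borel up to \<open>M\<close>-null sets, and \<open>M\<close>-null sets carry no points of almost every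
  configuration.\<close>

lemma emeasure_AE_cyl_sigma:
  assumes A: "A \<in> sets M"
  shows "\<exists>g\<in>borel_measurable cyl_sigma. AE \<gamma> in \<mu>. emeasure \<gamma> A = g \<gamma>"
proof -
  obtain B where B: "B \<in> sets borel" "AE x in M. x \<in> A \<longleftrightarrow> x \<in> B" using sets_M_borel_AE[OF A] by blast
  have nz: "nonzero_set \<in> sets borel"
  proof -
    obtain f :: "nat \<Rightarrow> 'a \<Rightarrow> real" where f: "\<forall>n. f n \<in> D" and U: "(\<Union>n. {x. f n x \<noteq> 0}) = nonzero_set"
      using nonzero_sequence by blast
    have "{x. f n x \<noteq> 0} \<in> sets borel" for n
      using measurable_sets[OF D_borel[OF f[rule_format, of n]], of "- {0}"] by (simp add: vimage_def)
    then show ?thesis unfolding U[symmetric] by blast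
  qed
  have "AE x in M. x \<in> A \<longleftrightarrow> x \<in> B \<inter> nonzero_set"
    using B(2) AE_nonzero_set by eventually_elim simp
  from AE_config[OF this] AE_space[of \<mu>] have "AE \<gamma> in \<mu>. emeasure \<gamma> A = emeasure \<gamma> (B \<inter> nonzero_set)"
  proof eventually_elim
    case (elim \<gamma>)
    then show ?case
      using A B(1) nz borel_subset sets_config[OF elim(2)] by (intro emeasure_eq_AE) auto
  qed
  with emeasure_borel_measurable[OF B(1)] show ?thesis
    by (intro bexI[of _ "\<lambda>\<gamma>. emeasure \<gamma> (B \<inter> nonzero_set)"])
qed

lemma cyl_algebra_generates:
  assumes "A \<in> sets \<mu>"
  shows "\<exists>B\<in>sets cyl_sigma. AE \<gamma> in \<mu>. \<gamma> \<in> A \<longleftrightarrow> \<gamma> \<in> B"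
  using assms unfolding sets_mu_eq
proof induction
  case (Basic A)
  then obtain E S where A: "A = (\<lambda>\<gamma>. emeasure \<gamma> E) -` S \<inter> configs M \<E>" and E: "E \<in> \<E>" and S: "S \<in> sets borel"
    by blast
  obtain g where g: "g \<in> borel_measurable cyl_sigma" "AE \<gamma> in \<mu>. emeasure \<gamma> E = g \<gamma>"
    using emeasure_AE_cyl_sigma[OF E_sets[OF E]] by blast
  have "g -` S \<inter> space cyl_sigma \<in> sets cyl_sigma" using g(1) S by (rule measurable_sets)
  moreover have "AE \<gamma> in \<mu>. \<gamma> \<in> A \<longleftrightarrow> \<gamma> \<in> g -` S \<inter> space cyl_sigma"
    using g(2) AE_space[of \<mu>] by eventually_elim (simp add: A space_mu)
  ultimately show ?case by blast
next
  case Empty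
  then show ?case by (intro bexI[of _ "{}"]) auto
next
  case (Compl A)
  then obtain B where B: "B \<in> sets cyl_sigma" "AE \<gamma> in \<mu>. \<gamma> \<in> A \<longleftrightarrow> \<gamma> \<in> B" by blast
  have "space cyl_sigma - B \<in> sets cyl_sigma" using B(1) by blast
  moreover have "AE \<gamma> in \<mu>. \<gamma> \<in> configs M \<E> - A \<longleftrightarrow> \<gamma> \<in> space cyl_sigma - B"
    using B(2) AE_space[of \<mu>] by eventually_elim (simp add: space_mu)
  ultimately show ?case by blast
next
  case (Union A)
  then have "\<forall>i. \<exists>B. B \<in> sets cyl_sigma \<and> (AE \<gamma> in \<mu>. \<gamma> \<in> A i \<longleftrightarrow> \<gamma> \<in> B)" by blast
  from choice[OF this] obtain B where B: "\<forall>i. B i \<in> sets cyl_sigma \<and> (AE \<gamma> in \<mu>. \<gamma> \<in> A i \<longleftrightarrow> \<gamma> \<in> B i)" by blast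
  have "(\<Union>i. B i) \<in> sets cyl_sigma" using B by blast
  moreover have "AE \<gamma> in \<mu>. \<forall>i. \<gamma> \<in> A i \<longleftrightarrow> \<gamma> \<in> B i" unfolding AE_all_countable using B by blast
  then have "AE \<gamma> in \<mu>. \<gamma> \<in> (\<Union>i. A i) \<longleftrightarrow> \<gamma> \<in> (\<Union>i. B i)" by eventually_elim simp
  ultimately show ?case by blast
qed

theorem cyl_algebra_dense:
  assumes "v \<in> L2 \<mu>"
  shows "v \<in> L2_limits \<mu> cyl_algebra"
proof (rule L2_limits_algebra[OF _ _ _ _ _ _ _ assms])
  show "finite_measure \<mu>" using prob_mu by (simp add: prob_space_def)
  show "cyl_algebra \<subseteq> borel_measurable \<mu>" unfolding cyl_algebra_def using cyl_fun_measurable by blast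
  show "(\<lambda>_. c) \<in> cyl_algebra" for c
  proof -
    obtain t where "t \<in> cyl_data D" "cyl_fun t = (\<lambda>\<gamma>. c)" using cyl_fun_const by blast
    then show ?thesis unfolding cyl_algebra_def by (metis image_eqI)
  qed
  show "(\<lambda>\<gamma>. u \<gamma> + v \<gamma>) \<in> cyl_algebra" if u: "u \<in> cyl_algebra" and v: "v \<in> cyl_algebra" for u v
  proof -
    obtain r s where r: "r \<in> cyl_data D" "u = cyl_fun r" and s: "s \<in> cyl_data D" "v = cyl_fun s"
      using u v unfolding cyl_algebra_def by blast
    obtain t where t: "t \<in> cyl_data D" "cyl_fun t = (\<lambda>\<gamma>. 1 * cyl_fun r \<gamma> + 1 * cyl_fun s \<gamma>)"
      using cyl_fun_linear[OF r(1) s(1)] by blast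
    have "(\<lambda>\<gamma>. u \<gamma> + v \<gamma>) = cyl_fun t" unfolding t(2) r(2) s(2) by simp
    with t(1) show ?thesis unfolding cyl_algebra_def by blast
  qed
  show "(\<lambda>\<gamma>. u \<gamma> * v \<gamma>) \<in> cyl_algebra" if u: "u \<in> cyl_algebra" and v: "v \<in> cyl_algebra" for u v
  proof -
    obtain r s where r: "r \<in> cyl_data D" "u = cyl_fun r" and s: "s \<in> cyl_data D" "v = cyl_fun s"
      using u v unfolding cyl_algebra_def by blast
    obtain t where t: "t \<in> cyl_data D" "cyl_fun t = (\<lambda>\<gamma>. cyl_fun r \<gamma> * cyl_fun s \<gamma>)"
      using cyl_fun_mult[OF r(1) s(1)] by blast
    have "(\<lambda>\<gamma>. u \<gamma> * v \<gamma>) = cyl_fun t" unfolding t(2) r(2) s(2) by simp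
    with t(1) show ?thesis unfolding cyl_algebra_def by blast
  qed
  show "\<exists>C. \<forall>\<gamma>\<in>space \<mu>. \<bar>u \<gamma>\<bar> \<le> C" if "u \<in> cyl_algebra" for u
    using that cyl_fun_bound unfolding cyl_algebra_def by blast
  show "\<exists>B\<in>sigma_sets (space \<mu>) {u -` {a<..} \<inter> space \<mu> |u a. u \<in> cyl_algebra}. AE \<gamma> in \<mu>. \<gamma> \<in> A \<longleftrightarrow> \<gamma> \<in> B"
    if "A \<in> sets \<mu>" for A
    using cyl_algebra_generates[OF that] unfolding sets_cyl_sigma .
qed

end


section \<open>The form on classes of cylinder functions\<close>

lemma CylE:
  assumes "u \<in> Cyl \<mu> D"
  shows "\<exists>r\<in>cyl_data D. AE \<gamma> in \<mu>. u \<gamma> = cyl_fun r \<gamma>"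
  using assms unfolding Cyl_def by blast

lemma form_approx_cong:
  assumes sub: "\<And>u v. u \<in> D \<Longrightarrow> v \<in> D \<Longrightarrow> (\<lambda>x. u x - v x) \<in> D"
    and eq: "\<And>u v. u \<in> D \<Longrightarrow> v \<in> D \<Longrightarrow> Q' u v = Q u v"
  shows "form_approx M D Q' = form_approx M D Q"
proof (intro ext)
  fix v u
  have "form_Cauchy Q' u \<longleftrightarrow> form_Cauchy Q u" if "\<forall>n. u n \<in> D"
  proof -
    have d: "(\<lambda>x. u i x - u j x) \<in> D" for i j using sub that by blast
    show ?thesis unfolding form_Cauchy_def eq[OF d d] ..
  qed
  then show "form_approx M D Q' v u = form_approx M D Q v u" unfolding form_approx_def by blast
qed

text \<open>The closure of a form only depends on its values on the domain.\<close>

lemma closure_cong: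
  assumes sub: "\<And>u v. u \<in> D \<Longrightarrow> v \<in> D \<Longrightarrow> (\<lambda>x. u x - v x) \<in> D"
    and eq: "\<And>u v. u \<in> D \<Longrightarrow> v \<in> D \<Longrightarrow> Q' u v = Q u v"
  shows "closure_dom M D Q' = closure_dom M D Q" and "closure_form M D Q' v w = closure_form M D Q v w"
proof -
  have approx: "form_approx M D Q' = form_approx M D Q"
    by (rule form_approx_cong[OF sub eq])
  then show "closure_dom M D Q' = closure_dom M D Q" unfolding closure_dom_def by simp
  have "form_approx M D Q v p \<and> form_approx M D Q w q \<and> (\<lambda>n. Q' (p n) (q n)) \<longlonglongrightarrow> c \<longleftrightarrow>
      form_approx M D Q v p \<and> form_approx M D Q w q \<and> (\<lambda>n. Q (p n) (q n)) \<longlonglongrightarrow> c" for p q c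
  proof (cases "form_approx M D Q v p \<and> form_approx M D Q w q")
    case True
    then have "Q' (p n) (q n) = Q (p n) (q n)" for n unfolding form_approx_def by (intro eq) auto
    then show ?thesis by simp
  qed blast
  then show "closure_form M D Q' v w = closure_form M D Q v w"
    unfolding closure_form_def approx by simp
qed

context GNZ_configs begin

lemma cyl_form_eq_energy:
  assumes L: "strong_lifting M L" and r: "r \<in> cyl_data D" and s: "s \<in> cyl_data D"
    and u: "AE \<gamma> in \<mu>. u \<gamma> = cyl_fun r \<gamma>" and v: "AE \<gamma> in \<mu>. v \<gamma> = cyl_fun s \<gamma>"
  shows "cyl_form \<mu> D \<Gamma> L u v = energy (cyl_fun r) (cyl_fun s)"
  unfolding cyl_form_def
proof (rule the_equality)
  show "\<exists>r'\<in>cyl_data D. \<exists>s'\<in>cyl_data D. (AE \<gamma> in \<mu>. u \<gamma> = cyl_fun r' \<gamma>) \<and> (AE \<gamma> in \<mu>. v \<gamma> = cyl_fun s' \<gamma>) \<and>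
      energy (cyl_fun r) (cyl_fun s) = (\<integral>\<gamma>. cyl_Gamma \<Gamma> L r' s' \<gamma> \<partial>\<mu>)"
    by (intro bexI[OF _ r] bexI[OF _ s] conjI u v cyl_Gamma_energy(3)[OF L r s, symmetric])
next
  fix c
  assume "\<exists>r\<in>cyl_data D. \<exists>s\<in>cyl_data D. (AE \<gamma> in \<mu>. u \<gamma> = cyl_fun r \<gamma>) \<and> (AE \<gamma> in \<mu>. v \<gamma> = cyl_fun s \<gamma>) \<and>
      c = (\<integral>\<gamma>. cyl_Gamma \<Gamma> L r s \<gamma> \<partial>\<mu>)"
  then obtain r' s' where r': "r' \<in> cyl_data D" and s': "s' \<in> cyl_data D"
    and u': "AE \<gamma> in \<mu>. u \<gamma> = cyl_fun r' \<gamma>" and v': "AE \<gamma> in \<mu>. v \<gamma> = cyl_fun s' \<gamma>"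
    and c: "c = (\<integral>\<gamma>. cyl_Gamma \<Gamma> L r' s' \<gamma> \<partial>\<mu>)" by blast
  have "AE \<gamma> in \<mu>. cyl_fun r' \<gamma> = cyl_fun r \<gamma>" using u u' by eventually_elim simp
  moreover have "AE \<gamma> in \<mu>. cyl_fun s' \<gamma> = cyl_fun s \<gamma>" using v v' by eventually_elim simp
  ultimately show "c = energy (cyl_fun r) (cyl_fun s)"
    unfolding c cyl_Gamma_energy(3)[OF L r' s'] by (rule energy_cong[OF r' r s' s])
qed

lemma Cyl_linear:
  assumes u: "u \<in> Cyl \<mu> D" and v: "v \<in> Cyl \<mu> D"
  shows "(\<lambda>\<gamma>. a * u \<gamma> + b * v \<gamma>) \<in> Cyl \<mu> D"
proof -
  obtain r where r: "r \<in> cyl_data D" "AE \<gamma> in \<mu>. u \<gamma> = cyl_fun r \<gamma>" using CylE[OF u] by blast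
  obtain s where s: "s \<in> cyl_data D" "AE \<gamma> in \<mu>. v \<gamma> = cyl_fun s \<gamma>" using CylE[OF v] by blast
  obtain t where t: "t \<in> cyl_data D" "cyl_fun t = (\<lambda>\<gamma>. a * cyl_fun r \<gamma> + b * cyl_fun s \<gamma>)"
    using cyl_fun_linear[OF r(1) s(1)] by blast
  have "AE \<gamma> in \<mu>. a * u \<gamma> + b * v \<gamma> = cyl_fun t \<gamma>"
    using r(2) s(2) by eventually_elim (simp add: t(2))
  moreover have "(\<lambda>\<gamma>. a * u \<gamma> + b * v \<gamma>) \<in> borel_measurable \<mu>"
    using u v unfolding Cyl_def by (intro borel_measurable_add borel_measurable_times borel_measurable_const) auto
  ultimately show ?thesis unfolding Cyl_def using t(1) by blast
qed

lemma Cyl_diff: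
  assumes "u \<in> Cyl \<mu> D" "v \<in> Cyl \<mu> D"
  shows "(\<lambda>\<gamma>. u \<gamma> - v \<gamma>) \<in> Cyl \<mu> D"
  using Cyl_linear[OF assms, of 1 "-1"] by simp

lemma cyl_fun_in_Cyl:
  assumes "r \<in> cyl_data D"
  shows "cyl_fun r \<in> Cyl \<mu> D"
  using cyl_fun_measurable[OF assms] assms unfolding Cyl_def by blast

lemma Cyl_subset_L2: "Cyl \<mu> D \<subseteq> L2 \<mu>"
proof
  fix u assume u: "u \<in> Cyl \<mu> D"
  then have um[measurable]: "u \<in> borel_measurable \<mu>" unfolding Cyl_def by blast
  obtain r where r: "r \<in> cyl_data D" "AE \<gamma> in \<mu>. u \<gamma> = cyl_fun r \<gamma>" using CylE[OF u] by blast
  obtain C where C: "\<forall>\<gamma>. \<bar>cyl_fun r \<gamma>\<bar> \<le> C" using cyl_fun_bound[OF r(1)] by blast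
  interpret finite_measure \<mu> using prob_mu by (simp add: prob_space_def)
  have "integrable \<mu> (\<lambda>\<gamma>. (u \<gamma>)\<^sup>2)"
  proof (rule integrable_const_bound[where B = "C\<^sup>2"])
    show "AE \<gamma> in \<mu>. norm ((u \<gamma>)\<^sup>2) \<le> C\<^sup>2"
      using r(2)
    proof eventually_elim
      case (elim \<gamma>)
      have "\<bar>u \<gamma>\<bar>\<^sup>2 \<le> C\<^sup>2" using C unfolding elim by (intro power_mono) auto
      then show ?case by simp
    qed
  qed measurable
  then show "u \<in> L2 \<mu>" unfolding L2_def using um by blast
qed

lemma cyl_form_is_form:
  assumes L: "strong_lifting M L"
  shows "form_on_L2 \<mu> (Cyl \<mu> D) (cyl_form \<mu> D \<Gamma> L)"
  unfolding form_on_L2_def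
proof (intro conjI ballI allI)
  show "Cyl \<mu> D \<subseteq> L2 \<mu>" by (rule Cyl_subset_L2)
  obtain t where "t \<in> cyl_data D" "cyl_fun t = (\<lambda>\<gamma>. 0)" using cyl_fun_const by blast
  then show "(\<lambda>_. 0) \<in> Cyl \<mu> D" using cyl_fun_in_Cyl by metis
  fix u assume u: "u \<in> Cyl \<mu> D"
  obtain r where r: "r \<in> cyl_data D" "AE \<gamma> in \<mu>. u \<gamma> = cyl_fun r \<gamma>" using CylE[OF u] by blast
  show "0 \<le> cyl_form \<mu> D \<Gamma> L u u"
    unfolding cyl_form_eq_energy[OF L r(1) r(1) r(2) r(2)] by (rule energy_nonneg[OF r(1)])
  fix v assume v: "v \<in> Cyl \<mu> D"
  obtain s where s: "s \<in> cyl_data D" "AE \<gamma> in \<mu>. v \<gamma> = cyl_fun s \<gamma>" using CylE[OF v] by blast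
  show "cyl_form \<mu> D \<Gamma> L u v = cyl_form \<mu> D \<Gamma> L v u"
    unfolding cyl_form_eq_energy[OF L r(1) s(1) r(2) s(2)] cyl_form_eq_energy[OF L s(1) r(1) s(2) r(2)]
    by (rule energy_sym[OF r(1) s(1)])
  show "(\<lambda>\<gamma>. a * u \<gamma> + b * v \<gamma>) \<in> Cyl \<mu> D" for a b by (rule Cyl_linear[OF u v])
  fix z a b assume z: "z \<in> Cyl \<mu> D"
  obtain t where t: "t \<in> cyl_data D" "AE \<gamma> in \<mu>. z \<gamma> = cyl_fun t \<gamma>" using CylE[OF z] by blast
  obtain q where q: "q \<in> cyl_data D" "cyl_fun q = (\<lambda>\<gamma>. a * cyl_fun r \<gamma> + b * cyl_fun s \<gamma>)"
    using cyl_fun_linear[OF r(1) s(1)] by blast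
  have ae: "AE \<gamma> in \<mu>. a * u \<gamma> + b * v \<gamma> = cyl_fun q \<gamma>"
    using r(2) s(2) by eventually_elim (simp add: q(2))
  show "cyl_form \<mu> D \<Gamma> L (\<lambda>\<gamma>. a * u \<gamma> + b * v \<gamma>) z = a * cyl_form \<mu> D \<Gamma> L u z + b * cyl_form \<mu> D \<Gamma> L v z"
    unfolding cyl_form_eq_energy[OF L q(1) t(1) ae t(2)] cyl_form_eq_energy[OF L r(1) t(1) r(2) t(2)]
      cyl_form_eq_energy[OF L s(1) t(1) s(2) t(2)]
    by (rule energy_linear[OF L r(1) s(1) t(1) q])
qed

lemma Cyl_dense: "L2_dense \<mu> (Cyl \<mu> D)"
  unfolding L2_dense_def
proof (intro conjI ballI)
  show "Cyl \<mu> D \<subseteq> L2 \<mu>" by (rule Cyl_subset_L2)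
  fix v assume "v \<in> L2 \<mu>"
  then obtain u where u: "\<forall>n. u n \<in> cyl_algebra" "L2_tendsto \<mu> u v"
    using cyl_algebra_dense unfolding L2_limits_def by blast
  have "cyl_algebra \<subseteq> Cyl \<mu> D" unfolding cyl_algebra_def by (rule image_subsetI) (rule cyl_fun_in_Cyl)
  with u(1) have "\<forall>n. u n \<in> Cyl \<mu> D" by blast
  with u(2) show "\<exists>u. (\<forall>n. u n \<in> Cyl \<mu> D) \<and> L2_tendsto \<mu> u v" by blast
qed

lemma cyl_form_closable:
  assumes L: "strong_lifting M L"
  shows "closable_form \<mu> (Cyl \<mu> D) (cyl_form \<mu> D \<Gamma> L)"
  unfolding closable_form_def
proof (intro allI impI, elim conjE)
  fix u
  assume u: "\<forall>n. u n \<in> Cyl \<mu> D" and Cauchy: "form_Cauchy (cyl_form \<mu> D \<Gamma> L) u"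
    and lim: "L2_tendsto \<mu> u (\<lambda>_. 0)"
  have "\<forall>n. \<exists>r. r \<in> cyl_data D \<and> (AE \<gamma> in \<mu>. u n \<gamma> = cyl_fun r \<gamma>)" using u CylE by blast
  from choice[OF this] obtain r where r: "\<And>n. r n \<in> cyl_data D" "\<And>n. AE \<gamma> in \<mu>. u n \<gamma> = cyl_fun (r n) \<gamma>"
    by blast
  have "\<forall>p. \<exists>t. t \<in> cyl_data D \<and> cyl_fun t = (\<lambda>\<gamma>. 1 * cyl_fun (r (fst p)) \<gamma> + (-1) * cyl_fun (r (snd p)) \<gamma>)"
    using cyl_fun_linear[OF r(1) r(1)] by blast
  from choice[OF this] obtain t where t: "\<And>p. t p \<in> cyl_data D"
    "\<And>p. cyl_fun (t p) = (\<lambda>\<gamma>. 1 * cyl_fun (r (fst p)) \<gamma> + (-1) * cyl_fun (r (snd p)) \<gamma>)" by blast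
  define d where "d i j = t (i, j)" for i j
  have d: "d i j \<in> cyl_data D" "cyl_fun (d i j) = (\<lambda>\<gamma>. cyl_fun (r i) \<gamma> - cyl_fun (r j) \<gamma>)" for i j
    unfolding d_def using t(1) by (simp_all add: t(2))
  have ae: "AE \<gamma> in \<mu>. u i \<gamma> - u j \<gamma> = cyl_fun (d i j) \<gamma>" for i j
    using r(2)[of i] r(2)[of j] by eventually_elim (simp add: d(2))
  have "(\<lambda>n. energy (cyl_fun (r n)) (cyl_fun (r n))) \<longlonglongrightarrow> 0"
  proof (rule energy_closable[OF L r(1) d])
    fix e :: real assume "0 < e"
    then show "\<exists>N. \<forall>i\<ge>N. \<forall>j\<ge>N. energy (cyl_fun (d i j)) (cyl_fun (d i j)) < e"
      using Cauchy unfolding form_Cauchy_def cyl_form_eq_energy[OF L d(1) d(1) ae ae] by blast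
  next
    have "(\<integral>\<^sup>+\<gamma>. ennreal ((u n \<gamma> - 0)\<^sup>2) \<partial>\<mu>) = (\<integral>\<^sup>+\<gamma>. ennreal ((cyl_fun (r n) \<gamma>)\<^sup>2) \<partial>\<mu>)" for n
      using r(2)[of n] by (intro nn_integral_cong_AE) auto
    then show "(\<lambda>n. \<integral>\<^sup>+\<gamma>. ennreal ((cyl_fun (r n) \<gamma>)\<^sup>2) \<partial>\<mu>) \<longlonglongrightarrow> 0"
      using lim unfolding L2_tendsto_def by simp
  qed
  then show "(\<lambda>n. cyl_form \<mu> D \<Gamma> L (u n) (u n)) \<longlonglongrightarrow> 0"
    unfolding cyl_form_eq_energy[OF L r(1) r(1) r(2) r(2)] .
qed

lemma cyl_form_lifting_independent:
  assumes L: "strong_lifting M L" and L': "strong_lifting M L'" and u: "u \<in> Cyl \<mu> D" and v: "v \<in> Cyl \<mu> D"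
  shows "cyl_form \<mu> D \<Gamma> L' u v = cyl_form \<mu> D \<Gamma> L u v"
proof -
  obtain r where r: "r \<in> cyl_data D" "AE \<gamma> in \<mu>. u \<gamma> = cyl_fun r \<gamma>" using CylE[OF u] by blast
  obtain s where s: "s \<in> cyl_data D" "AE \<gamma> in \<mu>. v \<gamma> = cyl_fun s \<gamma>" using CylE[OF v] by blast
  show ?thesis
    unfolding cyl_form_eq_energy[OF L r(1) s(1) r(2) s(2)] cyl_form_eq_energy[OF L' r(1) s(1) r(2) s(2)] ..
qed

end

text \<open>In the assumption on \<open>\<mu>\<close> the degeneracy condition refers to \<open>\<l> (\<Gamma> f g)\<close>, which equals
  \<open>\<Gamma> f g\<close> almost everywhere for all measures absolutely continuous with respect to \<open>M\<close>.\<close>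

lemma GNZ_configs_if_GNZ:
  assumes tlds: "topological_local_diffusion_space M \<E> D \<Gamma>"
    and lifting: "strong_lifting M \<l>"
    and prob: "prob_space \<mu>"
    and sets_mu: "sets \<mu> = sets (config_space M \<E>)"
    and gnz: "GNZ M \<E> D \<Gamma> \<l> \<mu>"
  shows "\<exists>\<rho> w. GNZ_configs M \<E> D \<Gamma> \<mu> \<rho> w"
proof -
  interpret topological_local_diffusion_space M \<E> D \<Gamma> by fact
  let ?R = "\<lambda>\<rho>. (\<forall>p\<in>space (\<mu> \<Otimes>\<^sub>M M). 0 \<le> \<rho> p) \<and> GNZ_identity M \<mu> \<rho> \<and>
      (AE \<gamma> in \<mu>. \<forall>f\<in>D. (AE x in cond_measure M \<rho> \<gamma>. f x = 0) \<longrightarrow>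
           (\<forall>g\<in>D. AE x in cond_measure M \<rho> \<gamma>. \<l> (\<Gamma> f g) x = 0))"
  let ?W = "\<lambda>\<rho> w. (\<forall>x\<in>space M. 0 < w x \<and> w x \<le> 1) \<and> integrable (intensity M \<mu>) w \<and>
      (AE \<gamma> in \<mu>. closable_form (density (cond_measure M \<rho> \<gamma>) (\<lambda>x. ennreal (w x))) D
              (\<lambda>f g. \<integral>x. \<Gamma> f g x * w x \<partial>cond_measure M \<rho> \<gamma>))"
  note gnz' = gnz[unfolded GNZ_def conj_assoc]
  have fin: "\<forall>E\<in>\<E>. (\<integral>\<^sup>+\<gamma>. emeasure \<gamma> E \<partial>\<mu>) < \<infinity>" by (rule conjunct1[OF gnz'])
  have "\<exists>\<rho>\<in>borel_measurable (\<mu> \<Otimes>\<^sub>M M). ?R \<rho> \<and> (\<exists>w\<in>borel_measurable M. ?W \<rho> w)"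
    unfolding conj_assoc by (rule conjunct2[OF gnz'])
  then obtain \<rho> where rho_meas: "\<rho> \<in> borel_measurable (\<mu> \<Otimes>\<^sub>M M)"
    and RW: "?R \<rho> \<and> (\<exists>w\<in>borel_measurable M. ?W \<rho> w)" by (rule bexE)
  note R = conjunct1[OF RW]
  from conjunct2[OF RW] obtain w where w_meas: "w \<in> borel_measurable M" and W: "?W \<rho> w" by (rule bexE)
  note rho = rho_meas conjunct1[OF R] conjunct1[OF conjunct2[OF R]]
    and deg = conjunct2[OF conjunct2[OF R]]
  note w = w_meas conjunct1[OF W] conjunct1[OF conjunct2[OF W]]
    and clos = conjunct2[OF conjunct2[OF W]]
  have deg': "AE \<gamma> in \<mu>. \<forall>f\<in>D. (AE x in cond_measure M \<rho> \<gamma>. f x = 0) \<longrightarrow>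
      (\<forall>g\<in>D. AE x in cond_measure M \<rho> \<gamma>. \<Gamma> f g x = 0)"
    using deg AE_space[of \<mu>]
  proof eventually_elim
    case (elim \<gamma>)
    have rm: "(\<lambda>x. ennreal (\<rho> (\<gamma>, x))) \<in> borel_measurable M"
      using measurable_compose[OF measurable_Pair1'[OF elim(2)] rho(1)] by simp
    show ?case
    proof (intro ballI impI)
      fix f g assume f: "f \<in> D" and g: "g \<in> D" and ae: "AE x in cond_measure M \<rho> \<gamma>. f x = 0"
      have "AE x in M. \<l> (\<Gamma> f g) x = \<Gamma> f g x"
        using lifting Gamma_Linf[OF f g] unfolding strong_lifting_def by (elim conjE) blast
      then have "AE x in cond_measure M \<rho> \<gamma>. \<l> (\<Gamma> f g) x = \<Gamma> f g x"
        unfolding cond_measure_def AE_density[OF rm] by eventually_elim simp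
      moreover have "AE x in cond_measure M \<rho> \<gamma>. \<l> (\<Gamma> f g) x = 0"
        by (rule bspec[OF mp[OF bspec[OF elim(1) f] ae] g])
      ultimately show "AE x in cond_measure M \<rho> \<gamma>. \<Gamma> f g x = 0" by eventually_elim simp
    qed
  qed
  have "diffusion_configs M \<E> D \<Gamma> \<mu>"
    by (intro diffusion_configs.intro diffusion_configs_axioms.intro tlds prob sets_mu)
  moreover have "GNZ_configs_axioms M \<E> D \<Gamma> \<mu> \<rho> w"
  proof (rule GNZ_configs_axioms.intro)
    show "(\<integral>\<^sup>+\<gamma>. emeasure \<gamma> E \<partial>\<mu>) < \<infinity>" if "E \<in> \<E>" for E by (rule bspec[OF fin that])
    show "0 \<le> \<rho> p" if "p \<in> space (\<mu> \<Otimes>\<^sub>M M)" for p by (rule bspec[OF rho(2) that])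
    show "0 < w x" "w x \<le> 1" for x using w(2) space_UNIV by auto
  qed (fact rho(1) rho(3) deg' w(1) w(3) clos)+
  ultimately have "GNZ_configs M \<E> D \<Gamma> \<mu> \<rho> w" by (rule GNZ_configs.intro)
  then show ?thesis by blast
qed

theorem proposition3p9:
  fixes M :: "'a::t2_space measure"
    and \<E> :: "'a set set"
    and D :: "('a \<Rightarrow> real) set"
    and \<Gamma> :: "('a \<Rightarrow> real) \<Rightarrow> ('a \<Rightarrow> real) \<Rightarrow> 'a \<Rightarrow> real"
    and \<l> :: "('a \<Rightarrow> real) \<Rightarrow> 'a \<Rightarrow> real"
    and \<mu> :: "'a measure measure"
  assumes tlds: "topological_local_diffusion_space M \<E> D \<Gamma>"
    and lifting: "strong_lifting M \<l>"
    and prob: "prob_space \<mu>"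
    and sets_mu: "sets \<mu> = sets (config_space M \<E>)"
    and gnz: "GNZ M \<E> D \<Gamma> \<l> \<mu>"
  shows "(\<forall>r\<in>cyl_data D. \<forall>s\<in>cyl_data D. integrable \<mu> (cyl_Gamma \<Gamma> \<l> r s))
    \<and> (\<forall>r\<in>cyl_data D. \<forall>r'\<in>cyl_data D. \<forall>s\<in>cyl_data D. \<forall>s'\<in>cyl_data D.
          (AE \<gamma> in \<mu>. cyl_fun r \<gamma> = cyl_fun r' \<gamma>) \<longrightarrow> (AE \<gamma> in \<mu>. cyl_fun s \<gamma> = cyl_fun s' \<gamma>) \<longrightarrow>
          (\<integral>\<gamma>. cyl_Gamma \<Gamma> \<l> r s \<gamma> \<partial>\<mu>) = (\<integral>\<gamma>. cyl_Gamma \<Gamma> \<l> r' s' \<gamma> \<partial>\<mu>))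
    \<and> form_on_L2 \<mu> (Cyl \<mu> D) (cyl_form \<mu> D \<Gamma> \<l>)
    \<and> L2_dense \<mu> (Cyl \<mu> D)
    \<and> closable_form \<mu> (Cyl \<mu> D) (cyl_form \<mu> D \<Gamma> \<l>)
    \<and> (\<forall>\<l>'. strong_lifting M \<l>' \<longrightarrow>
          (\<forall>u\<in>Cyl \<mu> D. \<forall>v\<in>Cyl \<mu> D. cyl_form \<mu> D \<Gamma> \<l>' u v = cyl_form \<mu> D \<Gamma> \<l> u v) \<and>
          closure_dom \<mu> (Cyl \<mu> D) (cyl_form \<mu> D \<Gamma> \<l>') = closure_dom \<mu> (Cyl \<mu> D) (cyl_form \<mu> D \<Gamma> \<l>) \<and>
          (\<forall>u\<in>closure_dom \<mu> (Cyl \<mu> D) (cyl_form \<mu> D \<Gamma> \<l>).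
             \<forall>v\<in>closure_dom \<mu> (Cyl \<mu> D) (cyl_form \<mu> D \<Gamma> \<l>).
               closure_form \<mu> (Cyl \<mu> D) (cyl_form \<mu> D \<Gamma> \<l>') u v =
               closure_form \<mu> (Cyl \<mu> D) (cyl_form \<mu> D \<Gamma> \<l>) u v))"
proof -
  obtain \<rho> w where "GNZ_configs M \<E> D \<Gamma> \<mu> \<rho> w"
    using GNZ_configs_if_GNZ[OF tlds lifting prob sets_mu gnz] by blast
  then interpret GNZ_configs M \<E> D \<Gamma> \<mu> \<rho> w .
  show ?thesis
  proof (intro conjI ballI allI impI)
    fix r s assume r: "r \<in> cyl_data D" and s: "s \<in> cyl_data D"
    show "integrable \<mu> (cyl_Gamma \<Gamma> \<l> r s)" by (rule cyl_Gamma_energy(1)[OF lifting r s])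
  next
    fix r r' s s' assume r: "r \<in> cyl_data D" "r' \<in> cyl_data D" and s: "s \<in> cyl_data D" "s' \<in> cyl_data D"
      and ae: "AE \<gamma> in \<mu>. cyl_fun r \<gamma> = cyl_fun r' \<gamma>" "AE \<gamma> in \<mu>. cyl_fun s \<gamma> = cyl_fun s' \<gamma>"
    show "(\<integral>\<gamma>. cyl_Gamma \<Gamma> \<l> r s \<gamma> \<partial>\<mu>) = (\<integral>\<gamma>. cyl_Gamma \<Gamma> \<l> r' s' \<gamma> \<partial>\<mu>)"
      unfolding cyl_Gamma_energy(3)[OF lifting r(1) s(1)] cyl_Gamma_energy(3)[OF lifting r(2) s(2)]
      by (rule energy_cong[OF r s ae])
  next
    show "form_on_L2 \<mu> (Cyl \<mu> D) (cyl_form \<mu> D \<Gamma> \<l>)" by (rule cyl_form_is_form[OF lifting])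
    show "L2_dense \<mu> (Cyl \<mu> D)" by (rule Cyl_dense)
    show "closable_form \<mu> (Cyl \<mu> D) (cyl_form \<mu> D \<Gamma> \<l>)" by (rule cyl_form_closable[OF lifting])
  next
    fix \<l>' assume lifting': "strong_lifting M \<l>'"
    note indep = cyl_form_lifting_independent[OF lifting lifting']
    show "cyl_form \<mu> D \<Gamma> \<l>' u v = cyl_form \<mu> D \<Gamma> \<l> u v" if "u \<in> Cyl \<mu> D" "v \<in> Cyl \<mu> D" for u v
      by (rule indep[OF that])
    show "closure_dom \<mu> (Cyl \<mu> D) (cyl_form \<mu> D \<Gamma> \<l>') = closure_dom \<mu> (Cyl \<mu> D) (cyl_form \<mu> D \<Gamma> \<l>)"
      by (rule closure_cong(1)[OF Cyl_diff indep])
    show "closure_form \<mu> (Cyl \<mu> D) (cyl_form \<mu> D \<Gamma> \<l>') u v = closure_form \<mu> (Cyl \<mu> D) (cyl_form \<mu> D \<Gamma> \<l>) u v" for u v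
      by (rule closure_cong(2)[OF Cyl_diff indep])
  qed
qed

end
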